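(* Let $0\leq k'\leq k$ and $0\leq \ell'\leq \ell$. Set $\mathcal{A}= \mathbb{C}\langle X_1,\ldots,X_k,Y_1,\ldots,Y_{\ell}\rangle$, $\mathcal{A}_1=\mathbb{C}\langle X_1,\ldots,X_k\rangle$, $\mathcal{A}_2=\mathbb{C}\langle Y_1,\ldots,Y_{\ell}\rangle$; let $\mathcal{I}_1$ be the ideal of $\mathcal{A}_1$ generated by $X_1,\ldots,X_{k'}$, $\mathcal{I}_2$ the ideal of $\mathcal{A}_2$ generated by $Y_1,\ldots,Y_{\ell'}$, and $\mathcal{I}$ the ideal of $\mathcal{A}$ generated by $\mathcal{I}_1\cup \mathcal{I}_2$. Let $(\mathbf{A}_N)_{N\geq 1}$ and $(\mathbf{B}_N)_{N\geq 1}$ be two deterministic sequences of $k$-tuples and $\ell$-tuples of real symmetric $N\times N$ matrices, and assume there are maps $\tau:\mathcal{A}_1\cup\mathcal{A}_2\to\mathbb{C}$ and $\tau':\mathcal{I}_1\cup\mathcal{I}_2\to\mathbb{C}$ with $\tau_{\mathbf{A}_N}(P)=\tau(P)+o(1)$ for $P\in \mathcal{A}_1$, $\tau_{\mathbf{A}_N}(P)=\frac{1}{N}\tau'(P)+o(N^{-1})$ for $P\in \mathcal{I}_1$, $\tau_{\mathbf{B}_N}(P)=\tau(P)+o(1)$ for $P\in\mathcal{A}_2$, and $\tau_{\mathbf{B}_N}(P)=\frac{1}{N}\tau'(P)+o(N^{-1})$ for $P\in \mathcal{I}_2$. Let $(U_N)_{N\geq 1}$ be a sequence of random orthogonal matrices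 of size $N$, uniformly (Haar) distributed in $O(N)$ or in $SO(N)$. Then $\tau$ extends to a linear functional on $\mathcal{A}$ and $\tau'$ to a linear functional on $\mathcal{I}$ such that $\mathbb{E}[ \tau_{\mathbf{A}_N, U_N\mathbf{B}_NU_N^*}(P)]=\tau(P)+o(1)$ for $P\in \mathcal{A}$ and $\mathbb{E}[ \tau_{\mathbf{A}_N, U_N\mathbf{B}_NU_N^*}(P)]=\frac{1}{N}\tau'(P)+o(N^{-1})$ for $P\in \mathcal{I}$; $(\mathcal{A}_1,\mathcal{I}_1)$ and $(\mathcal{A}_2,\mathcal{I}_2)$ are free of type $B$ in $(\mathcal{A},\tau,\mathcal{I},\tau')$; and almost surely $\tau_{\mathbf{A}_N, U_N\mathbf{B}_NU_N^*}(P)=\tau(P)+o(1)$ for all $P\in \mathcal{A}$ and $\tau_{\mathbf{A}_N, U_N\mathbf{B}_NU_N^*}(P)=\frac{1}{N}\tau'(P)+o(N^{-1})$ for all $P\in \mathcal{I}$.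
   Context: $\operatorname{tr}_N=\frac1N\operatorname{Tr}$; $\tau_{\mathbf{A}_N}(P)=\operatorname{tr}_N(P(\mathbf{A}_N))$; $\tau_{\mathbf{A}_N,U_N\mathbf{B}_NU_N^*}(P)=\operatorname{tr}_N(P(\mathbf{A}_N,U_NB_N^{(1)}U_N^*,\dots,U_NB_N^{(\ell)}U_N^* ))$, with $U_N^*=U_N^t$. $O(N)$ is the group of real orthogonal matrices, $SO(N)$ those of determinant $1$. Freeness of type $B$ in $(\mathcal{A},\tau,\mathcal{I},\tau')$ for $(\mathcal{A}_1,\mathcal{I}_1)$, $(\mathcal{A}_2,\mathcal{I}_2)$: $\mathcal{A}_1,\mathcal{A}_2$ are free w.r.t. $\tau$ (i.e. $\tau(a_1\cdots a_n)=0$ whenever the $a_j$ lie alternately in $\mathcal{A}_1,\mathcal{A}_2$ and are $\tau$-centered), and whenever $a_n\in\mathcal{A}_{i_n},\dots,a_1\in\mathcal{A}_{i_1}$, $v\in\mathcal{I}_h$, $b_1\in\mathcal{A}_{j_1},\dots,b_m\in\mathcal{A}_{j_m}$ with any two consecutive indices in $i_n,\dots,i_1,h,j_1,\dots,j_m$ different and all $a_r,b_s$ centered for $\tau$, $\tau'(a_n\cdots a_1vb_1\cdots b_m)=\tau(a_nb_m)\cdots\tau(a_1b_1)\tau'(v)$ if $n=m$ and $i_r=j_r$ for all $r$, and $=0$ otherwise. *)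

theory Defs
  imports "HOL-Probability.Probability" "HOL-Library.Poly_Mapping"
    "Jordan_Normal_Form.Determinant"
begin

text \<open>Words in the letters of a variable type 'v form the free monoid; we
  make it a monoid_add with concatenation as addition, so that finitely
  supported maps words => complex (Poly_Mapping) form the free algebra
  C<variables> with the convolution product.\<close>

datatype 'v ncword = NCW "'v list"

fun ncletters :: "'v ncword \<Rightarrow> 'v list" where
  "ncletters (NCW w) = w"

instantiation ncword :: (type) monoid_add
begin
definition zero_ncword :: "'v ncword" where "zero_ncword = NCW []"
definition plus_ncword :: "'v ncword \<Rightarrow> 'v ncword \<Rightarrow> 'v ncword" where
  "plus_ncword u v = NCW (ncletters u @ ncletters v)"
instance
proof
  fix a b c :: "'v ncword"
  show "a + b + c = a + (b + c)"
    by (cases a; cases b; cases c) (simp add: plus_ncword_def)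
  show "0 + a = a" by (cases a) (simp add: plus_ncword_def zero_ncword_def)
  show "a + 0 = a" by (cases a) (simp add: plus_ncword_def zero_ncword_def)
qed
end

text \<open>Variables: Inl i is X_(i+1) (i < k), Inr j is Y_(j+1) (j < l).\<close>
type_synonym ncpoly = "(nat + nat) ncword \<Rightarrow>\<^sub>0 complex"

definition ncvar :: "nat + nat \<Rightarrow> ncpoly" where
  "ncvar v = Poly_Mapping.single (NCW [v]) 1"

definition ncconst :: "complex \<Rightarrow> ncpoly" where
  "ncconst c = Poly_Mapping.single 0 c"

definition poly_alg :: "(nat + nat \<Rightarrow> bool) \<Rightarrow> ncpoly set" where
  "poly_alg ok = {P. \<forall>w\<in>Poly_Mapping.keys P. \<forall>v\<in>set (ncletters w). ok v}"

definition algA :: "nat \<Rightarrow> nat \<Rightarrow> ncpoly set" where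
  "algA k l = poly_alg (\<lambda>v. case v of Inl i \<Rightarrow> i < k | Inr j \<Rightarrow> j < l)"

definition algA1 :: "nat \<Rightarrow> ncpoly set" where
  "algA1 k = poly_alg (\<lambda>v. case v of Inl i \<Rightarrow> i < k | Inr j \<Rightarrow> False)"

definition algA2 :: "nat \<Rightarrow> ncpoly set" where
  "algA2 l = poly_alg (\<lambda>v. case v of Inl i \<Rightarrow> False | Inr j \<Rightarrow> j < l)"

inductive_set gen_ideal :: "ncpoly set \<Rightarrow> ncpoly set \<Rightarrow> ncpoly set"
  for S G where
  gen: "g \<in> G \<Longrightarrow> g \<in> gen_ideal S G"
| zero: "0 \<in> gen_ideal S G"
| add: "x \<in> gen_ideal S G \<Longrightarrow> y \<in> gen_ideal S G \<Longrightarrow> x + y \<in> gen_ideal S G"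
| lmult: "a \<in> S \<Longrightarrow> x \<in> gen_ideal S G \<Longrightarrow> a * x \<in> gen_ideal S G"
| rmult: "a \<in> S \<Longrightarrow> x \<in> gen_ideal S G \<Longrightarrow> x * a \<in> gen_ideal S G"

definition idealI1 :: "nat \<Rightarrow> nat \<Rightarrow> ncpoly set" where
  "idealI1 k k' = gen_ideal (algA1 k) {ncvar (Inl i) | i. i < k'}"

definition idealI2 :: "nat \<Rightarrow> nat \<Rightarrow> ncpoly set" where
  "idealI2 l l' = gen_ideal (algA2 l) {ncvar (Inr j) | j. j < l'}"

definition idealI :: "nat \<Rightarrow> nat \<Rightarrow> nat \<Rightarrow> nat \<Rightarrow> ncpoly set" where
  "idealI k k' l l' = gen_ideal (algA k l) (idealI1 k k' \<union> idealI2 l l')"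

definition lin_on :: "ncpoly set \<Rightarrow> (ncpoly \<Rightarrow> complex) \<Rightarrow> bool" where
  "lin_on S f \<longleftrightarrow> (\<forall>P\<in>S. \<forall>Q\<in>S. f (P + Q) = f P + f Q)
     \<and> (\<forall>c. \<forall>P\<in>S. f (ncconst c * P) = c * f P)"

definition mtrace :: "real mat \<Rightarrow> real" where
  "mtrace A = (\<Sum>i<dim_row A. A $$ (i, i))"

definition word_eval ::
  "nat \<Rightarrow> (nat \<Rightarrow> real mat) \<Rightarrow> (nat \<Rightarrow> real mat) \<Rightarrow> (nat + nat) ncword \<Rightarrow> real mat" where
  "word_eval N Xs Ys w =
     foldr (\<lambda>v M. (case v of Inl i \<Rightarrow> Xs i | Inr j \<Rightarrow> Ys j) * M) (ncletters w) (1\<^sub>m N)"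

text \<open>tr_N (P(Xs,Ys)) = (1/N) Tr(P(Xs,Ys)), written out using linearity of the trace
  in P.\<close>
definition ntr ::
  "nat \<Rightarrow> (nat \<Rightarrow> real mat) \<Rightarrow> (nat \<Rightarrow> real mat) \<Rightarrow> ncpoly \<Rightarrow> complex" where
  "ntr N Xs Ys P =
     (\<Sum>w\<in>Poly_Mapping.keys P. Poly_Mapping.lookup P w * complex_of_real (mtrace (word_eval N Xs Ys w)))
     / of_nat N"

definition orth_group :: "nat \<Rightarrow> real mat set" where
  "orth_group N = {U \<in> carrier_mat N N. U * transpose_mat U = 1\<^sub>m N}"

definition sorth_group :: "nat \<Rightarrow> real mat set" where
  "sorth_group N = {U \<in> orth_group N. det U = 1}"

definition mat_space :: "nat \<Rightarrow> real mat measure" where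
  "mat_space N = vimage_algebra (carrier_mat N N)
     (\<lambda>A. \<lambda>p\<in>{..<N} \<times> {..<N}. A $$ p) (PiM ({..<N} \<times> {..<N}) (\<lambda>_. borel))"

definition haar_random :: "'w measure \<Rightarrow> nat \<Rightarrow> real mat set \<Rightarrow> ('w \<Rightarrow> real mat) \<Rightarrow> bool" where
  "haar_random M N G U \<longleftrightarrow>
     U \<in> M \<rightarrow>\<^sub>M mat_space N \<and> (\<forall>\<omega>\<in>space M. U \<omega> \<in> G) \<and>
     (\<forall>V\<in>G. distr M (mat_space N) (\<lambda>\<omega>. V * U \<omega>) = distr M (mat_space N) U)"

definition alternating :: "nat list \<Rightarrow> bool" where
  "alternating xs \<longleftrightarrow> (\<forall>i. Suc i < length xs \<longrightarrow> xs ! i \<noteq> xs ! Suc i)"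

text \<open>(A1,I1), (A2,I2) free of type B in (A,tau,I,tau').  Elements are tagged with
  the index (1 or 2) of the algebra they come from.  For the second condition
  as = [(i_1,a_1),...,(i_n,a_n)] (a_1 adjacent to v), bs = [(j_1,b_1),...,(j_m,b_m)].\<close>
definition free_type_B ::
  "(ncpoly \<Rightarrow> complex) \<Rightarrow> (ncpoly \<Rightarrow> complex) \<Rightarrow> ncpoly set \<Rightarrow> ncpoly set
   \<Rightarrow> ncpoly set \<Rightarrow> ncpoly set \<Rightarrow> bool" where
  "free_type_B tau tau' A1 A2 I1 I2 \<longleftrightarrow>
    (let alg = (\<lambda>i::nat. if i = 1 then A1 else A2);
         idl = (\<lambda>i::nat. if i = 1 then I1 else I2);
         centered = (\<lambda>xs. \<forall>(i, a)\<in>set xs. i \<in> {1, 2} \<and> a \<in> alg i \<and> tau a = 0)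
     in (\<forall>xs. xs \<noteq> [] \<and> centered xs \<and> alternating (map fst xs)
            \<longrightarrow> tau (prod_list (map snd xs)) = 0)
      \<and> (\<forall>as bs h v. centered as \<and> centered bs \<and> h \<in> {1, 2} \<and> v \<in> idl h \<and>
            alternating (rev (map fst as) @ [h] @ map fst bs) \<longrightarrow>
            tau' (prod_list (rev (map snd as)) * v * prod_list (map snd bs)) =
              (if map fst as = map fst bs
               then (\<Prod>r<length as. tau (snd (as ! r) * snd (bs ! r))) * tau' v
               else 0)))"

end

theory Submission
  imports Defs
begin

text \<open>Conjugating by plane rotations and differentiating the Haar invariance at the identity gives a
  Schwinger--Dyson identity for the traces of words: up to an error, a sum over the positions of
  the conjugated letters of differences of products tr(w1) tr(w2), w = w1 w2, vanishes. If w
  starts with an X and ends with a Y, the identity expresses tr(w) through traces of shorter words,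
  so induction on the length of w yields both convergence and concentration: testing the identity
  against the seventh power of the centred trace bounds its eighth moment by a multiple of
  \<open>N powr (-2)\<close>, which is summable. The same holds for unnormalised traces of words with a letter
  in the ideal, where Cauchy--Schwarz gives the a priori bound \<open>O(sqrt N)\<close> for all error terms.
  No norm bounds are available; uniform bounds on tr(w) come from a trace Hoelder inequality and
  the convergence of the moments of single letters. In the limit the identity says that
  \<open>tau \<otimes> tau\<close> (respectively \<open>tau' \<otimes> tau + tau \<otimes> tau'\<close>) annihilates the free difference quotient,
  and freeness (of type B) follows from this by evaluating it on alternating products of centred
  elements.\<close>

section \<open>Traces of words\<close>

text \<open>The ends of a word decide whether its identity can be solved for tr(w). A cut at either
  end leaves w whole: the one after a final \<open>Y\<close>-letter contributes -N tr(w), the one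
  before an initial \<open>Y\<close>-letter contributes +N tr(w), and the two would cancel. Hence a
  word with both kinds of letters is first rotated so that only the final cut survives; words of one
  kind do not feel the conjugation and start the induction. Contracting over the generators of so(N)
  gives, besides tr(w1) tr(w2), a term tr(w1 w2^t) peculiar to orthogonal matrices. Since the
  letters are symmetric, w2^t is the reversed word, so this error is again the trace of a word and
  is covered by the same a priori bounds. The test function is centred at the centre of the
  right-hand side, not at the mean of tr(w). Convergence and concentration therefore pass together
  from shorter words to w. In the type B case the factor carrying an ideal letter keeps its
  unnormalised trace while the other factor is normalised; in the limit \<open>tau\<close> vanishes
  on the ideal, which removes most terms of the product rule.\<close>

lemma mtrace_mult:
  assumes "A \<in> carrier_mat N N" "B \<in> carrier_mat N N"
  shows "mtrace (A * B) = (\<Sum>i<N. \<Sum>j<N. A $$ (i, j) * B $$ (j, i))"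
  using assms by (simp add: mtrace_def scalar_prod_def atLeast0LessThan)

lemma mtrace_mult_comm:
  assumes "A \<in> carrier_mat N N" "B \<in> carrier_mat N N"
  shows "mtrace (A * B) = mtrace (B * A)"
  unfolding mtrace_mult[OF assms] mtrace_mult[OF assms(2,1)]
  by (subst sum.swap) (simp add: mult.commute)

lemma mtrace_mult_transpose:
  assumes "A \<in> carrier_mat N N" "B \<in> carrier_mat N N"
  shows "mtrace (A * transpose_mat B) = (\<Sum>i<N. \<Sum>j<N. A $$ (i, j) * B $$ (i, j))"
proof -
  have "mtrace (A * transpose_mat B)
      = (\<Sum>i<N. \<Sum>j<N. A $$ (i, j) * transpose_mat B $$ (j, i))"
    by (rule mtrace_mult) (use assms in auto)
  also have "\<dots> = (\<Sum>i<N. \<Sum>j<N. A $$ (i, j) * B $$ (i, j))"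
    using assms by (intro sum.cong refl) auto
  finally show ?thesis .
qed

lemma entry_sq_le_mtrace:
  assumes "A \<in> carrier_mat N N" "i < N" "j < N"
  shows "(A $$ (i, j))\<^sup>2 \<le> mtrace (A * transpose_mat A)"
proof -
  have "(A $$ (i, j))\<^sup>2 \<le> (\<Sum>j<N. (A $$ (i, j))\<^sup>2)"
    using assms by (intro member_le_sum) auto
  also have "\<dots> \<le> (\<Sum>i<N. \<Sum>j<N. (A $$ (i, j))\<^sup>2)"
    using assms
    by (intro member_le_sum[of i "{..<N}" "\<lambda>i. \<Sum>j<N. (A $$ (i, j))\<^sup>2"]) (auto intro: sum_nonneg)
  finally show ?thesis
    using assms by (simp add: mtrace_mult_transpose power2_eq_square)
qed

lemma mtrace_Cauchy_Schwarz:
  assumes "A \<in> carrier_mat N N" "B \<in> carrier_mat N N"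
  shows "(mtrace (A * B))\<^sup>2 \<le> mtrace (A * transpose_mat A) * mtrace (B * transpose_mat B)"
proof -
  let ?I = "{..<N} \<times> {..<N}"
  have "mtrace (A * B) = (\<Sum>p\<in>?I. A $$ p * B $$ (snd p, fst p))"
    by (simp add: mtrace_mult[OF assms] sum.cartesian_product case_prod_unfold)
  moreover have "mtrace (A * transpose_mat A) = (\<Sum>p\<in>?I. (A $$ p)\<^sup>2)"
    using assms by (simp add: mtrace_mult_transpose sum.cartesian_product case_prod_unfold power2_eq_square)
  moreover have "mtrace (B * transpose_mat B) = (\<Sum>p\<in>?I. (B $$ (snd p, fst p))\<^sup>2)"
  proof -
    have "mtrace (B * transpose_mat B) = (\<Sum>i<N. \<Sum>j<N. (B $$ (i, j))\<^sup>2)"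
      using assms by (simp add: mtrace_mult_transpose power2_eq_square)
    also have "\<dots> = (\<Sum>j<N. \<Sum>i<N. (B $$ (i, j))\<^sup>2)"
      by (rule sum.swap)
    finally show ?thesis
      by (simp add: sum.cartesian_product case_prod_unfold)
  qed
  ultimately show ?thesis
    using Cauchy_Schwarz_ineq_sum[of "\<lambda>p. A $$ p" "\<lambda>p. B $$ (snd p, fst p)" ?I] by simp
qed

text \<open>\<open>word_eval\<close> with a single family over an arbitrary letter type, so that the
  choice of the conjugated letters becomes a mere predicate on letters.\<close>

definition wprod :: "nat \<Rightarrow> ('v \<Rightarrow> real mat) \<Rightarrow> 'v list \<Rightarrow> real mat" where
  "wprod N Z w = foldr (\<lambda>v X. Z v * X) w (1\<^sub>m N)"

definition wtr :: "nat \<Rightarrow> ('v \<Rightarrow> real mat) \<Rightarrow> 'v list \<Rightarrow> real" where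
  "wtr N Z w = mtrace (wprod N Z w)"

definition sym_letters :: "nat \<Rightarrow> ('v \<Rightarrow> real mat) \<Rightarrow> bool" where
  "sym_letters N Z \<longleftrightarrow> (\<forall>v. Z v \<in> carrier_mat N N \<and> transpose_mat (Z v) = Z v)"

lemma sym_lettersD:
  assumes "sym_letters N Z"
  shows "Z v \<in> carrier_mat N N" "transpose_mat (Z v) = Z v"
  using assms by (auto simp: sym_letters_def)

lemma wprod_Nil [simp]: "wprod N Z [] = 1\<^sub>m N"
  and wprod_Cons [simp]: "wprod N Z (v # w) = Z v * wprod N Z w"
  by (simp_all add: wprod_def)

lemma wprod_cong: "(\<And>v. v \<in> set w \<Longrightarrow> Z v = Z' v) \<Longrightarrow> wprod N Z w = wprod N Z' w"
  by (induction w) auto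

lemma wprod_carrier [simp]: "sym_letters N Z \<Longrightarrow> wprod N Z w \<in> carrier_mat N N"
  by (induction w) (auto intro!: mult_carrier_mat[of _ N N] simp: sym_letters_def)

lemma wprod_dims [simp]:
  assumes "sym_letters N Z"
  shows "dim_row (wprod N Z w) = N" "dim_col (wprod N Z w) = N"
  using wprod_carrier[OF assms, of w] by auto

lemma wprod_append:
  assumes "sym_letters N Z"
  shows "wprod N Z (u @ w) = wprod N Z u * wprod N Z w"
proof (induction u)
  case Nil
  then show ?case using wprod_carrier[OF assms, of w] by simp
next
  case (Cons v u)
  then show ?case
    using wprod_carrier[OF assms, of w] wprod_carrier[OF assms, of u] sym_lettersD(1)[OF assms, of v]
    by (simp add: assoc_mult_mat[of _ N N _ N _ N])
qed

text \<open>Symmetric letters turn transposition into reversal, so the transposes created by the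
  orthogonal group stay within the traces of words.\<close>

lemma wprod_rev:
  assumes "sym_letters N Z"
  shows "wprod N Z (rev w) = transpose_mat (wprod N Z w)"
proof (induction w)
  case (Cons v w)
  have "wprod N Z (rev (v # w)) = transpose_mat (wprod N Z w) * transpose_mat (Z v)"
    using Cons sym_lettersD[OF assms, of v] wprod_append[OF assms, of "rev w" "[v]"] by simp
  also have "\<dots> = transpose_mat (Z v * wprod N Z w)"
    using wprod_carrier[OF assms, of w] sym_lettersD(1)[OF assms, of v]
    by (simp add: transpose_mult[of _ N N _ N])
  finally show ?case by simp
qed (simp add: transpose_one)

lemma wtr_append:
  "sym_letters N Z \<Longrightarrow> wtr N Z (u @ w) = mtrace (wprod N Z u * wprod N Z w)"
  by (simp add: wtr_def wprod_append)

lemma wtr_append_rev: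
  "sym_letters N Z \<Longrightarrow> wtr N Z (u @ rev w) = mtrace (wprod N Z u * transpose_mat (wprod N Z w))"
  by (simp add: wtr_append wprod_rev)

lemma wtr_commute: "sym_letters N Z \<Longrightarrow> wtr N Z (u @ w) = wtr N Z (w @ u)"
  by (simp add: wtr_append mtrace_mult_comm[of _ N])

lemma wtr_Nil [simp]: "wtr N Z [] = real N"
  by (simp add: wtr_def mtrace_def)

lemma wtr_cong: "(\<And>v. v \<in> set w \<Longrightarrow> Z v = Z' v) \<Longrightarrow> wtr N Z w = wtr N Z' w"
  unfolding wtr_def using wprod_cong by metis

lemma wtr_Cauchy_Schwarz:
  "sym_letters N Z \<Longrightarrow> (wtr N Z (u @ w))\<^sup>2 \<le> wtr N Z (u @ rev u) * wtr N Z (w @ rev w)"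
  using mtrace_Cauchy_Schwarz[of "wprod N Z u" N "wprod N Z w"]
  by (simp add: wtr_append wprod_rev)

lemma wtr_append_rev_nonneg: "sym_letters N Z \<Longrightarrow> 0 \<le> wtr N Z (u @ rev u)"
  by (simp add: wtr_append_rev mtrace_mult_transpose[of _ N] sum_nonneg)

lemma entry_sq_le_wtr:
  "sym_letters N Z \<Longrightarrow> i < N \<Longrightarrow> j < N \<Longrightarrow> (wprod N Z w $$ (i, j))\<^sup>2 \<le> wtr N Z (w @ rev w)"
  by (simp add: wtr_append_rev entry_sq_le_mtrace[of _ N])

lemma wtr_replicate_even_nonneg:
  assumes "sym_letters N Z"
  shows "0 \<le> wtr N Z (replicate (2 * m) x)"
proof -
  have "replicate (2 * m) x = replicate m x @ rev (replicate m x)"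
    by (simp add: replicate_add[symmetric] mult_2)
  then show ?thesis using wtr_append_rev_nonneg[OF assms] by metis
qed

subsection \<open>A trace Hoelder inequality\<close>

text \<open>Among the words of length 2m maximising the absolute trace there is a constant one: if
  w = PQ is a maximiser, then so is PP* by Cauchy--Schwarz, and choosing P to end in a run of
  a single letter doubles that run.\<close>

lemma wtr_maximizer_run:
  assumes Z: "sym_letters N Z" and L: "finite L" and m: "m \<ge> 1"
    and max: "\<And>w. set w \<subseteq> L \<Longrightarrow> length w = 2 * m \<Longrightarrow> \<bar>wtr N Z w\<bar> \<le> K"
    and w0: "set w0 \<subseteq> L" "length w0 = 2 * m" "\<bar>wtr N Z w0\<bar> = K"
    and r: "1 \<le> r" "r \<le> 2 * m"
  shows "\<exists>x u. x \<in> L \<and> set u \<subseteq> L \<and> length u = 2 * m - r \<and> \<bar>wtr N Z (replicate r x @ u)\<bar> = K"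
  using r
proof (induction r rule: dec_induct)
  case base
  obtain x u where "w0 = x # u" using w0 m by (cases w0) auto
  then show ?case using w0 by (intro exI[of _ x] exI[of _ u]) auto
next
  case (step r)
  then obtain x u where xu: "x \<in> L" "set u \<subseteq> L" "length u = 2 * m - r"
      "\<bar>wtr N Z (replicate r x @ u)\<bar> = K" by auto
  have double: "\<bar>wtr N Z (P @ rev P)\<bar> = K"
    if "set P \<subseteq> L" "set Q \<subseteq> L" "length P = m" "length Q = m" "\<bar>wtr N Z (P @ Q)\<bar> = K" for P Q
  proof -
    have P: "\<bar>wtr N Z (P @ rev P)\<bar> \<le> K" and Q: "\<bar>wtr N Z (Q @ rev Q)\<bar> \<le> K"
      using that max[of "P @ rev P"] max[of "Q @ rev Q"] by simp_all
    have "K\<^sup>2 \<le> wtr N Z (P @ rev P) * wtr N Z (Q @ rev Q)"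
      using wtr_Cauchy_Schwarz[OF Z, of P Q] that(5) by (metis power2_abs)
    also have "\<dots> \<le> wtr N Z (P @ rev P) * K"
      using Q wtr_append_rev_nonneg[OF Z] by (intro mult_left_mono) auto
    finally have "K * K \<le> wtr N Z (P @ rev P) * K" by (simp add: power2_eq_square)
    moreover have "K \<ge> 0" using P by linarith
    ultimately show ?thesis using P wtr_append_rev_nonneg[OF Z, of P]
      by (cases "K = 0") (auto simp: mult_le_cancel_right)
  qed
  show ?case
  \<comment> \<open>If the run fills the first half, doubling that half gives a constant word at
    once. Otherwise the word is rotated to \<open>u2 @ replicate r x @ u1\<close>, whose first half
    ends in the run; doubling yields a run of length \<open>2 * r\<close>, which is at least
    \<open>Suc r\<close> because \<open>r \<ge> 1\<close>.\<close>
  proof (cases "r \<ge> m")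
    case True
    define Q where "Q = replicate (r - m) x @ u"
    have "replicate r x @ u = replicate m x @ Q"
      using True by (simp add: Q_def replicate_add[symmetric])
    then have "\<bar>wtr N Z (replicate m x @ rev (replicate m x))\<bar> = K"
      using xu True step by (intro double[where Q = Q]) (auto simp: Q_def)
    moreover have "replicate m x @ rev (replicate m x)
        = replicate (Suc r) x @ replicate (2 * m - Suc r) x"
      using step by (simp add: replicate_add[symmetric] del: replicate_Suc)
    ultimately show ?thesis using xu step
      by (intro exI[of _ x] exI[of _ "replicate (2 * m - Suc r) x"]) auto
  next
    case False
    define u1 u2 where "u1 = take m u" and "u2 = drop m u"
    have u: "u = u1 @ u2" by (simp add: u1_def u2_def)
    have len: "length u1 = m" "length u2 = m - r"
      using xu False by (auto simp: u1_def u2_def)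
    have "wtr N Z (replicate r x @ u) = wtr N Z ((u2 @ replicate r x) @ u1)"
      using wtr_commute[OF Z, of "replicate r x @ u1" u2] by (simp add: u)
    then have "\<bar>wtr N Z ((u2 @ replicate r x) @ rev (u2 @ replicate r x))\<bar> = K"
      using xu len False u by (intro double[where Q = u1]) auto
    moreover have "wtr N Z ((u2 @ replicate r x) @ rev (u2 @ replicate r x))
        = wtr N Z (replicate (Suc r) x @ replicate (r - 1) x @ rev u2 @ u2)"
    proof -
      have "replicate (Suc r) x @ replicate (r - 1) x = replicate r x @ replicate r x"
        using step by (simp add: replicate_add[symmetric] del: replicate_Suc)
      then show ?thesis
        using wtr_commute[OF Z, of u2 "replicate r x @ replicate r x @ rev u2"]
        by (metis append.assoc rev_append rev_replicate)
    qed
    ultimately show ?thesis using xu len False step u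
      by (intro exI[of _ x] exI[of _ "replicate (r - 1) x @ rev u2 @ u2"]) auto
  qed
qed

text \<open>A maximiser exists since there are finitely many words, and a run of full length
  \<open>2 * m\<close> makes it constant. Its letter is unknown, but even powers have nonnegative
  trace, so the sum over all letters dominates. Only powers of single letters remain on the right,
  and conjugation leaves their traces unchanged.\<close>

lemma wtr_Hoelder_even:
  assumes Z: "sym_letters N Z" and L: "finite L" and w: "set w \<subseteq> L" "length w = 2 * m" and m: "m \<ge> 1"
  shows "\<bar>wtr N Z w\<bar> \<le> (\<Sum>x\<in>L. wtr N Z (replicate (2 * m) x))"
proof -
  define S where "S = {w. set w \<subseteq> L \<and> length w = 2 * m}"
  have fin: "finite S" unfolding S_def using finite_lists_length_eq[OF L] .
  define K where "K = Max ((\<lambda>w. \<bar>wtr N Z w\<bar>) ` S)"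
  have le: "\<bar>wtr N Z u\<bar> \<le> K" if "u \<in> S" for u
    unfolding K_def using fin that by (intro Max_ge) auto
  have "w \<in> S" using w by (simp add: S_def)
  then have "K \<in> (\<lambda>w. \<bar>wtr N Z w\<bar>) ` S"
    unfolding K_def using fin by (intro Max_in) auto
  then obtain w0 where w0: "w0 \<in> S" "\<bar>wtr N Z w0\<bar> = K" by auto
  obtain x u where x: "x \<in> L" "length u = 2 * m - 2 * m" "\<bar>wtr N Z (replicate (2 * m) x @ u)\<bar> = K"
    using wtr_maximizer_run[OF Z L m le, of w0 "2 * m"] w0 m by (auto simp: S_def)
  then have "K = wtr N Z (replicate (2 * m) x)"
    using wtr_replicate_even_nonneg[OF Z, of m x] by auto
  also have "\<dots> \<le> (\<Sum>x\<in>L. wtr N Z (replicate (2 * m) x))"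
    using x L wtr_replicate_even_nonneg[OF Z] by (intro member_le_sum) auto
  finally show ?thesis using le[OF \<open>w \<in> S\<close>] by simp
qed

section \<open>Orthogonal conjugation and plane rotations\<close>

definition conj_letters ::
    "('v \<Rightarrow> bool) \<Rightarrow> real mat \<Rightarrow> ('v \<Rightarrow> real mat) \<Rightarrow> 'v \<Rightarrow> real mat" where
  "conj_letters Y V Z v = (if Y v then V * Z v * transpose_mat V else Z v)"

lemma orth_groupD:
  assumes "V \<in> orth_group N"
  shows "V \<in> carrier_mat N N" "V * transpose_mat V = 1\<^sub>m N" "transpose_mat V * V = 1\<^sub>m N"
proof -
  show "V \<in> carrier_mat N N" and 1: "V * transpose_mat V = 1\<^sub>m N"
    using assms by (auto simp: orth_group_def)
  then show "transpose_mat V * V = 1\<^sub>m N"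
    by (intro mat_mult_left_right_inverse[OF _ _ 1]) auto
qed

lemma sym_letters_conj:
  assumes "sym_letters N Z" "V \<in> carrier_mat N N"
  shows "sym_letters N (conj_letters Y V Z)"
proof -
  have "transpose_mat (V * Z v * transpose_mat V) = V * Z v * transpose_mat V" for v
    using sym_lettersD[OF assms(1), of v] assms(2)
    by (simp add: transpose_mult[of _ N N _ N] assoc_mult_mat[of _ N N _ N _ N])
  then show ?thesis
    using assms sym_lettersD[OF assms(1)] by (auto simp: sym_letters_def conj_letters_def)
qed

text \<open>In a word of \<open>Y\<close>-letters the inner factors V^t V cancel and the outer pair
  disappears by cyclicity of the trace.\<close>

lemma wtr_conj_pure:
  assumes Z: "sym_letters N Z" and V: "V \<in> orth_group N"
    and w: "(\<forall>v\<in>set w. Y v) \<or> (\<forall>v\<in>set w. \<not> Y v)"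
  shows "wtr N (conj_letters Y V Z) w = wtr N Z w"
  using w
proof
  assume "\<forall>v\<in>set w. \<not> Y v"
  then show ?thesis by (intro wtr_cong) (auto simp: conj_letters_def)
next
  note V' = orth_groupD[OF V]
  assume "\<forall>v\<in>set w. Y v"
  then have "wprod N (conj_letters Y V Z) w = V * wprod N Z w * transpose_mat V"
  proof (induction w)
    case Nil
    then show ?case using V' by simp
  next
    case (Cons v w)
    define W where "W = wprod N Z w"
    have c: "W \<in> carrier_mat N N" "Z v \<in> carrier_mat N N" "transpose_mat V \<in> carrier_mat N N"
      using Z V' by (auto simp: W_def dest: sym_lettersD)
    have "wprod N (conj_letters Y V Z) (v # w)
        = (V * Z v * transpose_mat V) * (V * W * transpose_mat V)"
      using Cons by (simp add: conj_letters_def[of Y V Z v] W_def)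
    also have "\<dots> = V * Z v * (transpose_mat V * V) * (W * transpose_mat V)"
      using c V'(1) by (simp add: assoc_mult_mat[of _ N N _ N _ N])
    also have "\<dots> = V * (Z v * W) * transpose_mat V"
      using c V'(1) unfolding V'(3) by (simp add: assoc_mult_mat[of _ N N _ N _ N])
    finally show ?case by (simp add: W_def)
  qed
  moreover have "mtrace (V * wprod N Z w * transpose_mat V) = mtrace (wprod N Z w)"
  proof -
    have "mtrace (V * wprod N Z w * transpose_mat V) = mtrace (transpose_mat V * (V * wprod N Z w))"
      using V' Z by (intro mtrace_mult_comm[of _ N]) auto
    also have "transpose_mat V * (V * wprod N Z w) = (transpose_mat V * V) * wprod N Z w"
      using V'(1) Z by (subst assoc_mult_mat[of _ N N _ N _ N]) auto
    finally show ?thesis using V' Z by simp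
  qed
  ultimately show ?thesis by (simp add: wtr_def)
qed

lemma wtr_conj_Hoelder:
  assumes Z: "sym_letters N Z" and V: "V \<in> orth_group N"
    and L: "finite L" and w: "set w \<subseteq> L" "length w = 2 * m" and m: "m \<ge> 1"
  shows "\<bar>wtr N (conj_letters Y V Z) w\<bar> \<le> (\<Sum>x\<in>L. wtr N Z (replicate (2 * m) x))"
proof -
  have "\<bar>wtr N (conj_letters Y V Z) w\<bar> \<le> (\<Sum>x\<in>L. wtr N (conj_letters Y V Z) (replicate (2 * m) x))"
    by (rule wtr_Hoelder_even[OF sym_letters_conj[OF Z] L w m]) (use V orth_groupD in auto)
  also have "\<dots> = (\<Sum>x\<in>L. wtr N Z (replicate (2 * m) x))"
    using m by (intro sum.cong refl wtr_conj_pure[OF Z V]) auto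
  finally show ?thesis .
qed

text \<open>A squared entry of W is at most Tr(W W^t), to which the Hoelder bound applies unless the
  word is empty. The bound depends on \<open>N\<close>; it serves integrability and differentiation
  under the integral, not the asymptotics.\<close>

lemma wprod_conj_entries_bounded:
  assumes Z: "sym_letters N Z"
  shows "\<exists>K. \<forall>V\<in>orth_group N. \<forall>i<N. \<forall>j<N. \<bar>wprod N (conj_letters Y V Z) w $$ (i, j)\<bar> \<le> K"
proof (cases "w = []")
  case True
  then show ?thesis by (intro exI[of _ 1]) auto
next
  case False
  define K where "K = (\<Sum>x\<in>set w. wtr N Z (replicate (2 * length w) x))"
  have "\<bar>wprod N (conj_letters Y V Z) w $$ (i, j)\<bar> \<le> sqrt K"
    if V: "V \<in> orth_group N" and ij: "i < N" "j < N" for V i j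
  proof -
    note S = sym_letters_conj[OF Z orth_groupD(1)[OF V], of Y]
    have "(wprod N (conj_letters Y V Z) w $$ (i, j))\<^sup>2 \<le> wtr N (conj_letters Y V Z) (w @ rev w)"
      by (rule entry_sq_le_wtr[OF S ij])
    also have "\<dots> \<le> K"
      using wtr_conj_Hoelder[OF Z V, of "set w" "w @ rev w" "length w" Y] False
      by (auto simp: K_def Suc_le_eq)
    finally show ?thesis by (metis real_sqrt_le_iff real_sqrt_abs)
  qed
  then show ?thesis by blast
qed

lemma index_mult_mat_sum:
  assumes "A \<in> carrier_mat N N" "B \<in> carrier_mat N N" "i < N" "j < N"
  shows "(A * B) $$ (i, j) = (\<Sum>k<N. A $$ (i, k) * B $$ (k, j))"
  using assms by (simp add: scalar_prod_def atLeast0LessThan)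

text \<open>For \<open>p \<noteq> q\<close> in range this is the one-parameter group exp(\<theta> E)
  generated by E = \<open>skew N p q\<close>.\<close>

definition rot :: "nat \<Rightarrow> nat \<Rightarrow> nat \<Rightarrow> real \<Rightarrow> real mat" where
  "rot N p q \<theta> = mat N N (\<lambda>(i, j).
     if i = p then (if j = p then cos \<theta> else if j = q then sin \<theta> else 0)
     else if i = q then (if j = p then - sin \<theta> else if j = q then cos \<theta> else 0)
     else if i = j then 1 else 0)"

lemma rot_carrier [simp]: "rot N p q \<theta> \<in> carrier_mat N N"
  by (simp add: rot_def)

lemma rot_mult_index:
  assumes pq: "p < N" "q < N" "p \<noteq> q" and X: "X \<in> carrier_mat N N" and ij: "i < N" "j < N"
  shows "(rot N p q \<theta> * X) $$ (i, j) =
    (if i = p then cos \<theta> * X $$ (p, j) + sin \<theta> * X $$ (q, j)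
     else if i = q then - sin \<theta> * X $$ (p, j) + cos \<theta> * X $$ (q, j)
     else X $$ (i, j))"
proof -
  have *: "(rot N p q \<theta> * X) $$ (i, j) = (\<Sum>k<N. rot N p q \<theta> $$ (i, k) * X $$ (k, j))"
    by (rule index_mult_mat_sum[OF rot_carrier X ij])
  have row: "rot N p q \<theta> $$ (i, k) =
     (if i = p then (if k = p then cos \<theta> else 0) + (if k = q then sin \<theta> else 0)
      else if i = q then (if k = p then - sin \<theta> else 0) + (if k = q then cos \<theta> else 0)
      else if k = i then 1 else 0)" if "k < N" for k
    using that pq ij by (auto simp: rot_def)
  have if0: "(if P then a else 0) * (b::real) = (if P then a * b else 0)" for P a b by simp
  show ?thesis unfolding *
    using pq ij by (simp add: row distrib_right sum.distrib if0 sum.delta cong: if_cong)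
qed

lemma rot_mult:
  assumes "p < N" "q < N" "p \<noteq> q"
  shows "rot N p q a * rot N p q b = rot N p q (a + b)"
proof (rule eq_matI)
  fix i j assume "i < dim_row (rot N p q (a + b))" "j < dim_col (rot N p q (a + b))"
  then have ij: "i < N" "j < N" by (simp_all add: rot_def)
  show "(rot N p q a * rot N p q b) $$ (i, j) = rot N p q (a + b) $$ (i, j)"
    unfolding rot_mult_index[OF assms rot_carrier ij]
    using assms ij by (auto simp: rot_def cos_add sin_add)
qed (simp_all add: rot_def)

lemma rot_0: "rot N p q 0 = 1\<^sub>m N"
  by (rule eq_matI) (auto simp: rot_def)

lemma rot_transpose: "p \<noteq> q \<Longrightarrow> transpose_mat (rot N p q \<theta>) = rot N p q (- \<theta>)"
  by (rule eq_matI) (auto simp: rot_def)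

text \<open>Orthogonality gives a determinant of square 1, and halving the angle exhibits the
  determinant as such a square. Membership in the smaller group lets one invariance argument serve
  both O(N) and SO(N).\<close>

lemma rot_in_sorth_group:
  assumes "p < N" "q < N" "p \<noteq> q"
  shows "rot N p q \<theta> \<in> sorth_group N"
proof -
  have orth: "rot N p q t \<in> orth_group N" for t
    using assms by (simp add: orth_group_def rot_transpose rot_mult rot_0)
  have "(det (rot N p q t))\<^sup>2 = 1" for t
  proof -
    have "det (rot N p q t) * det (transpose_mat (rot N p q t)) = det (1\<^sub>m N :: real mat)"
      using det_mult[of "rot N p q t" N "transpose_mat (rot N p q t)"] orth_groupD(2)[OF orth] by simp
    then show ?thesis using det_transpose[OF rot_carrier] by (simp add: power2_eq_square)
  qed
  moreover have "det (rot N p q \<theta>) = (det (rot N p q (\<theta> / 2)))\<^sup>2"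
    using det_mult[OF rot_carrier rot_carrier, of N p q "\<theta>/2" p q "\<theta>/2"]
    by (simp add: rot_mult[OF assms] power2_eq_square)
  ultimately show ?thesis using orth by (simp add: sorth_group_def)
qed

lemma sorth_group_subset: "sorth_group N \<subseteq> orth_group N"
  by (auto simp: sorth_group_def)

lemma orth_group_mult:
  assumes "V \<in> orth_group N" "W \<in> orth_group N"
  shows "V * W \<in> orth_group N"
proof -
  note V = orth_groupD[OF assms(1)] and W = orth_groupD[OF assms(2)]
  have "V * W * transpose_mat (V * W) = V * (W * transpose_mat W) * transpose_mat V"
    using V(1) W(1) by (simp add: transpose_mult[of _ N N _ N] assoc_mult_mat[of _ N N _ N _ N])
  then show ?thesis using V W by (simp add: orth_group_def)
qed

section \<open>Differentiating words along a rotation\<close>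

text \<open>The sum over the positions of Y-letters is the discrete form of the derivation that maps
  a Y-letter y to Ey - yE.\<close>

definition ysum :: "('v \<Rightarrow> bool) \<Rightarrow> 'v list \<Rightarrow> (nat \<Rightarrow> 'b::ab_group_add) \<Rightarrow> 'b" where
  "ysum Y w f = (\<Sum>i<length w. if Y (w ! i) then f i - f (Suc i) else 0)"

lemma ysum_Nil [simp]: "ysum Y [] f = 0"
  by (simp add: ysum_def)

lemma ysum_Cons: "ysum Y (v # w) f = (if Y v then f 0 - f (Suc 0) else 0) + ysum Y w (\<lambda>i. f (Suc i))"
  unfolding ysum_def length_Cons by (subst sum.lessThan_Suc_shift) simp

lemma ysum_add: "ysum Y w (\<lambda>i. f i + g i) = ysum Y w f + ysum Y w g"
  unfolding ysum_def by (subst sum.distrib[symmetric]) (intro sum.cong, auto)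

lemma ysum_diff: "ysum Y w (\<lambda>i. f i - g i) = ysum Y w f - ysum Y w g"
  unfolding ysum_def by (subst sum_subtractf[symmetric]) (intro sum.cong, auto)

lemma ysum_sum: "ysum Y w (\<lambda>i. \<Sum>a\<in>A. f a i) = (\<Sum>a\<in>A. ysum Y w (f a))"
  unfolding ysum_def by (subst sum.swap) (intro sum.cong, auto simp: sum_subtractf)

lemma ysum_cmult: "ysum Y w (\<lambda>i. c * f i) = c * (ysum Y w f :: 'b::ring)"
  unfolding ysum_def sum_distrib_left by (intro sum.cong) (auto simp: right_diff_distrib)

definition mder :: "nat \<Rightarrow> (real \<Rightarrow> real mat) \<Rightarrow> real mat \<Rightarrow> real \<Rightarrow> bool" where
  "mder N F D \<theta> \<longleftrightarrow>
     (\<forall>i<N. \<forall>j<N. ((\<lambda>t. F t $$ (i, j)) has_real_derivative D $$ (i, j)) (at \<theta>))"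

lemma mder_mult:
  assumes F: "\<And>t. F t \<in> carrier_mat N N" "D \<in> carrier_mat N N" "mder N F D \<theta>"
    and G: "\<And>t. G t \<in> carrier_mat N N" "D' \<in> carrier_mat N N" "mder N G D' \<theta>"
  shows "mder N (\<lambda>t. F t * G t) (D * G \<theta> + F \<theta> * D') \<theta>"
  unfolding mder_def
proof (intro allI impI)
  fix i j assume ij: "i < N" "j < N"
  have "((\<lambda>t. \<Sum>k<N. F t $$ (i, k) * G t $$ (k, j)) has_real_derivative
     (\<Sum>k<N. F \<theta> $$ (i, k) * D' $$ (k, j) + D $$ (i, k) * G \<theta> $$ (k, j))) (at \<theta>)"
    using F(3) G(3) ij by (intro DERIV_sum DERIV_mult') (auto simp: mder_def)
  moreover have "(D * G \<theta> + F \<theta> * D') $$ (i, j)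
      = (\<Sum>k<N. F \<theta> $$ (i, k) * D' $$ (k, j) + D $$ (i, k) * G \<theta> $$ (k, j))"
  proof -
    have "(D * G \<theta> + F \<theta> * D') $$ (i, j) = (D * G \<theta>) $$ (i, j) + (F \<theta> * D') $$ (i, j)"
      using F(1)[of \<theta>] G(2) ij by simp
    then show ?thesis
      by (simp add: index_mult_mat_sum[OF F(2) G(1) ij] index_mult_mat_sum[OF F(1) G(2) ij] sum.distrib)
  qed
  ultimately show "((\<lambda>t. (F t * G t) $$ (i, j)) has_real_derivative
      (D * G \<theta> + F \<theta> * D') $$ (i, j)) (at \<theta>)"
    by (simp only: index_mult_mat_sum[OF F(1) G(1) ij])
qed

lemma mder_const: "A \<in> carrier_mat N N \<Longrightarrow> mder N (\<lambda>_. A) (0\<^sub>m N N) \<theta>"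
  by (simp add: mder_def)

definition skew :: "nat \<Rightarrow> nat \<Rightarrow> nat \<Rightarrow> real mat" where
  "skew N p q = mat N N (\<lambda>(i, j). if i = p \<and> j = q then 1 else if i = q \<and> j = p then -1 else 0)"

lemma skew_carrier [simp]: "skew N p q \<in> carrier_mat N N"
  by (simp add: skew_def)

lemma skew_transpose: "p \<noteq> q \<Longrightarrow> transpose_mat (skew N p q) = - skew N p q"
  by (rule eq_matI) (auto simp: skew_def)

lemma skew_mult_index:
  assumes pq: "p < N" "q < N" "p \<noteq> q" and X: "X \<in> carrier_mat N N" and ij: "i < N" "j < N"
  shows "(skew N p q * X) $$ (i, j) =
     (if i = p then 1 else 0) * X $$ (q, j) - (if i = q then 1 else 0) * X $$ (p, j)"
proof -
  have row: "skew N p q $$ (i, k) =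
     (if i = p then (if k = q then 1 else 0) else if i = q then (if k = p then - 1 else 0) else 0)"
    if "k < N" for k
    using that pq ij by (auto simp: skew_def)
  have if0: "(if P then a else 0) * (b::real) = (if P then a * b else 0)" for P a b by simp
  show ?thesis unfolding index_mult_mat_sum[OF skew_carrier X ij]
    using pq ij by (simp add: row if0 sum.delta cong: if_cong)
qed

lemma mult_skew_index:
  assumes pq: "p < N" "q < N" "p \<noteq> q" and X: "X \<in> carrier_mat N N" and ij: "i < N" "j < N"
  shows "(X * skew N p q) $$ (i, j) =
     (if j = q then 1 else 0) * X $$ (i, p) - (if j = p then 1 else 0) * X $$ (i, q)"
proof -
  have row: "skew N p q $$ (k, j) =
     (if j = q then (if k = p then 1 else 0) else if j = p then (if k = q then - 1 else 0) else 0)"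
    if "k < N" for k
    using that pq ij by (auto simp: skew_def)
  have if0: "b * (if P then a else 0) = (if P then b * a else (0::real))" for P a b by simp
  show ?thesis unfolding index_mult_mat_sum[OF X skew_carrier ij]
    using pq ij by (simp add: row if0 sum.delta cong: if_cong)
qed

text \<open>The derivative of exp(\<theta> E) X is E exp(\<theta> E) X. It is needed at every angle,
  because difference quotients are later bounded by the mean value theorem along the path.\<close>

lemma mder_rot_mult:
  assumes pq: "p < N" "q < N" "p \<noteq> q" and X: "X \<in> carrier_mat N N"
  shows "mder N (\<lambda>t. rot N p q t * X) (skew N p q * (rot N p q \<theta> * X)) \<theta>"
  unfolding mder_def
proof (intro allI impI)
  fix i j assume ij: "i < N" "j < N"
  have c: "rot N p q \<theta> * X \<in> carrier_mat N N" using X by (auto intro!: mult_carrier_mat[of _ N N])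
  show "((\<lambda>t. (rot N p q t * X) $$ (i, j)) has_real_derivative
      (skew N p q * (rot N p q \<theta> * X)) $$ (i, j)) (at \<theta>)"
    unfolding skew_mult_index[OF pq c ij] rot_mult_index[OF pq X ij]
      rot_mult_index[OF pq X pq(1) ij(2)] rot_mult_index[OF pq X pq(2) ij(2)]
    using pq by (cases "i = p"; cases "i = q") (auto intro!: derivative_eq_intros)
qed

text \<open>Product rule for V Z V^t with V' = E V: skew symmetry of E turns the derivative of the
  transposed factor into multiplication by -E on the right, which leaves the commutator of E and the
  conjugated letter.\<close>

lemma mder_conj_letters:
  assumes pq: "p < N" "q < N" "p \<noteq> q" and X: "X \<in> carrier_mat N N" and Z: "sym_letters N Z"
  fixes Y :: "'v \<Rightarrow> bool" and v :: 'v
  defines "C \<equiv> \<lambda>t. conj_letters Y (rot N p q t * X) Z v"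
  shows "mder N C (if Y v then skew N p q * C \<theta> - C \<theta> * skew N p q else 0\<^sub>m N N) \<theta>"
proof (cases "Y v")
  case False
  then show ?thesis using mder_const sym_lettersD(1)[OF Z] by (simp add: C_def conj_letters_def)
next
  case True
  define V where "V t = rot N p q t * X" for t
  have V: "V t \<in> carrier_mat N N" for t using X by (auto simp: V_def intro!: mult_carrier_mat[of _ N N])
  define E where "E = skew N p q"
  have E: "E \<in> carrier_mat N N" "transpose_mat E = - E"
    using pq by (auto simp: E_def skew_transpose)
  have Zv: "Z v \<in> carrier_mat N N" using sym_lettersD(1)[OF Z] .
  have dV: "mder N V (E * V \<theta>) \<theta>" unfolding V_def E_def by (rule mder_rot_mult[OF pq X])
  then have dVT: "mder N (\<lambda>t. transpose_mat (V t)) (transpose_mat (E * V \<theta>)) \<theta>"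
    using V[THEN carrier_matD(1)] V[THEN carrier_matD(2)] E
    unfolding mder_def by auto
  have "mder N (\<lambda>t. V t * Z v) (E * V \<theta> * Z v + V \<theta> * 0\<^sub>m N N) \<theta>"
    by (rule mder_mult[OF V _ dV Zv _ mder_const[OF Zv]]) (use E V in auto)
  moreover have "E * V \<theta> * Z v + V \<theta> * 0\<^sub>m N N = E * V \<theta> * Z v"
    using E V[of \<theta>] Zv by (simp add: right_add_zero_mat[of _ N N])
  ultimately have "mder N (\<lambda>t. V t * Z v) (E * V \<theta> * Z v) \<theta>" by simp
  then have "mder N (\<lambda>t. V t * Z v * transpose_mat (V t))
     (E * V \<theta> * Z v * transpose_mat (V \<theta>) + V \<theta> * Z v * transpose_mat (E * V \<theta>)) \<theta>"
    by (rule mder_mult[OF _ _ _ _ _ dVT, rotated 2])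
      (use E V Zv in \<open>auto intro!: mult_carrier_mat[of _ N N _ N]\<close>)
  moreover have "E * V \<theta> * Z v * transpose_mat (V \<theta>) = E * (V \<theta> * Z v * transpose_mat (V \<theta>))"
    using E V[of \<theta>] Zv by (simp add: assoc_mult_mat[of _ N N _ N _ N])
  moreover have "V \<theta> * Z v * transpose_mat (E * V \<theta>) = - (V \<theta> * Z v * transpose_mat (V \<theta>) * E)"
  proof -
    have "V \<theta> * Z v * transpose_mat (E * V \<theta>) = V \<theta> * Z v * transpose_mat (V \<theta>) * (- E)"
      using E V[of \<theta>] Zv
      by (simp add: transpose_mult[of _ N N _ N] assoc_mult_mat[of _ N N _ N _ N])
    then show ?thesis using E V[of \<theta>] Zv
      by (simp add: uminus_mult_right_mat)
  qed
  moreover have "E * C \<theta> + - (C \<theta> * E) = E * C \<theta> - C \<theta> * E"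
    using E V[of \<theta>] Zv True
    by (intro minus_add_uminus_mat[symmetric, of _ N N]) (auto simp: C_def conj_letters_def V_def[symmetric])
  ultimately show ?thesis using True
    by (simp add: C_def conj_letters_def V_def[symmetric] E_def[symmetric])
qed

text \<open>The entry (a,b) of PEQ, where P and Q are the two parts of the word w split at
  position i and E is the generator of the rotation in the plane (p,q).\<close>

definition split_entry ::
    "nat \<Rightarrow> ('v \<Rightarrow> real mat) \<Rightarrow> nat \<Rightarrow> nat \<Rightarrow> 'v list \<Rightarrow> nat \<Rightarrow> nat \<Rightarrow> nat \<Rightarrow> real" where
  "split_entry N Z p q w a b i =
     wprod N Z (take i w) $$ (a, p) * wprod N Z (drop i w) $$ (q, b)
   - wprod N Z (take i w) $$ (a, q) * wprod N Z (drop i w) $$ (p, b)"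

text \<open>Leibniz rule along the word: the commutator at a \<open>Y\<close>-letter inserts E just
  before that letter and subtracts the insertion just after it, and these are the differences summed
  by \<open>ysum\<close>.\<close>

lemma wprod_has_derivative_rot:
  assumes pq: "p < N" "q < N" "p \<noteq> q" and X: "X \<in> carrier_mat N N" and Z: "sym_letters N Z"
  fixes Y :: "'v \<Rightarrow> bool"
  defines "C \<equiv> \<lambda>t. conj_letters Y (rot N p q t * X) Z"
  assumes ab: "a < N" "b < N"
  shows "((\<lambda>t. wprod N (C t) w $$ (a, b)) has_real_derivative
     ysum Y w (split_entry N (C \<theta>) p q w a b)) (at \<theta>)"
  using ab(1)
proof (induction w arbitrary: a)
  case Nil
  then show ?case by simp
next
  case (Cons v w)
  have VX: "rot N p q t * X \<in> carrier_mat N N" for t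
    using X by (auto intro!: mult_carrier_mat[of _ N N])
  have S: "sym_letters N (C t)" for t
    unfolding C_def by (rule sym_letters_conj[OF Z VX])
  note cc = sym_lettersD(1)[OF S] wprod_carrier[OF S]
  define E where "E = skew N p q"
  define D where "D = (if Y v then E * C \<theta> v - C \<theta> v * E else 0\<^sub>m N N)"
  have Ec: "E \<in> carrier_mat N N" by (simp add: E_def)
  have Dc: "D \<in> carrier_mat N N"
    using Ec cc(1)[of \<theta> v] by (auto simp: D_def intro!: minus_carrier_mat mult_carrier_mat[of _ N N])
  have dC: "mder N (\<lambda>t. C t v) D \<theta>"
    unfolding D_def E_def C_def by (rule mder_conj_letters[OF pq X Z])
  define W where "W t = wprod N (C t) w" for t
  have "((\<lambda>t. \<Sum>k<N. C t v $$ (a, k) * W t $$ (k, b)) has_real_derivative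
      (\<Sum>k<N. C \<theta> v $$ (a, k) * ysum Y w (split_entry N (C \<theta>) p q w k b)
            + D $$ (a, k) * W \<theta> $$ (k, b))) (at \<theta>)"
    using dC Cons by (intro DERIV_sum DERIV_mult') (auto simp: mder_def W_def)
  moreover have "(\<Sum>k<N. C t v $$ (a, k) * W t $$ (k, b)) = wprod N (C t) (v # w) $$ (a, b)" for t
    using index_mult_mat_sum[OF cc(1) cc(2) Cons.prems ab(2), of t v t w] by (simp add: W_def)
  moreover have "(\<Sum>k<N. C \<theta> v $$ (a, k) * ysum Y w (split_entry N (C \<theta>) p q w k b)
            + D $$ (a, k) * W \<theta> $$ (k, b)) = ysum Y (v # w) (split_entry N (C \<theta>) p q (v # w) a b)"
  proof -
    have shift: "split_entry N (C \<theta>) p q (v # w) a b (Suc i)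
        = (\<Sum>k<N. C \<theta> v $$ (a, k) * split_entry N (C \<theta>) p q w k b i)" for i
    proof -
      have "split_entry N (C \<theta>) p q (v # w) a b (Suc i) =
        (\<Sum>k<N. C \<theta> v $$ (a, k) * wprod N (C \<theta>) (take i w) $$ (k, p)) * wprod N (C \<theta>) (drop i w) $$ (q, b)
      - (\<Sum>k<N. C \<theta> v $$ (a, k) * wprod N (C \<theta>) (take i w) $$ (k, q)) * wprod N (C \<theta>) (drop i w) $$ (p, b)"
        unfolding split_entry_def
        using index_mult_mat_sum[OF cc(1) cc(2) Cons.prems pq(1), of \<theta> v \<theta> "take i w"]
          index_mult_mat_sum[OF cc(1) cc(2) Cons.prems pq(2), of \<theta> v \<theta> "take i w"] by simp
      also have "\<dots> = (\<Sum>k<N. C \<theta> v $$ (a, k) * split_entry N (C \<theta>) p q w k b i)"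
        by (simp add: split_entry_def sum_distrib_right right_diff_distrib sum_subtractf mult.assoc)
      finally show ?thesis .
    qed
    have "(\<Sum>k<N. C \<theta> v $$ (a, k) * ysum Y w (split_entry N (C \<theta>) p q w k b))
        = ysum Y w (\<lambda>i. split_entry N (C \<theta>) p q (v # w) a b (Suc i))"
      unfolding shift ysum_sum ysum_cmult ..
    moreover have "(\<Sum>k<N. D $$ (a, k) * W \<theta> $$ (k, b)) =
       (if Y v then split_entry N (C \<theta>) p q (v # w) a b 0 - split_entry N (C \<theta>) p q (v # w) a b (Suc 0) else 0)"
    proof (cases "Y v")
      case True
      have Wc: "W \<theta> \<in> carrier_mat N N" unfolding W_def by (rule cc)
      have "(\<Sum>k<N. D $$ (a, k) * W \<theta> $$ (k, b)) = (D * W \<theta>) $$ (a, b)"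
        using index_mult_mat_sum[OF Dc Wc Cons.prems ab(2)] by simp
      also have "D * W \<theta> = E * (C \<theta> v * W \<theta>) - C \<theta> v * (E * W \<theta>)"
        using True Ec cc(1)[of \<theta> v] Wc
        by (simp add: D_def minus_mult_distrib_mat[of _ N N _ _ N] assoc_mult_mat[of _ N N _ N _ N])
      also have "\<dots> $$ (a, b) = (E * (C \<theta> v * W \<theta>)) $$ (a, b) - (C \<theta> v * (E * W \<theta>)) $$ (a, b)"
        using Ec cc(1)[of \<theta> v] Wc Cons.prems ab(2) by simp
      also have "(E * (C \<theta> v * W \<theta>)) $$ (a, b) = split_entry N (C \<theta>) p q (v # w) a b 0"
        unfolding E_def using skew_mult_index[OF pq _ Cons.prems ab(2), of "C \<theta> v * W \<theta>"]
          cc(1)[of \<theta> v] Wc Cons.prems pq by (simp add: split_entry_def W_def mult_carrier_mat[of _ N N])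
      also have "(C \<theta> v * (E * W \<theta>)) $$ (a, b) = split_entry N (C \<theta>) p q (v # w) a b (Suc 0)"
      proof -
        have "C \<theta> v * (E * W \<theta>) = (C \<theta> v * E) * W \<theta>"
          using Ec cc(1)[of \<theta> v] Wc by (simp add: assoc_mult_mat[of _ N N _ N _ N])
        also have "\<dots> $$ (a, b) = (\<Sum>k<N. (C \<theta> v * E) $$ (a, k) * W \<theta> $$ (k, b))"
          using Ec cc(1)[of \<theta> v] Wc Cons.prems ab(2) by (intro index_mult_mat_sum) auto
        also have "\<dots> = (\<Sum>k<N. ((if k = q then 1 else 0) * C \<theta> v $$ (a, p)
            - (if k = p then 1 else 0) * C \<theta> v $$ (a, q)) * W \<theta> $$ (k, b))"
          using Cons.prems by (intro sum.cong refl) (simp add: E_def mult_skew_index[OF pq cc(1)])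
        also have "\<dots> = (\<Sum>k<N. (if k = q then C \<theta> v $$ (a, p) * W \<theta> $$ (k, b) else 0))
            - (\<Sum>k<N. (if k = p then C \<theta> v $$ (a, q) * W \<theta> $$ (k, b) else 0))"
          unfolding sum_subtractf[symmetric] by (intro sum.cong refl) (auto simp: left_diff_distrib)
        also have "\<dots> = C \<theta> v $$ (a, p) * W \<theta> $$ (q, b) - C \<theta> v $$ (a, q) * W \<theta> $$ (p, b)"
          using pq by simp
        finally show ?thesis using cc(1)[of \<theta> v] by (simp add: split_entry_def W_def)
      qed
      finally show ?thesis using True by simp
    next
      case False
      then show ?thesis using Cons.prems by (simp add: D_def)
    qed
    ultimately show ?thesis by (simp add: sum.distrib ysum_Cons)
  qed
  ultimately show ?case by simp
qed

section \<open>The Schwinger--Dyson identity\<close>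

text \<open>The same as measurability into \<open>mat_space N\<close>, by
  \<open>measurable_mat_space\<close> and \<open>entries_measurable_comp\<close>, but in the form
  that products and transposes visibly preserve.\<close>

definition entries_measurable :: "'a measure \<Rightarrow> nat \<Rightarrow> ('a \<Rightarrow> real mat) \<Rightarrow> bool" where
  "entries_measurable M N F \<longleftrightarrow> (\<forall>\<omega>\<in>space M. F \<omega> \<in> carrier_mat N N) \<and>
     (\<forall>i<N. \<forall>j<N. (\<lambda>\<omega>. F \<omega> $$ (i, j)) \<in> borel_measurable M)"

lemma entries_measurable_const:
  "A \<in> carrier_mat N N \<Longrightarrow> entries_measurable M N (\<lambda>_. A)"
  by (simp add: entries_measurable_def)

lemma entries_measurable_mult:
  assumes "entries_measurable M N F" "entries_measurable M N G"
  shows "entries_measurable M N (\<lambda>\<omega>. F \<omega> * G \<omega>)"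
  unfolding entries_measurable_def
proof (intro conjI allI impI ballI)
  show "F \<omega> * G \<omega> \<in> carrier_mat N N" if "\<omega> \<in> space M" for \<omega>
    using assms that by (auto simp: entries_measurable_def intro!: mult_carrier_mat[of _ N N])
  fix i j assume ij: "i < N" "j < N"
  have "(\<lambda>\<omega>. \<Sum>k<N. F \<omega> $$ (i, k) * G \<omega> $$ (k, j)) \<in> borel_measurable M"
    using assms ij by (intro borel_measurable_sum borel_measurable_times) (auto simp: entries_measurable_def)
  then show "(\<lambda>\<omega>. (F \<omega> * G \<omega>) $$ (i, j)) \<in> borel_measurable M"
    by (rule subst[OF measurable_cong, rotated])
      (use assms ij in \<open>auto simp: entries_measurable_def intro!: index_mult_mat_sum[symmetric]\<close>)
qed

lemma entries_measurable_transpose: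
  assumes "entries_measurable M N F"
  shows "entries_measurable M N (\<lambda>\<omega>. transpose_mat (F \<omega>))"
  unfolding entries_measurable_def
proof (intro conjI allI impI ballI)
  show "transpose_mat (F \<omega>) \<in> carrier_mat N N" if "\<omega> \<in> space M" for \<omega>
    using assms that by (auto simp: entries_measurable_def)
  fix i j assume ij: "i < N" "j < N"
  have "(\<lambda>\<omega>. F \<omega> $$ (j, i)) \<in> borel_measurable M"
    using assms ij by (auto simp: entries_measurable_def)
  then show "(\<lambda>\<omega>. transpose_mat (F \<omega>) $$ (i, j)) \<in> borel_measurable M"
    by (rule subst[OF measurable_cong, rotated])
      (use assms ij in \<open>fastforce simp: entries_measurable_def\<close>)
qed

lemma entries_measurable_wprod_conj:
  assumes Z: "sym_letters N Z" and F: "entries_measurable M N F"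
  shows "entries_measurable M N (\<lambda>\<omega>. wprod N (conj_letters Y (F \<omega>) Z) w)"
proof (induction w)
  case Nil
  then show ?case by (simp add: entries_measurable_const)
next
  case (Cons v w)
  have "entries_measurable M N (\<lambda>\<omega>. conj_letters Y (F \<omega>) Z v)"
    using sym_lettersD(1)[OF Z, of v] F
    by (cases "Y v") (auto simp: conj_letters_def
        intro!: entries_measurable_mult entries_measurable_const entries_measurable_transpose)
  from entries_measurable_mult[OF this Cons] show ?case by simp
qed

lemma borel_measurable_wtr_conj:
  assumes Z: "sym_letters N Z" and F: "entries_measurable M N F"
  shows "(\<lambda>\<omega>. wtr N (conj_letters Y (F \<omega>) Z) w) \<in> borel_measurable M"
proof -
  note m = entries_measurable_wprod_conj[OF assms, of Y w]
  have "(\<lambda>\<omega>. \<Sum>i<N. wprod N (conj_letters Y (F \<omega>) Z) w $$ (i, i)) \<in> borel_measurable M"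
    using m by (intro borel_measurable_sum) (auto simp: entries_measurable_def)
  then show ?thesis
    by (rule subst[OF measurable_cong, rotated])
      (use m in \<open>auto simp: entries_measurable_def wtr_def mtrace_def\<close>)
qed

lemma space_mat_space [simp]: "space (mat_space N) = carrier_mat N N"
  by (simp add: mat_space_def)

lemma entries_measurable_mat_space: "entries_measurable (mat_space N) N (\<lambda>V. V)"
  unfolding entries_measurable_def
proof (intro conjI allI impI ballI)
  fix i j assume ij: "i < N" "j < N"
  let ?I = "{..<N} \<times> {..<N}"
  have "(\<lambda>A. \<lambda>p\<in>?I. A $$ p) \<in> mat_space N \<rightarrow>\<^sub>M PiM ?I (\<lambda>_. borel :: real measure)"
    unfolding mat_space_def by (rule measurable_vimage_algebra1) (auto simp: space_PiM)
  from measurable_compose[OF this measurable_component_singleton[of "(i, j)"]] ij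
  show "(\<lambda>A. A $$ (i, j)) \<in> borel_measurable (mat_space N)" by simp
qed auto

lemma measurable_mat_space:
  assumes "entries_measurable M N F"
  shows "F \<in> M \<rightarrow>\<^sub>M mat_space N"
  unfolding mat_space_def
proof (rule measurable_vimage_algebra2)
  show "F \<in> space M \<rightarrow> carrier_mat N N" using assms by (auto simp: entries_measurable_def)
  show "(\<lambda>x. \<lambda>p\<in>{..<N} \<times> {..<N}. F x $$ p) \<in> M \<rightarrow>\<^sub>M PiM ({..<N} \<times> {..<N}) (\<lambda>_. borel)"
    using assms by (intro measurable_restrict) (auto simp: entries_measurable_def)
qed

lemma entries_measurable_comp:
  assumes "F \<in> M \<rightarrow>\<^sub>M mat_space N"
  shows "entries_measurable M N F"
proof -
  have "(\<lambda>\<omega>. F \<omega> $$ (i, j)) \<in> borel_measurable M" if "i < N" "j < N" for i j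
    using measurable_compose[OF assms, of "\<lambda>V. V $$ (i, j)" borel]
      entries_measurable_mat_space[of N] that by (simp add: entries_measurable_def)
  moreover have "F \<omega> \<in> carrier_mat N N" if "\<omega> \<in> space M" for \<omega>
    using measurable_space[OF assms that] by (simp only: space_mat_space)
  ultimately show ?thesis unfolding entries_measurable_def by blast
qed

lemma haar_random_integral:
  fixes f :: "real mat \<Rightarrow> real"
  assumes U: "haar_random M N G U" and V: "V \<in> G" "V \<in> carrier_mat N N"
    and f: "f \<in> borel_measurable (mat_space N)"
  shows "(\<integral>\<omega>. f (V * U \<omega>) \<partial>M) = (\<integral>\<omega>. f (U \<omega>) \<partial>M)"
proof -
  have U': "U \<in> M \<rightarrow>\<^sub>M mat_space N" using U by (simp add: haar_random_def)
  have VU: "(\<lambda>\<omega>. V * U \<omega>) \<in> M \<rightarrow>\<^sub>M mat_space N"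
    by (rule measurable_mat_space[OF entries_measurable_mult[OF
          entries_measurable_const[OF V(2)] entries_measurable_comp[OF U']]])
  have "(\<integral>\<omega>. f (V * U \<omega>) \<partial>M) = (\<integral>X. f X \<partial>distr M (mat_space N) (\<lambda>\<omega>. V * U \<omega>))"
    by (rule integral_distr[OF VU f, symmetric])
  also have "\<dots> = (\<integral>X. f X \<partial>distr M (mat_space N) U)"
    using U V by (simp add: haar_random_def)
  also have "\<dots> = (\<integral>\<omega>. f (U \<omega>) \<partial>M)"
    by (rule integral_distr[OF U' f])
  finally show ?thesis .
qed

text \<open>Differentiation under the integral along the times 1/(n+1). Every difference quotient
  has expectation 0 by invariance and is bounded by \<open>K\<close> by the mean value theorem, so
  dominated convergence passes to the derivative. The same Lipschitz bound carries boundedness,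
  hence integrability, from time 0 to positive times.\<close>

lemma (in prob_space) expectation_derivative_eq_0:
  fixes f f' :: "real \<Rightarrow> 'a \<Rightarrow> real"
  assumes meas: "\<And>t. f t \<in> borel_measurable M" "f' 0 \<in> borel_measurable M"
    and bnd: "\<And>\<omega>. \<omega> \<in> space M \<Longrightarrow> \<bar>f 0 \<omega>\<bar> \<le> B"
    and der: "\<And>t \<omega>. \<omega> \<in> space M \<Longrightarrow> ((\<lambda>s. f s \<omega>) has_real_derivative f' t \<omega>) (at t)"
    and bnd': "\<And>t \<omega>. \<omega> \<in> space M \<Longrightarrow> \<bar>f' t \<omega>\<bar> \<le> K"
    and inv: "\<And>t. expectation (f t) = expectation (f 0)"
  shows "expectation (f' 0) = 0"
proof -
  define h where "h n = inverse (real (Suc n))" for n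
  have h: "h n > 0" for n by (simp add: h_def)
  have h0: "h \<longlonglongrightarrow> 0" unfolding h_def by (rule LIMSEQ_inverse_real_of_nat)
  define g where "g n \<omega> = (f (h n) \<omega> - f 0 \<omega>) / h n" for n \<omega>
  have lip: "\<bar>f t \<omega> - f 0 \<omega>\<bar> \<le> K * t" if \<omega>: "\<omega> \<in> space M" and t: "t > 0" for t \<omega>
  proof -
    obtain z where "f t \<omega> - f 0 \<omega> = (t - 0) * f' z \<omega>"
      using MVT2[OF t, of "\<lambda>s. f s \<omega>" "\<lambda>s. f' s \<omega>"] der[OF \<omega>] by blast
    then show ?thesis using bnd'[OF \<omega>, of z] t by (simp add: abs_mult mult.commute)
  qed
  have gb: "\<bar>g n \<omega>\<bar> \<le> K" if "\<omega> \<in> space M" for n \<omega>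
    using lip[OF that h, of n] h[of n] by (simp add: g_def abs_divide divide_le_eq)
  have int: "integrable M (f t)" if "t \<ge> 0" for t
  proof (rule integrable_const_bound[where B = "B + K * t"])
    show "AE \<omega> in M. norm (f t \<omega>) \<le> B + K * t"
    proof (rule AE_I2)
      fix \<omega> assume \<omega>: "\<omega> \<in> space M"
      show "norm (f t \<omega>) \<le> B + K * t"
        using lip[OF \<omega>, of t] bnd[OF \<omega>] that by (cases "t = 0") auto
    qed
  qed (rule meas)
  have g0: "expectation (g n) = 0" for n
    using int[of "h n"] int[of 0] h[of n] inv[of "h n"] by (simp add: g_def[abs_def])
  have "(\<lambda>n. expectation (g n)) \<longlonglongrightarrow> expectation (f' 0)"
  proof (rule integral_dominated_convergence[where w = "\<lambda>_. K"])
    show "AE \<omega> in M. (\<lambda>n. g n \<omega>) \<longlonglongrightarrow> f' 0 \<omega>"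
    proof (rule AE_I2)
      fix \<omega> assume "\<omega> \<in> space M"
      then have "((\<lambda>t. (f (0 + t) \<omega> - f 0 \<omega>) / t) \<longlongrightarrow> f' 0 \<omega>) (at 0)"
        using der[of \<omega> 0] by (simp add: DERIV_def)
      moreover have "filterlim h (at 0) sequentially"
        using h0 h by (auto simp: filterlim_at less_imp_neq[THEN not_sym])
      ultimately show "(\<lambda>n. g n \<omega>) \<longlonglongrightarrow> f' 0 \<omega>"
        unfolding g_def using filterlim_compose[of "\<lambda>t. (f (0 + t) \<omega> - f 0 \<omega>) / t"] by fastforce
    qed
    show "g n \<in> borel_measurable M" for n
      unfolding g_def using meas by measurable
  qed (use gb meas in auto)
  then show ?thesis by (simp add: g0 LIMSEQ_const_iff)
qed

text \<open>The summand is Tr(E P E Q) for E = \<open>skew N p q\<close>, and the formula is the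
  Casimir identity of so(N): over p < q, the sum of E_ij E_kl is d_ik d_jl - d_il d_jk, with d the
  Kronecker symbol. The factor 2 arises because \<open>p\<close> and \<open>q\<close> run over
  ordered pairs.\<close>

lemma sum_skew_split:
  assumes P: "P \<in> carrier_mat N N" and Q: "Q \<in> carrier_mat N N"
  shows "(\<Sum>p<N. \<Sum>q<N. (P $$ (q, p) * Q $$ (q, p) - P $$ (q, q) * Q $$ (p, p))
        - (P $$ (p, p) * Q $$ (q, q) - P $$ (p, q) * Q $$ (p, q)))
     = 2 * (mtrace (P * transpose_mat Q) - mtrace P * mtrace Q)"
proof -
  have 1: "(\<Sum>p<N. \<Sum>q<N. P $$ (q, p) * Q $$ (q, p)) = mtrace (P * transpose_mat Q)"
    unfolding mtrace_mult_transpose[OF assms] by (rule sum.swap)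
  have 2: "(\<Sum>p<N. \<Sum>q<N. P $$ (p, q) * Q $$ (p, q)) = mtrace (P * transpose_mat Q)"
    unfolding mtrace_mult_transpose[OF assms] ..
  have 3: "(\<Sum>p<N. \<Sum>q<N. P $$ (p, p) * Q $$ (q, q)) = mtrace P * mtrace Q"
    using assms by (simp add: mtrace_def sum_product)
  have 4: "(\<Sum>p<N. \<Sum>q<N. P $$ (q, q) * Q $$ (p, p)) = mtrace P * mtrace Q"
    using 3 by (subst sum.swap)
  show ?thesis by (simp add: sum_subtractf 1 2 3 4)
qed

text \<open>The same contraction, applied to Tr(E W) Tr(P E Q): two traces are merged into one
  instead of one being split.\<close>

lemma sum_skew_pair:
  assumes W: "W \<in> carrier_mat N N" and P: "P \<in> carrier_mat N N" and Q: "Q \<in> carrier_mat N N"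
  shows "(\<Sum>p<N. \<Sum>q<N. (W $$ (q, p) - W $$ (p, q)) *
        (\<Sum>a<N. P $$ (a, p) * Q $$ (q, a) - P $$ (a, q) * Q $$ (p, a)))
     = 2 * (mtrace (W * transpose_mat (Q * P)) - mtrace (W * (Q * P)))"
proof -
  define R where "R = Q * P"
  have R: "R \<in> carrier_mat N N" using P Q by (auto simp: R_def intro!: mult_carrier_mat[of _ N N])
  have Ri: "(\<Sum>a<N. P $$ (a, p) * Q $$ (q, a)) = R $$ (q, p)" if "p < N" "q < N" for p q
    using index_mult_mat_sum[OF Q P that(2,1)] by (simp add: R_def mult.commute)
  have "(\<Sum>p<N. \<Sum>q<N. (W $$ (q, p) - W $$ (p, q)) *
        (\<Sum>a<N. P $$ (a, p) * Q $$ (q, a) - P $$ (a, q) * Q $$ (p, a)))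
     = (\<Sum>p<N. \<Sum>q<N. W $$ (q, p) * R $$ (q, p) + W $$ (p, q) * R $$ (p, q)
         - (W $$ (p, q) * R $$ (q, p) + W $$ (q, p) * R $$ (p, q)))"
    by (intro sum.cong refl) (simp add: sum_subtractf Ri algebra_simps)
  also have "\<dots> = 2 * (mtrace (W * transpose_mat R) - mtrace (W * R))"
  proof -
    have 1: "(\<Sum>p<N. \<Sum>q<N. W $$ (q, p) * R $$ (q, p)) = mtrace (W * transpose_mat R)"
      unfolding mtrace_mult_transpose[OF W R] by (rule sum.swap)
    have 2: "(\<Sum>p<N. \<Sum>q<N. W $$ (q, p) * R $$ (p, q)) = mtrace (W * R)"
      unfolding mtrace_mult[OF W R] by (rule sum.swap)
    show ?thesis
      by (simp add: sum_subtractf sum.distrib 1 2 mtrace_mult_transpose[OF W R, symmetric]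
          mtrace_mult[OF W R, symmetric])
  qed
  finally show ?thesis by (simp add: R_def)
qed

text \<open>The two quantities produced by the sum of \<open>E \<otimes> E\<close> over all generators E of the rotation
  group: the first by a generator hitting the word it is paired with, the second by a generator
  hitting another copy of the trace of w.\<close>

definition sd_split :: "nat \<Rightarrow> ('v \<Rightarrow> real mat) \<Rightarrow> 'v list \<Rightarrow> nat \<Rightarrow> real" where
  "sd_split N Z w i = wtr N Z (take i w @ rev (drop i w)) - wtr N Z (take i w) * wtr N Z (drop i w)"

definition sd_merge :: "nat \<Rightarrow> ('v \<Rightarrow> real mat) \<Rightarrow> 'v list \<Rightarrow> nat \<Rightarrow> real" where
  "sd_merge N Z w i = wtr N Z (w @ rev (drop i w @ take i w)) - wtr N Z (w @ drop i w @ take i w)"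

lemma sum_split_entry:
  assumes "sym_letters N Z"
  shows "(\<Sum>p<N. \<Sum>q<N. ysum Y w (split_entry N Z p q w q p) - ysum Y w (split_entry N Z p q w p q))
       = 2 * ysum Y w (sd_split N Z w)"
proof -
  have "(\<Sum>p<N. \<Sum>q<N. ysum Y w (split_entry N Z p q w q p) - ysum Y w (split_entry N Z p q w p q))
      = ysum Y w (\<lambda>i. \<Sum>p<N. \<Sum>q<N. split_entry N Z p q w q p i - split_entry N Z p q w p q i)"
    by (simp only: ysum_sum ysum_diff)
  also have "(\<lambda>i. \<Sum>p<N. \<Sum>q<N. split_entry N Z p q w q p i - split_entry N Z p q w p q i)
      = (\<lambda>i. 2 * sd_split N Z w i)"
    unfolding split_entry_def sd_split_def wtr_append_rev[OF assms]
    by (subst sum_skew_split) (simp_all add: assms wtr_def)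
  finally show ?thesis by (simp add: ysum_cmult)
qed

lemma sum_split_entry_pair:
  assumes "sym_letters N Z"
  shows "(\<Sum>p<N. \<Sum>q<N. (wprod N Z w $$ (q, p) - wprod N Z w $$ (p, q)) *
           (\<Sum>a<N. ysum Y w (split_entry N Z p q w a a))) = 2 * ysum Y w (sd_merge N Z w)"
proof -
  have "(\<Sum>p<N. \<Sum>q<N. (wprod N Z w $$ (q, p) - wprod N Z w $$ (p, q)) *
           (\<Sum>a<N. ysum Y w (split_entry N Z p q w a a)))
     = ysum Y w (\<lambda>i. \<Sum>p<N. \<Sum>q<N. (wprod N Z w $$ (q, p) - wprod N Z w $$ (p, q)) *
           (\<Sum>a<N. split_entry N Z p q w a a i))"
    by (simp only: ysum_sum ysum_cmult)
  also have "(\<lambda>i. \<Sum>p<N. \<Sum>q<N. (wprod N Z w $$ (q, p) - wprod N Z w $$ (p, q)) *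
           (\<Sum>a<N. split_entry N Z p q w a a i)) = (\<lambda>i. 2 * sd_merge N Z w i)"
    unfolding split_entry_def sd_merge_def wtr_append_rev[OF assms] wtr_append[OF assms, of w] 
    by (subst sum_skew_pair) (simp_all add: assms wprod_append)
  finally show ?thesis by (simp add: ysum_cmult)
qed

lemma ysum_bounded:
  fixes f :: "'a \<Rightarrow> nat \<Rightarrow> real"
  assumes "\<And>i. \<exists>K. \<forall>x\<in>S. \<bar>f x i\<bar> \<le> K"
  shows "\<exists>K. \<forall>x\<in>S. \<bar>ysum Y w (f x)\<bar> \<le> K"
proof -
  obtain K where K: "\<And>i x. x \<in> S \<Longrightarrow> \<bar>f x i\<bar> \<le> K i" using assms by metis
  have "\<bar>ysum Y w (f x)\<bar> \<le> (\<Sum>i<length w. \<bar>K i\<bar> + \<bar>K (Suc i)\<bar>)" if "x \<in> S" for x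
    unfolding ysum_def
  proof (rule order_trans[OF sum_abs sum_mono])
    fix i
    show "\<bar>if Y (w ! i) then f x i - f x (Suc i) else 0\<bar> \<le> \<bar>K i\<bar> + \<bar>K (Suc i)\<bar>"
      using K[OF that, of i] K[OF that, of "Suc i"] by auto
  qed
  then show ?thesis by blast
qed

text \<open>The function differentiated in the direction E is Tr(E W) \<phi>(Tr W), with W the
  matrix of \<open>w\<close> and the same E in both places. Differentiating the first factor gives
  the splitting terms, the chain rule on \<phi> the merging terms, once everything is summed over
  the planes. A constant \<phi> yields the limit equations, a seventh power the
  concentration.\<close>

theorem schwinger_dyson:
  fixes \<phi> \<phi>' :: "real \<Rightarrow> real" and Y :: "'v \<Rightarrow> bool"
  assumes M: "prob_space M" and U: "haar_random M N G U" and G: "G \<subseteq> orth_group N" "sorth_group N \<subseteq> G"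
    and Z: "sym_letters N Z"
    and \<phi>: "\<And>x. (\<phi> has_real_derivative \<phi>' x) (at x)" "continuous_on UNIV \<phi>'"
  defines "C \<equiv> \<lambda>\<omega>. conj_letters Y (U \<omega>) Z"
  shows "(\<integral>\<omega>. ysum Y w (sd_split N (C \<omega>) w) * \<phi> (wtr N (C \<omega>) w)
            + \<phi>' (wtr N (C \<omega>) w) * ysum Y w (sd_merge N (C \<omega>) w) \<partial>M) = 0"
proof -
  interpret prob_space M by (rule M)
  have U': "entries_measurable M N U"
    using U by (auto simp: haar_random_def intro: entries_measurable_comp)
  have Uorth: "U \<omega> \<in> orth_group N" if "\<omega> \<in> space M" for \<omega>
    using U G that by (auto simp: haar_random_def)
  define K where "K V = conj_letters Y V Z" for V
  define F where "F p q V = (wprod N (K V) w $$ (q, p) - wprod N (K V) w $$ (p, q)) * \<phi> (wtr N (K V) w)"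
    for p q V
  define D where "D p q V = (ysum Y w (split_entry N (K V) p q w q p) - ysum Y w (split_entry N (K V) p q w p q))
        * \<phi> (wtr N (K V) w)
      + \<phi>' (wtr N (K V) w) * ((wprod N (K V) w $$ (q, p) - wprod N (K V) w $$ (p, q))
          * (\<Sum>a<N. ysum Y w (split_entry N (K V) p q w a a)))" for p q V
  have S: "sym_letters N (K V)" if "V \<in> carrier_mat N N" for V
    unfolding K_def by (rule sym_letters_conj[OF Z that])
  have c\<phi>: "continuous_on UNIV \<phi>"
    using \<phi>(1) by (meson DERIV_isCont continuous_at_imp_continuous_on)
  have m\<phi>: "\<phi> \<in> borel_measurable borel" "\<phi>' \<in> borel_measurable borel"
    using c\<phi> \<phi>(2) by (auto intro: borel_measurable_continuous_onI)
  \<comment> \<open>The \<open>bnd_\<close> facts assemble, at fixed \<open>N\<close>, bounds on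
    \<open>F\<close> and \<open>D\<close> that are uniform over the orthogonal group; these give the
    dominating constants as well as integrability.\<close>
  have bnd_entry: "\<exists>B. \<forall>V\<in>orth_group N. \<bar>wprod N (K V) u $$ (i, j)\<bar> \<le> B" if "i < N" "j < N" for u i j
    using wprod_conj_entries_bounded[OF Z, of Y u] that unfolding K_def by blast
  have bnd_mult: "\<exists>B. \<forall>V\<in>orth_group N. \<bar>f V * g V\<bar> \<le> B"
    if "\<exists>B. \<forall>V\<in>orth_group N. \<bar>f V\<bar> \<le> B" "\<exists>B. \<forall>V\<in>orth_group N. \<bar>g V\<bar> \<le> B" for f g :: "real mat \<Rightarrow> real"
  proof -
    from that obtain B1 B2 where B: "\<forall>V\<in>orth_group N. \<bar>f V\<bar> \<le> B1" "\<forall>V\<in>orth_group N. \<bar>g V\<bar> \<le> B2" by blast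
    have "\<bar>f V * g V\<bar> \<le> \<bar>B1\<bar> * \<bar>B2\<bar>" if "V \<in> orth_group N" for V
      unfolding abs_mult using B(1)[rule_format, OF that] B(2)[rule_format, OF that]
      by (intro mult_mono) linarith+
    then show ?thesis by blast
  qed
  have bnd_add: "\<exists>B. \<forall>V\<in>orth_group N. \<bar>f V + g V\<bar> \<le> B"
    if "\<exists>B. \<forall>V\<in>orth_group N. \<bar>f V\<bar> \<le> B" "\<exists>B. \<forall>V\<in>orth_group N. \<bar>g V\<bar> \<le> B" for f g :: "real mat \<Rightarrow> real"
  proof -
    from that obtain B1 B2 where B: "\<forall>V\<in>orth_group N. \<bar>f V\<bar> \<le> B1" "\<forall>V\<in>orth_group N. \<bar>g V\<bar> \<le> B2" by blast
    have "\<bar>f V + g V\<bar> \<le> B1 + B2" if "V \<in> orth_group N" for V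
      using B(1)[rule_format, OF that] B(2)[rule_format, OF that] by linarith
    then show ?thesis by blast
  qed
  have bnd_diff: "\<exists>B. \<forall>V\<in>orth_group N. \<bar>f V - g V\<bar> \<le> B"
    if "\<exists>B. \<forall>V\<in>orth_group N. \<bar>f V\<bar> \<le> B" "\<exists>B. \<forall>V\<in>orth_group N. \<bar>g V\<bar> \<le> B" for f g :: "real mat \<Rightarrow> real"
  proof -
    from that obtain B1 B2 where B: "\<forall>V\<in>orth_group N. \<bar>f V\<bar> \<le> B1" "\<forall>V\<in>orth_group N. \<bar>g V\<bar> \<le> B2" by blast
    have "\<bar>f V - g V\<bar> \<le> B1 + B2" if "V \<in> orth_group N" for V
      using B(1)[rule_format, OF that] B(2)[rule_format, OF that] by linarith
    then show ?thesis by blast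
  qed
  have bnd_sum: "\<exists>B. \<forall>V\<in>orth_group N. \<bar>\<Sum>a<n. f V a\<bar> \<le> B"
    if "\<And>a. a < n \<Longrightarrow> \<exists>B. \<forall>V\<in>orth_group N. \<bar>f V a\<bar> \<le> B" for f :: "real mat \<Rightarrow> nat \<Rightarrow> real" and n
    using that
  proof (induction n)
    case (Suc n)
    then show ?case by (auto intro!: bnd_add)
  qed auto
  have bnd_split: "\<exists>B. \<forall>V\<in>orth_group N. \<bar>ysum Y w (split_entry N (K V) p q w a b)\<bar> \<le> B"
    if "p < N" "q < N" "a < N" "b < N" for p q a b
    unfolding split_entry_def using that by (intro ysum_bounded bnd_diff bnd_mult bnd_entry)
  have wtrK: "wtr N (K V) w = (\<Sum>a<N. wprod N (K V) w $$ (a, a))" if "V \<in> carrier_mat N N" for V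
    using S[OF that] by (simp add: wtr_def mtrace_def)
  have bnd_tr: "\<exists>B. \<forall>V\<in>orth_group N. \<bar>wtr N (K V) w\<bar> \<le> B"
  proof -
    have "\<exists>B. \<forall>V\<in>orth_group N. \<bar>\<Sum>a<N. wprod N (K V) w $$ (a, a)\<bar> \<le> B"
      by (intro bnd_sum bnd_entry)
    then show ?thesis using wtrK orth_groupD(1) by metis
  qed
  have bnd_cont: "\<exists>B. \<forall>V\<in>orth_group N. \<bar>\<psi> (wtr N (K V) w)\<bar> \<le> B"
    if \<psi>: "continuous_on UNIV \<psi>" for \<psi> :: "real \<Rightarrow> real"
  proof -
    obtain B where B: "\<forall>V\<in>orth_group N. \<bar>wtr N (K V) w\<bar> \<le> B" using bnd_tr by blast
    have "compact (\<psi> ` {-B..B})"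
      using \<psi> by (intro compact_continuous_image) (auto intro: continuous_on_subset)
    then obtain B' where "\<forall>x\<in>\<psi> ` {-B..B}. norm x \<le> B'"
      using compact_imp_bounded bounded_iff by blast
    then have "\<forall>x\<in>{-B..B}. \<bar>\<psi> x\<bar> \<le> B'" by simp
    moreover have "wtr N (K V) w \<in> {-B..B}" if "V \<in> orth_group N" for V
      using B[rule_format, OF that] by (simp add: abs_le_iff)
    ultimately show ?thesis by blast
  qed
  have bF: "\<exists>B. \<forall>V\<in>orth_group N. \<bar>F p q V\<bar> \<le> B" if "p < N" "q < N" for p q
    unfolding F_def using that by (intro bnd_mult bnd_diff bnd_entry bnd_cont c\<phi>)
  have bD: "\<exists>B. \<forall>V\<in>orth_group N. \<bar>D p q V\<bar> \<le> B" if "p < N" "q < N" for p q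
    unfolding D_def using that
    by (intro bnd_mult bnd_diff bnd_add bnd_sum bnd_split bnd_entry bnd_cont c\<phi> \<phi>(2))
  have me: "(\<lambda>\<omega>. wprod N (K (V \<omega>)) u $$ (i, j)) \<in> borel_measurable M'"
    if "entries_measurable M' N V" "i < N" "j < N" for M' :: "'c measure" and V u i j
    using entries_measurable_wprod_conj[OF Z that(1), of Y u] that by (simp add: entries_measurable_def K_def)
  have mt: "(\<lambda>\<omega>. wtr N (K (V \<omega>)) w) \<in> borel_measurable M'"
    if "entries_measurable M' N V" for M' :: "'c measure" and V
    using borel_measurable_wtr_conj[OF Z that, of Y w] by (simp add: K_def)
  have mF: "F p q \<in> borel_measurable (mat_space N)" if "p < N" "q < N" for p q
    unfolding F_def using that me[OF entries_measurable_mat_space] mt[OF entries_measurable_mat_space]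
    by (intro borel_measurable_times borel_measurable_diff measurable_compose[OF _ m\<phi>(1)]) auto
  have mys: "(\<lambda>\<omega>. ysum Y w (split_entry N (K (U \<omega>)) p q w a b)) \<in> borel_measurable M"
    if "p < N" "q < N" "a < N" "b < N" for p q a b
    unfolding ysum_def split_entry_def
    by (intro borel_measurable_sum borel_measurable_times borel_measurable_diff measurable_If me[OF U'] that) auto
  have mD: "(\<lambda>\<omega>. D p q (U \<omega>)) \<in> borel_measurable M" if "p < N" "q < N" for p q
    unfolding D_def using that
    by (intro borel_measurable_times borel_measurable_diff borel_measurable_add borel_measurable_sum
        measurable_compose[OF _ m\<phi>(1)] measurable_compose[OF _ m\<phi>(2)] mys me[OF U'] mt[OF U']) auto
  have der: "((\<lambda>s. F p q (rot N p q s * X)) has_real_derivative D p q (rot N p q t * X)) (at t)"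
    if pq: "p < N" "q < N" "p \<noteq> q" and X: "X \<in> carrier_mat N N" for p q X t
  proof -
    have RX: "rot N p q s * X \<in> carrier_mat N N" for s using X by (auto intro!: mult_carrier_mat[of _ N N])
    note dW = wprod_has_derivative_rot[OF pq X Z, where Y = Y and w = w and \<theta> = t, folded K_def]
    have dtr: "((\<lambda>s. wtr N (K (rot N p q s * X)) w) has_real_derivative
        (\<Sum>a<N. ysum Y w (split_entry N (K (rot N p q t * X)) p q w a a))) (at t)"
      unfolding wtrK[OF RX] by (intro DERIV_sum dW) auto
    show ?thesis unfolding F_def D_def
      by (rule DERIV_cong, rule DERIV_mult', rule DERIV_diff, rule dW[OF pq(2,1)], rule dW[OF pq(1,2)],
          rule DERIV_chain2[OF \<phi>(1) dtr]) (simp add: algebra_simps)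
  qed
  have int0: "expectation (\<lambda>\<omega>. D p q (U \<omega>)) = 0" if pq: "p < N" "q < N" for p q
  proof (cases "p = q")
    case True
    then have "D p q V = 0" for V by (simp add: D_def split_entry_def)
    then show ?thesis by simp
  next
    case False
    have R: "rot N p q t \<in> G" "rot N p q t \<in> orth_group N" for t
      using rot_in_sorth_group[OF pq False] G by auto
    obtain B where B: "\<forall>V\<in>orth_group N. \<bar>F p q V\<bar> \<le> B" using bF[OF pq] by blast
    obtain B' where B': "\<forall>V\<in>orth_group N. \<bar>D p q V\<bar> \<le> B'" using bD[OF pq] by blast
    have "expectation (\<lambda>\<omega>. D p q (rot N p q 0 * U \<omega>)) = 0"
    proof (rule expectation_derivative_eq_0[where f = "\<lambda>t \<omega>. F p q (rot N p q t * U \<omega>)" and B = B and K = B'])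
      show "(\<lambda>\<omega>. F p q (rot N p q t * U \<omega>)) \<in> borel_measurable M" for t
        by (rule measurable_compose[OF measurable_mat_space mF[OF pq]])
          (intro entries_measurable_mult entries_measurable_const U' rot_carrier)
      have "(\<lambda>\<omega>. D p q (rot N p q 0 * U \<omega>)) \<in> borel_measurable M \<longleftrightarrow> (\<lambda>\<omega>. D p q (U \<omega>)) \<in> borel_measurable M"
        using U' by (intro measurable_cong) (auto simp: rot_0 entries_measurable_def)
      then show "(\<lambda>\<omega>. D p q (rot N p q 0 * U \<omega>)) \<in> borel_measurable M" using mD[OF pq] by simp
      show "\<bar>F p q (rot N p q 0 * U \<omega>)\<bar> \<le> B" if "\<omega> \<in> space M" for \<omega>
        using B orth_group_mult[OF R(2) Uorth[OF that]] by blast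
      show "\<bar>D p q (rot N p q t * U \<omega>)\<bar> \<le> B'" if "\<omega> \<in> space M" for t \<omega>
        using B' orth_group_mult[OF R(2) Uorth[OF that]] by blast
      show "((\<lambda>s. F p q (rot N p q s * U \<omega>)) has_real_derivative D p q (rot N p q t * U \<omega>)) (at t)"
        if "\<omega> \<in> space M" for t \<omega>
        using der[OF pq False] orth_groupD(1)[OF Uorth[OF that]] by blast
      show "expectation (\<lambda>\<omega>. F p q (rot N p q t * U \<omega>)) = expectation (\<lambda>\<omega>. F p q (rot N p q 0 * U \<omega>))" for t
        using haar_random_integral[OF U R(1) rot_carrier mF[OF pq]] by simp
    qed
    moreover have "expectation (\<lambda>\<omega>. D p q (rot N p q 0 * U \<omega>)) = expectation (\<lambda>\<omega>. D p q (U \<omega>))"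
      using U' by (intro Bochner_Integration.integral_cong) (auto simp: rot_0 entries_measurable_def)
    ultimately show ?thesis by simp
  qed
  have intD: "integrable M (\<lambda>\<omega>. D p q (U \<omega>))" if pq: "p < N" "q < N" for p q
  proof -
    obtain B' where B': "\<forall>V\<in>orth_group N. \<bar>D p q V\<bar> \<le> B'" using bD[OF pq] by blast
    then show ?thesis using mD[OF pq] Uorth by (intro integrable_const_bound[where B = B']) auto
  qed
  have "expectation (\<lambda>\<omega>. \<Sum>p<N. \<Sum>q<N. D p q (U \<omega>)) = (\<Sum>p<N. expectation (\<lambda>\<omega>. \<Sum>q<N. D p q (U \<omega>)))"
    using intD by (intro Bochner_Integration.integral_sum Bochner_Integration.integrable_sum) auto
  also have "\<dots> = (\<Sum>p<N. \<Sum>q<N. expectation (\<lambda>\<omega>. D p q (U \<omega>)))"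
    using intD by (intro sum.cong refl Bochner_Integration.integral_sum) auto
  finally have 0: "expectation (\<lambda>\<omega>. \<Sum>p<N. \<Sum>q<N. D p q (U \<omega>)) = 0" by (simp add: int0)
  have "(\<Sum>p<N. \<Sum>q<N. D p q (U \<omega>)) = 2 * (ysum Y w (sd_split N (C \<omega>) w) * \<phi> (wtr N (C \<omega>) w)
            + \<phi>' (wtr N (C \<omega>) w) * ysum Y w (sd_merge N (C \<omega>) w))" if "\<omega> \<in> space M" for \<omega>
  proof -
    have S': "sym_letters N (C \<omega>)" using S[OF orth_groupD(1)[OF Uorth[OF that]]] by (simp add: C_def K_def)
    show ?thesis
      unfolding D_def K_def C_def[symmetric, THEN meta_eq_to_obj_eq, THEN fun_cong]
      by (simp only: sum.distrib sum_distrib_left[symmetric] sum_distrib_right[symmetric]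
          sum_split_entry[OF S', of Y w] sum_split_entry_pair[OF S', of w Y]) (simp add: algebra_simps)
  qed
  with 0 have "expectation (\<lambda>\<omega>. 2 * (ysum Y w (sd_split N (C \<omega>) w) * \<phi> (wtr N (C \<omega>) w)
            + \<phi>' (wtr N (C \<omega>) w) * ysum Y w (sd_merge N (C \<omega>) w))) = 0"
    by (subst (asm) Bochner_Integration.integral_cong[OF refl])
  then show ?thesis unfolding integral_mult_right_zero by simp
qed

section \<open>Concentration\<close>

lemma power8_add_le: "(a + b) ^ 8 \<le> 256 * (a ^ 8 + b ^ 8 :: real)"
proof -
  define m where "m = max \<bar>a\<bar> \<bar>b\<bar>"
  have "(a + b) ^ 8 = \<bar>a + b\<bar> ^ 8" by (simp add: power_even_abs)
  also have "\<dots> \<le> (2 * m) ^ 8" by (intro power_mono) (auto simp: m_def)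
  also have "\<dots> = 256 * m ^ 8" by (simp add: power_mult_distrib)
  also have "m ^ 8 \<le> a ^ 8 + b ^ 8"
    by (cases "\<bar>a\<bar> \<le> \<bar>b\<bar>") (auto simp: m_def max_def power_even_abs)
  finally show ?thesis by simp
qed

text \<open>Young's inequality, by distinguishing whether the perturbation is small compared with x.\<close>

lemma power8_absorb:
  fixes x d q :: real
  shows "d * x ^ 7 - 7 * x ^ 6 * q \<le> x ^ 8 / 2 + 4 ^ 7 * d ^ 8 + 7 * 28 ^ 3 * q ^ 4"
proof -
  \<comment> \<open>The thresholds \<open>4 * a\<close> here and \<open>28 * a\<close> (28 = 4 * 7)
    below are chosen so that each of the two perturbations costs a quarter of \<open>x ^ 8\<close>.
    The second inequality is used with \<open>t\<close> the square of \<open>x\<close>.\<close>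
  have young1: "a * t ^ 7 \<le> t ^ 8 / 4 + 4 ^ 7 * a ^ 8" if "0 \<le> a" "0 \<le> t" for a t :: real
  proof (cases "4 * a \<le> t")
    case True
    then have "4 * a * t ^ 7 \<le> t * t ^ 7" using that by (intro mult_right_mono) auto
    also have "t * t ^ 7 = t ^ 8" by (simp flip: power_Suc)
    finally have "a * t ^ 7 \<le> t ^ 8 / 4" by simp
    then show ?thesis using that by (intro add_increasing2) auto
  next
    case False
    then have "a * t ^ 7 \<le> a * (4 * a) ^ 7" using that by (intro mult_left_mono power_mono) auto
    also have "a * (4 * a) ^ 7 = 4 ^ 7 * (a * a ^ 7)" by (simp add: power_mult_distrib)
    also have "a * a ^ 7 = a ^ 8" by (simp flip: power_Suc)
    finally show ?thesis using that by (intro add_increasing) auto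
  qed
  have young2: "7 * t ^ 3 * a \<le> t ^ 4 / 4 + 7 * 28 ^ 3 * a ^ 4" if "0 \<le> a" "0 \<le> t" for a t :: real
  proof (cases "28 * a \<le> t")
    case True
    then have "28 * a * t ^ 3 \<le> t * t ^ 3" using that by (intro mult_right_mono) auto
    also have "t * t ^ 3 = t ^ 4" by (simp flip: power_Suc)
    finally have "7 * t ^ 3 * a \<le> t ^ 4 / 4" by (simp add: mult.commute mult.left_commute)
    then show ?thesis using that by (intro add_increasing2) auto
  next
    case False
    then have "7 * t ^ 3 * a \<le> 7 * (28 * a) ^ 3 * a"
      using that by (intro mult_right_mono mult_left_mono power_mono) auto
    also have "7 * (28 * a) ^ 3 * a = 7 * 28 ^ 3 * (a * a ^ 3)" by (simp add: power_mult_distrib)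
    also have "a * a ^ 3 = a ^ 4" by (simp flip: power_Suc)
    finally show ?thesis using that by (intro add_increasing) auto
  qed
  have "d * x ^ 7 \<le> \<bar>d\<bar> * \<bar>x\<bar> ^ 7" by (metis abs_ge_self abs_mult power_abs)
  also have "\<dots> \<le> x ^ 8 / 4 + 4 ^ 7 * d ^ 8"
    using young1[of "\<bar>d\<bar>" "\<bar>x\<bar>"] by (simp add: power_even_abs)
  finally have 1: "d * x ^ 7 \<le> x ^ 8 / 4 + 4 ^ 7 * d ^ 8" .
  have p: "x ^ 6 = (x\<^sup>2) ^ 3" "x ^ 8 = (x\<^sup>2) ^ 4"
    by (simp_all only: power_mult[symmetric]) simp_all
  have "0 \<le> 7 * (x\<^sup>2) ^ 3" by simp
  from mult_left_mono[OF abs_ge_minus_self[of q] this]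
  have "- (7 * (x\<^sup>2) ^ 3 * q) \<le> 7 * (x\<^sup>2) ^ 3 * \<bar>q\<bar>" by (simp only: mult_minus_right)
  also have "\<dots> \<le> (x\<^sup>2) ^ 4 / 4 + 7 * 28 ^ 3 * \<bar>q\<bar> ^ 4"
    by (rule young2) auto
  also have "\<bar>q\<bar> ^ 4 = q ^ 4" by (simp add: power_even_abs)
  finally have 2: "- (7 * x ^ 6 * q) \<le> x ^ 8 / 4 + 7 * 28 ^ 3 * q ^ 4" by (simp only: p)
  have "d * x ^ 7 - 7 * x ^ 6 * q = d * x ^ 7 + - (7 * x ^ 6 * q)" by simp
  also have "\<dots> \<le> (x ^ 8 / 4 + 4 ^ 7 * d ^ 8) + (x ^ 8 / 4 + 7 * 28 ^ 3 * q ^ 4)"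
    by (rule add_mono[OF 1 2])
  finally show ?thesis by simp
qed

section \<open>Bounded random variables and the calculus of concentrated sequences\<close>

context prob_space
begin

text \<open>At fixed \<open>N\<close> every quantity met here is bounded, so integrability follows
  from closure rules. The bound may depend on \<open>N\<close>; rates are stated separately.\<close>

definition bdd_rv :: "('a \<Rightarrow> real) \<Rightarrow> bool" where
  "bdd_rv f \<longleftrightarrow> f \<in> borel_measurable M \<and> (\<exists>B. \<forall>\<omega>\<in>space M. \<bar>f \<omega>\<bar> \<le> B)"

lemma bdd_rv_const: "bdd_rv (\<lambda>_. c)"
  by (auto simp: bdd_rv_def)

lemma bdd_rv_add:
  assumes "bdd_rv f" "bdd_rv g" shows "bdd_rv (\<lambda>\<omega>. f \<omega> + g \<omega>)"
proof -
  obtain B1 B2 where B: "\<And>\<omega>. \<omega> \<in> space M \<Longrightarrow> \<bar>f \<omega>\<bar> \<le> B1" "\<And>\<omega>. \<omega> \<in> space M \<Longrightarrow> \<bar>g \<omega>\<bar> \<le> B2"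
    using assms by (auto simp: bdd_rv_def)
  have "\<bar>f \<omega> + g \<omega>\<bar> \<le> B1 + B2" if "\<omega> \<in> space M" for \<omega>
    using B(1)[OF that] B(2)[OF that] by linarith
  then show ?thesis using assms by (auto simp: bdd_rv_def)
qed

lemma bdd_rv_mult:
  assumes "bdd_rv f" "bdd_rv g" shows "bdd_rv (\<lambda>\<omega>. f \<omega> * g \<omega>)"
proof -
  obtain B1 B2 where B: "\<And>\<omega>. \<omega> \<in> space M \<Longrightarrow> \<bar>f \<omega>\<bar> \<le> B1" "\<And>\<omega>. \<omega> \<in> space M \<Longrightarrow> \<bar>g \<omega>\<bar> \<le> B2"
    using assms by (auto simp: bdd_rv_def)
  have "\<bar>f \<omega> * g \<omega>\<bar> \<le> \<bar>B1\<bar> * \<bar>B2\<bar>" if "\<omega> \<in> space M" for \<omega>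
    unfolding abs_mult using B(1)[OF that] B(2)[OF that] by (intro mult_mono) linarith+
  then show ?thesis using assms by (auto simp: bdd_rv_def)
qed

lemma bdd_rv_diff: "bdd_rv f \<Longrightarrow> bdd_rv g \<Longrightarrow> bdd_rv (\<lambda>\<omega>. f \<omega> - g \<omega>)"
  using bdd_rv_add[of f "\<lambda>\<omega>. -1 * g \<omega>"] bdd_rv_mult[OF bdd_rv_const[of "-1"], of g] by simp

lemma bdd_rv_divide: "bdd_rv f \<Longrightarrow> bdd_rv (\<lambda>\<omega>. f \<omega> / c)"
  using bdd_rv_mult[OF _ bdd_rv_const[of "inverse c"], of f] by (simp add: field_class.field_divide_inverse)

lemma bdd_rv_power: "bdd_rv f \<Longrightarrow> bdd_rv (\<lambda>\<omega>. f \<omega> ^ n)"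
  by (induction n) (auto intro: bdd_rv_const bdd_rv_mult)

lemma bdd_rv_sum: "(\<And>i. i \<in> I \<Longrightarrow> bdd_rv (f i)) \<Longrightarrow> bdd_rv (\<lambda>\<omega>. \<Sum>i\<in>I. f i \<omega>)"
  by (induction I rule: infinite_finite_induct) (auto intro: bdd_rv_const bdd_rv_add)

lemma bdd_rv_ysum:
  assumes "\<And>i. bdd_rv (\<lambda>\<omega>. f \<omega> i)"
  shows "bdd_rv (\<lambda>\<omega>. ysum Y w (f \<omega>))"
proof -
  have "bdd_rv (\<lambda>\<omega>. if Y (w ! i) then f \<omega> i - f \<omega> (Suc i) else 0)" for i
    by (cases "Y (w ! i)") (auto intro: bdd_rv_const bdd_rv_diff assms)
  then show ?thesis unfolding ysum_def by (intro bdd_rv_sum)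
qed

lemmas bdd_rv_intros = bdd_rv_const bdd_rv_add bdd_rv_mult bdd_rv_diff bdd_rv_divide bdd_rv_power

lemma bdd_rv_integrable: "bdd_rv f \<Longrightarrow> integrable M f"
  unfolding bdd_rv_def by (elim conjE exE, rule integrable_const_bound) auto

lemma expectation_sq_le: "bdd_rv f \<Longrightarrow> (expectation f)\<^sup>2 \<le> expectation (\<lambda>\<omega>. (f \<omega>)\<^sup>2)"
  using variance_eq[of f] variance_positive[of f] by (simp add: bdd_rv_integrable bdd_rv_power)

text \<open>Jensen's inequality, from three uses of the nonnegativity of the variance.\<close>

lemma expectation_power8_le:
  assumes f: "bdd_rv f" shows "(expectation f) ^ 8 \<le> expectation (\<lambda>\<omega>. f \<omega> ^ 8)"
proof -
  have "(expectation f) ^ 8 = (((expectation f)\<^sup>2)\<^sup>2)\<^sup>2"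
    by (simp only: power_mult[symmetric]) simp
  also have "\<dots> \<le> ((expectation (\<lambda>\<omega>. (f \<omega>)\<^sup>2))\<^sup>2)\<^sup>2"
    by (intro power_mono expectation_sq_le f) auto
  also have "\<dots> \<le> (expectation (\<lambda>\<omega>. ((f \<omega>)\<^sup>2)\<^sup>2))\<^sup>2"
    by (intro power_mono expectation_sq_le bdd_rv_power f) auto
  also have "\<dots> \<le> expectation (\<lambda>\<omega>. (((f \<omega>)\<^sup>2)\<^sup>2)\<^sup>2)"
    by (intro expectation_sq_le bdd_rv_power f)
  also have "(\<lambda>\<omega>. (((f \<omega>)\<^sup>2)\<^sup>2)\<^sup>2) = (\<lambda>\<omega>. f \<omega> ^ 8)"
    by (simp only: power_mult[symmetric]) simp
  finally show ?thesis .
qed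

text \<open>The eighth moment is used since in the type B setting the a priori bound is only of order
  \<open>sqrt N\<close>: it yields deviations of order \<open>N powr (-1/4)\<close>, whose eighth power is summable.\<close>

definition conc :: "(nat \<Rightarrow> 'a \<Rightarrow> real) \<Rightarrow> real \<Rightarrow> bool" where
  "conc F x \<longleftrightarrow> (\<forall>N. bdd_rv (F N)) \<and>
     (\<exists>c C. c \<longlonglongrightarrow> x \<and> (\<forall>N\<ge>1. expectation (\<lambda>\<omega>. (F N \<omega> - c N) ^ 8) \<le> C / real N ^ 2))"

lemma conc_bdd_rv: "conc F x \<Longrightarrow> bdd_rv (F N)"
  by (simp add: conc_def)

lemma concE:
  assumes "conc F x"
  obtains c C where "c \<longlonglongrightarrow> x" "C \<ge> 0" "\<And>N. N \<ge> 1 \<Longrightarrow> expectation (\<lambda>\<omega>. (F N \<omega> - c N) ^ 8) \<le> C / real N ^ 2"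
proof -
  obtain c C where c: "c \<longlonglongrightarrow> x" "\<And>N. N \<ge> 1 \<Longrightarrow> expectation (\<lambda>\<omega>. (F N \<omega> - c N) ^ 8) \<le> C / real N ^ 2"
    using assms by (auto simp: conc_def)
  have "0 \<le> expectation (\<lambda>\<omega>. (F 1 \<omega> - c 1) ^ 8)" by (intro Bochner_Integration.integral_nonneg) auto
  also have "\<dots> \<le> C / real 1 ^ 2" by (rule c(2)) simp
  finally have "C \<ge> 0" by simp
  then show ?thesis using that c by blast
qed

lemma conc_cong:
  assumes "conc F x" "\<And>N \<omega>. \<omega> \<in> space M \<Longrightarrow> F N \<omega> = F' N \<omega>"
  shows "conc F' x"
proof -
  have "bdd_rv (F' N) \<longleftrightarrow> bdd_rv (F N)" for N
    using assms(2) unfolding bdd_rv_def by (simp cong: measurable_cong)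
  moreover have "expectation (\<lambda>\<omega>. (F' N \<omega> - c N) ^ 8) = expectation (\<lambda>\<omega>. (F N \<omega> - c N) ^ 8)" for c N
    using assms(2) by (intro Bochner_Integration.integral_cong) auto
  ultimately show ?thesis using assms(1) unfolding conc_def by simp
qed

lemma conc_deterministic: "c \<longlonglongrightarrow> x \<Longrightarrow> conc (\<lambda>N _. c N) x"
  unfolding conc_def by (auto intro!: bdd_rv_const exI[of _ c] exI[of _ 0])

lemma conc_add:
  assumes "conc F x" "conc G y"
  shows "conc (\<lambda>N \<omega>. F N \<omega> + G N \<omega>) (x + y)"
proof -
  obtain c C where c: "c \<longlonglongrightarrow> x" "\<And>N. N \<ge> 1 \<Longrightarrow> expectation (\<lambda>\<omega>. (F N \<omega> - c N) ^ 8) \<le> C / real N ^ 2"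
    using concE[OF assms(1)] by blast
  obtain d D where d: "d \<longlonglongrightarrow> y" "\<And>N. N \<ge> 1 \<Longrightarrow> expectation (\<lambda>\<omega>. (G N \<omega> - d N) ^ 8) \<le> D / real N ^ 2"
    using concE[OF assms(2)] by blast
  note b = conc_bdd_rv[OF assms(1)] conc_bdd_rv[OF assms(2)]
  have "expectation (\<lambda>\<omega>. (F N \<omega> + G N \<omega> - (c N + d N)) ^ 8) \<le> 256 * (C + D) / real N ^ 2" if "N \<ge> 1" for N
  proof -
    have "expectation (\<lambda>\<omega>. (F N \<omega> + G N \<omega> - (c N + d N)) ^ 8)
        \<le> expectation (\<lambda>\<omega>. 256 * ((F N \<omega> - c N) ^ 8 + (G N \<omega> - d N) ^ 8))"
      using power8_add_le[of "F N _ - c N" "G N _ - d N"] b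
      by (intro integral_mono bdd_rv_integrable bdd_rv_intros) (auto simp: algebra_simps)
    also have "\<dots> = 256 * (expectation (\<lambda>\<omega>. (F N \<omega> - c N) ^ 8) + expectation (\<lambda>\<omega>. (G N \<omega> - d N) ^ 8))"
      using b by (simp add: bdd_rv_integrable bdd_rv_intros)
    also have "\<dots> \<le> 256 * (C / real N ^ 2 + D / real N ^ 2)"
      using c(2)[OF that] d(2)[OF that] by (intro mult_left_mono add_mono) auto
    finally show ?thesis by (simp add: add_divide_distrib)
  qed
  then show ?thesis unfolding conc_def using b c(1) d(1)
    by (auto intro!: bdd_rv_add exI[of _ "\<lambda>N. c N + d N"] exI[of _ "256 * (C + D)"] tendsto_add)
qed

text \<open>From FG - cd = (F - c) G + (G - d) c with c bounded as a convergent sequence. A uniform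
  bound is asked of one factor only, because an unnormalised trace through \<open>S\<close> is a
  priori merely O(sqrt N).\<close>

lemma conc_mult:
  assumes F: "conc F x" and G: "conc G y"
    and bnd: "\<And>N \<omega>. N \<ge> 1 \<Longrightarrow> \<omega> \<in> space M \<Longrightarrow> \<bar>G N \<omega>\<bar> \<le> K"
  shows "conc (\<lambda>N \<omega>. F N \<omega> * G N \<omega>) (x * y)"
proof -
  obtain c C where c: "c \<longlonglongrightarrow> x" "C \<ge> 0" "\<And>N. N \<ge> 1 \<Longrightarrow> expectation (\<lambda>\<omega>. (F N \<omega> - c N) ^ 8) \<le> C / real N ^ 2"
    using concE[OF F] by blast
  obtain d D where d: "d \<longlonglongrightarrow> y" "D \<ge> 0" "\<And>N. N \<ge> 1 \<Longrightarrow> expectation (\<lambda>\<omega>. (G N \<omega> - d N) ^ 8) \<le> D / real N ^ 2"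
    using concE[OF G] by blast
  note b = conc_bdd_rv[OF F] conc_bdd_rv[OF G]
  obtain B where B: "\<And>N. \<bar>c N\<bar> \<le> B"
    using c(1) by (metis convergentI convergent_imp_Bseq BseqE real_norm_def)
  have pos: "0 \<le> expectation (\<lambda>\<omega>. f \<omega> ^ 8)" for f :: "'a \<Rightarrow> real" by (intro Bochner_Integration.integral_nonneg) auto
  have "expectation (\<lambda>\<omega>. (F N \<omega> * G N \<omega> - c N * d N) ^ 8) \<le> 256 * (K ^ 8 * C + B ^ 8 * D) / real N ^ 2"
    if N: "N \<ge> 1" for N
  proof -
    have "expectation (\<lambda>\<omega>. (F N \<omega> * G N \<omega> - c N * d N) ^ 8)
        \<le> expectation (\<lambda>\<omega>. 256 * (K ^ 8 * (F N \<omega> - c N) ^ 8 + B ^ 8 * (G N \<omega> - d N) ^ 8))"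
    proof (intro integral_mono bdd_rv_integrable bdd_rv_intros b)
      fix \<omega> assume \<omega>: "\<omega> \<in> space M"
      have le: "(u * v) ^ 8 \<le> k ^ 8 * u ^ 8" if "\<bar>v\<bar> \<le> k" for u v k :: real
      proof -
        have "v ^ 8 \<le> k ^ 8" using power_mono[OF that, of 8] by (simp add: power_even_abs)
        then have "v ^ 8 * u ^ 8 \<le> k ^ 8 * u ^ 8" by (intro mult_right_mono) auto
        then show ?thesis by (simp add: power_mult_distrib mult.commute)
      qed
      have "F N \<omega> * G N \<omega> - c N * d N = (F N \<omega> - c N) * G N \<omega> + (G N \<omega> - d N) * c N"
        by (simp add: algebra_simps)
      then have "(F N \<omega> * G N \<omega> - c N * d N) ^ 8
          \<le> 256 * (((F N \<omega> - c N) * G N \<omega>) ^ 8 + ((G N \<omega> - d N) * c N) ^ 8)"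
        using power8_add_le by simp
      also have "\<dots> \<le> 256 * (K ^ 8 * (F N \<omega> - c N) ^ 8 + B ^ 8 * (G N \<omega> - d N) ^ 8)"
        by (intro mult_left_mono add_mono le bnd[OF N \<omega>] B) auto
      finally show "(F N \<omega> * G N \<omega> - c N * d N) ^ 8
          \<le> 256 * (K ^ 8 * (F N \<omega> - c N) ^ 8 + B ^ 8 * (G N \<omega> - d N) ^ 8)" .
    qed
    also have "\<dots> = 256 * (K ^ 8 * expectation (\<lambda>\<omega>. (F N \<omega> - c N) ^ 8)
        + B ^ 8 * expectation (\<lambda>\<omega>. (G N \<omega> - d N) ^ 8))"
      using b by (simp add: bdd_rv_integrable bdd_rv_intros)
    also have "\<dots> \<le> 256 * (K ^ 8 * (C / real N ^ 2) + B ^ 8 * (D / real N ^ 2))"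
      using c(3)[OF N] d(3)[OF N] by (intro mult_left_mono add_mono) auto
    finally show ?thesis by (simp add: add_divide_distrib)
  qed
  then show ?thesis unfolding conc_def using b c(1) d(1)
    by (auto intro!: bdd_rv_mult exI[of _ "\<lambda>N. c N * d N"]
        exI[of _ "256 * (K ^ 8 * C + B ^ 8 * D)"] tendsto_mult)
qed

lemma conc_diff: "conc F x \<Longrightarrow> conc G y \<Longrightarrow> conc (\<lambda>N \<omega>. F N \<omega> - G N \<omega>) (x - y)"
  using conc_add[of F x "\<lambda>N \<omega>. G N \<omega> * -1" "y * -1"]
    conc_mult[of G y "\<lambda>N \<omega>. -1" "-1" 1] conc_deterministic[of "\<lambda>_. -1" "-1"] by simp

lemma conc_sum:
  "(\<And>i. i \<in> I \<Longrightarrow> conc (F i) (x i)) \<Longrightarrow> conc (\<lambda>N \<omega>. \<Sum>i\<in>I. F i N \<omega>) (\<Sum>i\<in>I. x i)"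
  by (induction I rule: infinite_finite_induct) (auto intro: conc_add conc_deterministic)

lemma conc_expectation:
  assumes "conc F x"
  shows "(\<lambda>N. expectation (F N)) \<longlonglongrightarrow> x"
proof -
  obtain c C where c: "c \<longlonglongrightarrow> x" "\<And>N. N \<ge> 1 \<Longrightarrow> expectation (\<lambda>\<omega>. (F N \<omega> - c N) ^ 8) \<le> C / real N ^ 2"
    using concE[OF assms] by blast
  note b = conc_bdd_rv[OF assms]
  have "(expectation (F N) - c N) ^ 8 \<le> C / real N ^ 2" if "N \<ge> 1" for N
  proof -
    have "expectation (F N) - c N = expectation (\<lambda>\<omega>. F N \<omega> - c N)"
      using b by (simp add: bdd_rv_integrable prob_space)
    then show ?thesis
      using expectation_power8_le[of "\<lambda>\<omega>. F N \<omega> - c N"] b c(2)[OF that]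
      by (simp add: bdd_rv_intros)
  qed
  then have ev: "\<forall>\<^sub>F N in sequentially. (expectation (F N) - c N) ^ 8 \<le> C / real N ^ 2"
    by (intro eventually_sequentiallyI[of 1]) auto
  have lim: "(\<lambda>N. C / real N ^ 2) \<longlonglongrightarrow> 0"
    by (intro tendsto_divide_0[OF tendsto_const] filterlim_at_top_imp_at_infinity
        filterlim_pow_at_top filterlim_real_sequentially) simp
  have "(\<lambda>N. (expectation (F N) - c N) ^ 8) \<longlonglongrightarrow> 0"
    by (rule tendsto_sandwich[OF _ ev tendsto_const lim]) auto
  then have "(\<lambda>N. expectation (F N) - c N) \<longlonglongrightarrow> 0"
    by (simp add: power_tendsto_0_iff)
  from tendsto_add[OF this c(1)] show ?thesis by simp
qed

text \<open>The eighth powers of the deviations have summable expectations, so their sum is almost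
  surely finite and its terms tend to 0, whatever the joint law of the sequence. The shift by
  \<open>Suc\<close> is there because the moment bound starts at N = 1.\<close>

lemma conc_AE:
  assumes "conc F x"
  shows "AE \<omega> in M. (\<lambda>N. F N \<omega>) \<longlonglongrightarrow> x"
proof -
  obtain c C where c: "c \<longlonglongrightarrow> x" "C \<ge> 0" "\<And>N. N \<ge> 1 \<Longrightarrow> expectation (\<lambda>\<omega>. (F N \<omega> - c N) ^ 8) \<le> C / real N ^ 2"
    using concE[OF assms] by blast
  note b = conc_bdd_rv[OF assms]
  define X where "X n \<omega> = (F (Suc n) \<omega> - c (Suc n)) ^ 8" for n \<omega>
  have X0: "X n \<omega> \<ge> 0" for n \<omega> by (simp add: X_def)
  have Xb: "bdd_rv (X n)" for n unfolding X_def by (intro bdd_rv_intros b)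
  then have [measurable]: "X n \<in> borel_measurable M" for n by (simp add: bdd_rv_def)
  have sumC: "summable (\<lambda>n. C / real (Suc n) ^ 2)"
    using summable_mult[OF inverse_power_summable[of 2, where 'a = real], of C]
    by (subst summable_Suc_iff[of "\<lambda>n. C / real n ^ 2"]) (simp add: field_class.field_divide_inverse)
  have "(\<integral>\<^sup>+\<omega>. suminf (\<lambda>n. ennreal (X n \<omega>)) \<partial>M) = suminf (\<lambda>n. \<integral>\<^sup>+\<omega>. ennreal (X n \<omega>) \<partial>M)"
    by (intro nn_integral_suminf) measurable
  also have "\<dots> = suminf (\<lambda>n. ennreal (expectation (X n)))"
    using X0 Xb by (intro suminf_cong nn_integral_eq_integral bdd_rv_integrable) auto
  also have "\<dots> \<le> suminf (\<lambda>n. ennreal (C / real (Suc n) ^ 2))"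
    using c(3)[of "Suc _"] by (intro suminf_le ennreal_leI) (auto simp only: X_def[abs_def])
  also have "\<dots> = ennreal (suminf (\<lambda>n. C / real (Suc n) ^ 2))"
    using c(2) sumC by (intro suminf_ennreal2) auto
  finally have "(\<integral>\<^sup>+\<omega>. suminf (\<lambda>n. ennreal (X n \<omega>)) \<partial>M) \<noteq> \<infinity>"
    by (metis ennreal_less_top infinity_ennreal_def leD top.not_eq_extremum order_le_less_trans)
  then have "AE \<omega> in M. suminf (\<lambda>n. ennreal (X n \<omega>)) \<noteq> \<infinity>"
    by (intro nn_integral_noteq_infinite) auto
  then show ?thesis
  proof eventually_elim
    case (elim \<omega>)
    then have "summable (\<lambda>n. X n \<omega>)" using X0 by (intro summable_suminf_not_top) auto
    then have "(\<lambda>n. X n \<omega>) \<longlonglongrightarrow> 0" by (rule summable_LIMSEQ_zero)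
    then have "(\<lambda>n. F (Suc n) \<omega> - c (Suc n)) \<longlonglongrightarrow> 0"
      unfolding X_def by (simp add: power_tendsto_0_iff)
    from tendsto_add[OF this LIMSEQ_Suc[OF c(1)]] have "(\<lambda>n. F (Suc n) \<omega>) \<longlonglongrightarrow> x" by simp
    then show ?case by (rule LIMSEQ_imp_Suc)
  qed
qed

text \<open>Taking for \<open>c\<close> the centre of \<open>H\<close>, and X = F - c, d = H - c +
  R, the hypothesis \<open>eq\<close> reads E X^8 = E (d X^7 - 7 X^6 Q). Half of E X^8 is absorbed
  by \<open>power8_absorb\<close>. The term Q^4 dictates the rate N^(-2); R^8 would even give
  N^(-4). As \<open>F\<close> inherits the centre of \<open>H\<close>, it inherits the limit
  too.\<close>

lemma conc_step:
  assumes F: "\<And>N. bdd_rv (F N)" and R: "\<And>N. bdd_rv (R N)" and Q: "\<And>N. bdd_rv (Q N)"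
    and H: "conc H x"
    and bnd: "\<And>N \<omega>. N \<ge> 1 \<Longrightarrow> \<omega> \<in> space M \<Longrightarrow> \<bar>R N \<omega>\<bar> \<le> K / sqrt (real N)"
      "\<And>N \<omega>. N \<ge> 1 \<Longrightarrow> \<omega> \<in> space M \<Longrightarrow> \<bar>Q N \<omega>\<bar> \<le> K / sqrt (real N)"
    and eq: "\<And>N c. N \<ge> 1 \<Longrightarrow>
      expectation (\<lambda>\<omega>. (F N \<omega> - H N \<omega> - R N \<omega>) * (F N \<omega> - c) ^ 7 + 7 * (F N \<omega> - c) ^ 6 * Q N \<omega>) = 0"
  shows "conc F x"
proof -
  obtain c C where c: "c \<longlonglongrightarrow> x" "C \<ge> 0" "\<And>N. N \<ge> 1 \<Longrightarrow> expectation (\<lambda>\<omega>. (H N \<omega> - c N) ^ 8) \<le> C / real N ^ 2"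
    using concE[OF H] by blast
  note Hb = conc_bdd_rv[OF H]
  define C' where "C' = 2 * (4 ^ 7 * (256 * (C + K ^ 8)) + 7 * 28 ^ 3 * K ^ 4)"
  have "expectation (\<lambda>\<omega>. (F N \<omega> - c N) ^ 8) \<le> C' / real N ^ 2" if N: "N \<ge> 1" for N
  proof -
    define X where "X \<omega> = F N \<omega> - c N" for \<omega>
    define d where "d \<omega> = H N \<omega> - c N + R N \<omega>" for \<omega>
    have b: "bdd_rv X" "bdd_rv d" "bdd_rv (Q N)" "bdd_rv (H N)" "bdd_rv (R N)"
      unfolding X_def d_def by (intro bdd_rv_intros F Hb R Q)+
    have "expectation (\<lambda>\<omega>. X \<omega> ^ 8 - (d \<omega> * X \<omega> ^ 7 - 7 * X \<omega> ^ 6 * Q N \<omega>)) = 0"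
    proof -
      have "(F N \<omega> - H N \<omega> - R N \<omega>) * (F N \<omega> - c N) ^ 7 + 7 * (F N \<omega> - c N) ^ 6 * Q N \<omega>
          = X \<omega> ^ 8 - (d \<omega> * X \<omega> ^ 7 - 7 * X \<omega> ^ 6 * Q N \<omega>)" for \<omega>
      proof -
        have "F N \<omega> - H N \<omega> - R N \<omega> = X \<omega> - d \<omega>" by (simp add: X_def d_def)
        moreover have "X \<omega> * X \<omega> ^ 7 = X \<omega> ^ 8" by (simp flip: power_Suc)
        ultimately show ?thesis by (simp add: X_def[symmetric] left_diff_distrib)
      qed
      then show ?thesis using eq[OF N, of "c N"] by simp
    qed
    then have "expectation (\<lambda>\<omega>. X \<omega> ^ 8) = expectation (\<lambda>\<omega>. d \<omega> * X \<omega> ^ 7 - 7 * X \<omega> ^ 6 * Q N \<omega>)"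
      by (subst (asm) Bochner_Integration.integral_diff)
        (intro bdd_rv_integrable bdd_rv_intros b | simp)+
    also have "\<dots> \<le> expectation (\<lambda>\<omega>. X \<omega> ^ 8 / 2 + 4 ^ 7 * d \<omega> ^ 8 + 7 * 28 ^ 3 * (Q N \<omega>) ^ 4)"
      by (intro integral_mono bdd_rv_integrable bdd_rv_intros b power8_absorb)
    also have "\<dots> \<le> expectation (\<lambda>\<omega>. X \<omega> ^ 8 / 2 + 4 ^ 7 * (256 * ((H N \<omega> - c N) ^ 8 + K ^ 8 / real N ^ 2))
         + 7 * 28 ^ 3 * (K ^ 4 / real N ^ 2))"
    proof (intro integral_mono bdd_rv_integrable bdd_rv_intros b add_mono mult_left_mono order_refl)
      fix \<omega> assume \<omega>: "\<omega> \<in> space M"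
      have s4: "(K / sqrt (real N)) ^ 4 = K ^ 4 / real N ^ 2"
      proof -
        have "sqrt (real N) ^ 4 = ((sqrt (real N))\<^sup>2)\<^sup>2"
          by (simp only: power_mult[symmetric]) simp
        then show ?thesis by (simp add: power_divide)
      qed
      have s8: "(K / sqrt (real N)) ^ 8 \<le> K ^ 8 / real N ^ 2"
      proof -
        have "sqrt (real N) ^ 8 = ((sqrt (real N))\<^sup>2) ^ 4"
          by (simp only: power_mult[symmetric]) simp
        then have "(K / sqrt (real N)) ^ 8 = K ^ 8 / real N ^ 4" by (simp add: power_divide)
        also have "\<dots> \<le> K ^ 8 / real N ^ 2"
          using N by (intro divide_left_mono power_increasing mult_pos_pos) auto
        finally show ?thesis .
      qed
      have "(Q N \<omega>) ^ 4 = \<bar>Q N \<omega>\<bar> ^ 4" by (simp add: power_even_abs)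
      also have "\<dots> \<le> (K / sqrt (real N)) ^ 4" by (intro power_mono bnd(2) N \<omega>) auto
      finally show "(Q N \<omega>) ^ 4 \<le> K ^ 4 / real N ^ 2" by (simp only: s4)
      have "(R N \<omega>) ^ 8 = \<bar>R N \<omega>\<bar> ^ 8" by (simp add: power_even_abs)
      also have "\<dots> \<le> (K / sqrt (real N)) ^ 8" by (intro power_mono bnd(1) N \<omega>) auto
      finally have "(R N \<omega>) ^ 8 \<le> K ^ 8 / real N ^ 2" using s8 by linarith
      then show "d \<omega> ^ 8 \<le> 256 * ((H N \<omega> - c N) ^ 8 + K ^ 8 / real N ^ 2)"
        unfolding d_def using power8_add_le[of "H N \<omega> - c N" "R N \<omega>"] by simp
    qed auto
    also have "\<dots> = expectation (\<lambda>\<omega>. X \<omega> ^ 8) / 2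
        + 4 ^ 7 * (256 * (expectation (\<lambda>\<omega>. (H N \<omega> - c N) ^ 8) + K ^ 8 / real N ^ 2))
        + 7 * 28 ^ 3 * (K ^ 4 / real N ^ 2)"
      using b by (simp add: bdd_rv_integrable bdd_rv_intros prob_space)
    also have "\<dots> \<le> expectation (\<lambda>\<omega>. X \<omega> ^ 8) / 2
        + 4 ^ 7 * (256 * (C / real N ^ 2 + K ^ 8 / real N ^ 2)) + 7 * 28 ^ 3 * (K ^ 4 / real N ^ 2)"
      using c(3)[OF N] by simp
    finally have "expectation (\<lambda>\<omega>. X \<omega> ^ 8)
        \<le> 2 * (4 ^ 7 * (256 * (C / real N ^ 2 + K ^ 8 / real N ^ 2)) + 7 * 28 ^ 3 * (K ^ 4 / real N ^ 2))"
      by simp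
    also have "\<dots> = C' / real N ^ 2" by (simp add: C'_def add_divide_distrib)
    finally show ?thesis by (simp add: X_def)
  qed
  then show ?thesis unfolding conc_def using F c(1) by blast
qed

end

section \<open>Traces of words in matrices conjugated by Haar matrices\<close>

lemma convergent_abs_bounded:
  fixes f :: "nat \<Rightarrow> real"
  assumes "convergent f" shows "\<exists>K. \<forall>N. \<bar>f N\<bar> \<le> K"
  using convergent_imp_Bseq[OF assms] by (auto simp: Bseq_def)

text \<open>The letters satisfying Y are conjugated by U; the letters in S are those whose
  unnormalised traces converge.\<close>

locale haar_words = prob_space M for M :: "'w measure" +
  fixes Y :: "'v \<Rightarrow> bool" and Z :: "nat \<Rightarrow> 'v \<Rightarrow> real mat" and U :: "nat \<Rightarrow> 'w \<Rightarrow> real mat"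
    and G :: "nat \<Rightarrow> real mat set" and L S :: "'v set"
  assumes Z: "\<And>N. sym_letters N (Z N)"
    and U: "\<And>N. haar_random M N (G N) (U N)"
    and G: "\<And>N. G N \<subseteq> orth_group N" "\<And>N. sorth_group N \<subseteq> G N"
    and L: "finite L"
    and pure: "\<And>w. set w \<subseteq> L \<Longrightarrow> (\<forall>v\<in>set w. Y v) \<or> (\<forall>v\<in>set w. \<not> Y v) \<Longrightarrow>
      convergent (\<lambda>N. wtr N (Z N) w / real N)"
    and pure': "\<And>w. set w \<subseteq> L \<Longrightarrow> (\<forall>v\<in>set w. Y v) \<or> (\<forall>v\<in>set w. \<not> Y v) \<Longrightarrow>
      set w \<inter> S \<noteq> {} \<Longrightarrow> convergent (\<lambda>N. wtr N (Z N) w)"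
begin

section \<open>Traces as random variables and their a priori bounds\<close>

definition T :: "nat \<Rightarrow> 'w \<Rightarrow> 'v list \<Rightarrow> real" where
  "T N \<omega> w = wtr N (conj_letters Y (U N \<omega>) (Z N)) w"

lemma U_orth: "\<omega> \<in> space M \<Longrightarrow> U N \<omega> \<in> orth_group N"
  using U[of N] G(1)[of N] by (auto simp: haar_random_def)

lemma sym: "\<omega> \<in> space M \<Longrightarrow> sym_letters N (conj_letters Y (U N \<omega>) (Z N))"
  by (rule sym_letters_conj[OF Z orth_groupD(1)[OF U_orth]])

lemma T_commute: "\<omega> \<in> space M \<Longrightarrow> T N \<omega> (u @ w) = T N \<omega> (w @ u)"
  unfolding T_def by (rule wtr_commute[OF sym])

lemma T_pure:
  "\<omega> \<in> space M \<Longrightarrow> (\<forall>v\<in>set w. Y v) \<or> (\<forall>v\<in>set w. \<not> Y v) \<Longrightarrow> T N \<omega> w = wtr N (Z N) w"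
  unfolding T_def by (rule wtr_conj_pure[OF Z U_orth])

lemma T_Nil [simp]: "T N \<omega> [] = real N"
  by (simp add: T_def)

lemma T_bound_even:
  assumes w: "set w \<subseteq> L" "length w = 2 * m" "m \<ge> 1"
  shows "\<exists>K\<ge>0. \<forall>N\<ge>1. \<forall>\<omega>\<in>space M. \<bar>T N \<omega> w\<bar> \<le> K * real N"
proof -
  have "\<exists>K. \<forall>N. \<bar>wtr N (Z N) (replicate (2 * m) x) / real N\<bar> \<le> K" if "x \<in> L" for x
  proof -
    have "convergent (\<lambda>N. wtr N (Z N) (replicate (2 * m) x) / real N)"
      by (rule pure) (use that in auto)
    then show ?thesis by (rule convergent_abs_bounded)
  qed
  then obtain K where K: "\<And>x N. x \<in> L \<Longrightarrow> \<bar>wtr N (Z N) (replicate (2 * m) x) / real N\<bar> \<le> K x" by metis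
  have "\<bar>T N \<omega> w\<bar> \<le> (\<Sum>x\<in>L. K x) * real N" if "N \<ge> 1" "\<omega> \<in> space M" for N \<omega>
  proof -
    have "\<bar>T N \<omega> w\<bar> \<le> (\<Sum>x\<in>L. wtr N (Z N) (replicate (2 * m) x))"
      unfolding T_def by (rule wtr_conj_Hoelder[OF Z U_orth[OF that(2)] L w])
    also have "\<dots> \<le> (\<Sum>x\<in>L. K x * real N)"
    proof (rule sum_mono)
      fix x assume "x \<in> L"
      from K[OF this, of N] have "wtr N (Z N) (replicate (2 * m) x) / real N \<le> K x" by linarith
      then show "wtr N (Z N) (replicate (2 * m) x) \<le> K x * real N"
        using that(1) by (simp add: divide_le_eq)
    qed
    finally show ?thesis by (simp add: sum_distrib_right)
  qed
  moreover have "0 \<le> (\<Sum>x\<in>L. K x)" using K by (intro sum_nonneg) (meson abs_ge_zero order_trans)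
  ultimately show ?thesis by blast
qed

text \<open>Words of odd length are reached by Cauchy-Schwarz against the empty word, whose trace is
  N.\<close>

lemma T_bound:
  assumes w: "set w \<subseteq> L"
  shows "\<exists>K\<ge>0. \<forall>N\<ge>1. \<forall>\<omega>\<in>space M. \<bar>T N \<omega> w\<bar> \<le> K * real N"
proof (cases "w = []")
  case True
  then show ?thesis by (intro exI[of _ 1]) auto
next
  case False
  have "\<exists>K\<ge>0. \<forall>N\<ge>1. \<forall>\<omega>\<in>space M. \<bar>T N \<omega> (w @ rev w)\<bar> \<le> K * real N"
    by (rule T_bound_even[of _ "length w"]) (use w False in \<open>auto simp: Suc_le_eq\<close>)
  then obtain K where K: "K \<ge> 0" "\<And>N \<omega>. N \<ge> 1 \<Longrightarrow> \<omega> \<in> space M \<Longrightarrow> \<bar>T N \<omega> (w @ rev w)\<bar> \<le> K * real N"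
    by blast
  have "\<bar>T N \<omega> w\<bar> \<le> sqrt K * real N" if "N \<ge> 1" "\<omega> \<in> space M" for N \<omega>
  proof -
    have "(T N \<omega> w)\<^sup>2 \<le> T N \<omega> (w @ rev w) * real N"
      using wtr_Cauchy_Schwarz[OF sym[OF that(2)], of N w "[]"] by (simp add: T_def)
    also have "\<dots> \<le> (K * real N) * real N" using K(2)[OF that] by (intro mult_right_mono) auto
    also have "\<dots> = (sqrt K * real N)\<^sup>2" using K(1) by (simp add: power_mult_distrib power2_eq_square)
    finally show ?thesis using K(1) by (simp add: abs_le_square_iff[symmetric] abs_mult)
  qed
  then show ?thesis using K(1) by (intro exI[of _ "sqrt K"]) auto
qed

text \<open>Rotate a letter x of \<open>S\<close> to the front, w ~ x u. Then T(x u)^2 is at most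
  T(x x) T(u u^t): the first factor is bounded because \<open>x x\<close> is a word of one kind
  through \<open>S\<close>, the second is O(N).\<close>

lemma T_bound_small:
  assumes w: "set w \<subseteq> L" "set w \<inter> S \<noteq> {}"
  shows "\<exists>K\<ge>0. \<forall>N\<ge>1. \<forall>\<omega>\<in>space M. \<bar>T N \<omega> w\<bar> \<le> K * sqrt (real N)"
proof -
  obtain x where x: "x \<in> set w" "x \<in> S" using w by blast
  then obtain a b where ab: "w = a @ x # b" by (meson split_list)
  define u where "u = b @ a"
  have "convergent (\<lambda>N. wtr N (Z N) [x, x])" by (rule pure') (use w x in auto)
  then obtain K1 where K1: "\<And>N. \<bar>wtr N (Z N) [x, x]\<bar> \<le> K1"
    using convergent_abs_bounded by blast
  obtain K2 where K2: "K2 \<ge> 0" "\<And>N \<omega>. N \<ge> 1 \<Longrightarrow> \<omega> \<in> space M \<Longrightarrow> \<bar>T N \<omega> (u @ rev u)\<bar> \<le> K2 * real N"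
    using T_bound[of "u @ rev u"] w ab by (auto simp: u_def)
  have K1': "K1 \<ge> 0" using K1[of 0] by linarith
  have "\<bar>T N \<omega> w\<bar> \<le> sqrt (K1 * K2) * sqrt (real N)" if "N \<ge> 1" "\<omega> \<in> space M" for N \<omega>
  proof -
    have "T N \<omega> w = T N \<omega> ([x] @ u)"
      using T_commute[OF that(2), of N a "x # b"] by (simp add: ab u_def)
    then have "(T N \<omega> w)\<^sup>2 \<le> T N \<omega> [x, x] * T N \<omega> (u @ rev u)"
      using wtr_Cauchy_Schwarz[OF sym[OF that(2)], of N "[x]" u] by (simp add: T_def)
    also have "\<dots> \<le> \<bar>T N \<omega> [x, x]\<bar> * \<bar>T N \<omega> (u @ rev u)\<bar>" by (metis abs_ge_self abs_mult)
    also have "\<dots> \<le> K1 * (K2 * real N)"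
      using K1[of N] K2(2)[OF that] K1' T_pure[OF that(2), of "[x, x]" N] by (intro mult_mono) auto
    also have "\<dots> = (sqrt (K1 * K2) * sqrt (real N))\<^sup>2"
      using K1' K2(1) by (simp add: power_mult_distrib)
    finally have "\<bar>T N \<omega> w\<bar> \<le> \<bar>sqrt (K1 * K2) * sqrt (real N)\<bar>" by (simp add: abs_le_square_iff)
    then show ?thesis using K1' K2(1) by (simp add: abs_mult)
  qed
  then show ?thesis using K1' K2(1) by (intro exI[of _ "sqrt (K1 * K2)"]) auto
qed

lemma bdd_rv_T: "bdd_rv (\<lambda>\<omega>. T N \<omega> w)"
proof -
  have "entries_measurable M N (U N)"
    using U[of N] by (auto simp: haar_random_def intro: entries_measurable_comp)
  then have "(\<lambda>\<omega>. T N \<omega> w) \<in> borel_measurable M"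
    unfolding T_def by (rule borel_measurable_wtr_conj[OF Z])
  moreover obtain K where K: "\<forall>V\<in>orth_group N. \<forall>i<N. \<forall>j<N.
      \<bar>wprod N (conj_letters Y V (Z N)) w $$ (i, j)\<bar> \<le> K"
    using wprod_conj_entries_bounded[OF Z] by blast
  have "\<bar>T N \<omega> w\<bar> \<le> (\<Sum>i<N. K)" if "\<omega> \<in> space M" for \<omega>
  proof -
    have "T N \<omega> w = (\<Sum>i<N. wprod N (conj_letters Y (U N \<omega>) (Z N)) w $$ (i, i))"
      using sym[OF that, of N] by (simp add: T_def wtr_def mtrace_def)
    also have "\<bar>\<dots>\<bar> \<le> (\<Sum>i<N. K)"
      using K U_orth[OF that, of N] by (intro order_trans[OF sum_abs sum_mono]) auto
    finally show ?thesis .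
  qed
  ultimately show ?thesis by (auto simp: bdd_rv_def)
qed

definition split_prod :: "nat \<Rightarrow> 'w \<Rightarrow> 'v list \<Rightarrow> nat \<Rightarrow> real" where
  "split_prod N \<omega> w i = T N \<omega> (take i w) * T N \<omega> (drop i w)"

text \<open>Normalised traces of arbitrary words and unnormalised traces of words with a letter in S obey
  the same estimates relative to this scale, so one induction serves for both.\<close>

definition scale :: "bool \<Rightarrow> nat \<Rightarrow> real" where
  "scale small N = (if small then 1 else real N)"

definition admissible :: "bool \<Rightarrow> 'v set \<Rightarrow> bool" where
  "admissible small A \<longleftrightarrow> A \<subseteq> L \<and> (small \<longrightarrow> A \<inter> S \<noteq> {})"

lemma scale_pos: "N \<ge> 1 \<Longrightarrow> scale small N \<ge> 1"
  by (auto simp: scale_def)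

text \<open>The common form is sqrt N if \<open>small\<close>, and otherwise N^(3/2), which is
  deliberately weaker than \<open>T_bound\<close>. After division by N times the scale, both cases
  give the N^(-1/2) that \<open>conc_step\<close> asks for.\<close>

lemma T_bound_scale:
  assumes "admissible small (set w)"
  shows "\<exists>K\<ge>0. \<forall>N\<ge>1. \<forall>\<omega>\<in>space M. \<bar>T N \<omega> w\<bar> \<le> K * (real N * scale small N / sqrt (real N))"
proof (cases small)
  case True
  then show ?thesis using T_bound_small[of w] assms
    by (simp add: scale_def admissible_def real_div_sqrt)
next
  case False
  obtain K where K: "K \<ge> 0" "\<And>N \<omega>. N \<ge> 1 \<Longrightarrow> \<omega> \<in> space M \<Longrightarrow> \<bar>T N \<omega> w\<bar> \<le> K * real N"
    using T_bound[of w] assms by (auto simp: admissible_def)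
  have "\<bar>T N \<omega> w\<bar> \<le> K * (real N * real N / sqrt (real N))" if "N \<ge> 1" "\<omega> \<in> space M" for N \<omega>
  proof -
    have "real N * 1 \<le> real N * sqrt (real N)" using that by (intro mult_left_mono) auto
    also have "\<dots> = real N * real N / sqrt (real N)" by (simp add: real_div_sqrt flip: times_divide_eq_right)
    finally have "K * real N \<le> K * (real N * real N / sqrt (real N))" using K(1) by (intro mult_left_mono) auto
    then show ?thesis using K(2)[OF that] by linarith
  qed
  then show ?thesis using K(1) False by (auto simp: scale_def)
qed

lemma ysum_T_bound:
  assumes "\<And>i. admissible small (set (f i))"
  shows "\<exists>K\<ge>0. \<forall>N\<ge>1. \<forall>\<omega>\<in>space M.
    \<bar>ysum Y w (\<lambda>i. T N \<omega> (f i))\<bar> \<le> K * (real N * scale small N / sqrt (real N))"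
proof -
  obtain K where K: "\<And>i. K i \<ge> 0" "\<And>i N \<omega>. N \<ge> 1 \<Longrightarrow> \<omega> \<in> space M \<Longrightarrow>
      \<bar>T N \<omega> (f i)\<bar> \<le> K i * (real N * scale small N / sqrt (real N))"
    using T_bound_scale[OF assms] by metis
  define K' where "K' = (\<Sum>i<length w. K i + K (Suc i))"
  have "\<bar>ysum Y w (\<lambda>i. T N \<omega> (f i))\<bar> \<le> K' * (real N * scale small N / sqrt (real N))"
    if "N \<ge> 1" "\<omega> \<in> space M" for N \<omega>
    unfolding ysum_def K'_def sum_distrib_right
  proof (rule order_trans[OF sum_abs sum_mono])
    fix i
    show "\<bar>if Y (w ! i) then T N \<omega> (f i) - T N \<omega> (f (Suc i)) else 0\<bar>
        \<le> (K i + K (Suc i)) * (real N * scale small N / sqrt (real N))"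
      unfolding distrib_right using K(2)[OF that, of i] K(2)[OF that, of "Suc i"]
      by (cases "Y (w ! i)"; simp only: if_True if_False; linarith)
  qed
  moreover have "K' \<ge> 0" unfolding K'_def using K(1) by (intro sum_nonneg add_nonneg_nonneg) auto
  ultimately show ?thesis by blast
qed

lemma admissible_splits:
  assumes "admissible small (set w)"
  shows "admissible small (set (take i w @ rev (drop i w)))"
    "admissible small (set (w @ rev (drop i w @ take i w)))"
    "admissible small (set (w @ drop i w @ take i w))"
proof -
  have "set (take i w) \<union> set (drop i w) = set w" by (metis append_take_drop_id set_append)
  then have "set (take i w @ rev (drop i w)) = set w" "set (w @ rev (drop i w @ take i w)) = set w"
    "set (w @ drop i w @ take i w) = set w" by auto
  then show "admissible small (set (take i w @ rev (drop i w)))"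
    "admissible small (set (w @ rev (drop i w @ take i w)))"
    "admissible small (set (w @ drop i w @ take i w))" using assms by simp_all
qed

text \<open>The first letter is not in \<open>Y\<close>, so the cut at 0 never occurs; the last one
  is, so the cut at the end occurs once. It carries T(w) N, while every other cut gives two shorter
  words: the identity can be solved for T(w).\<close>

lemma conc_T_step:
  assumes adm: "admissible small (set w)" and w: "w \<noteq> []" "\<not> Y (hd w)" "Y (last w)"
    and IH: "\<And>i. 0 < i \<Longrightarrow> i < length w \<Longrightarrow>
      conc (\<lambda>N \<omega>. split_prod N \<omega> w i / (real N * scale small N)) (\<gamma> i)"
  shows "\<exists>x. conc (\<lambda>N \<omega>. T N \<omega> w / scale small N) x"
proof -
  define n where "n = length w - 1"
  have n: "length w = Suc n" using w(1) by (simp add: n_def)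
  have Yn: "Y (w ! n)" using w by (simp add: last_conv_nth n_def)
  have Y0: "\<not> Y (w ! 0)" using w by (simp add: hd_conv_nth)
  have "n \<noteq> 0" using Yn Y0 by metis
  define s where "s N = real N * scale small N" for N
  \<comment> \<open>\<open>rest\<close> is \<open>ysum\<close> without the cut at the end,
    \<open>f (Suc n)\<close>. For \<open>split_prod\<close> the omitted value is T(w) times N, the
    trace of the empty word.\<close>
  define rest where "rest f = (\<Sum>i<n. if Y (w ! i) then f i - f (Suc i) else 0) + f n" for f :: "nat \<Rightarrow> real"
  have ysum_rest: "ysum Y w f = rest f - f (Suc n)" for f :: "nat \<Rightarrow> real"
    using Yn by (simp add: ysum_def n rest_def)
  define H where "H N \<omega> = rest (\<lambda>i. split_prod N \<omega> w i / s N)" for N \<omega>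
  \<comment> \<open>\<open>R\<close> collects the transposed terms and \<open>Q\<close> the merging
    terms. The extra division by the scale in \<open>Q\<close> comes from differentiating the test
    function of T(w) / scale.\<close>
  define R where "R N \<omega> = - (ysum Y w (\<lambda>i. T N \<omega> (take i w @ rev (drop i w))) / s N)" for N \<omega>
  define Q where "Q N \<omega> = ysum Y w (\<lambda>i. T N \<omega> (w @ rev (drop i w @ take i w)) - T N \<omega> (w @ drop i w @ take i w))
      / (s N * scale small N)" for N \<omega>
  have H: "conc H (rest \<gamma>)"
    unfolding H_def rest_def
  proof (intro conc_add conc_sum)
    show "conc (\<lambda>N \<omega>. split_prod N \<omega> w n / s N) (\<gamma> n)"
      unfolding s_def using \<open>n \<noteq> 0\<close> n by (intro IH) auto
    fix i assume "i \<in> {..<n}"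
    show "conc (\<lambda>N \<omega>. if Y (w ! i) then split_prod N \<omega> w i / s N - split_prod N \<omega> w (Suc i) / s N else 0)
        (if Y (w ! i) then \<gamma> i - \<gamma> (Suc i) else 0)"
    proof (cases "Y (w ! i)")
      case True
      then have "i \<noteq> 0" using Y0 by metis
      have "conc (\<lambda>N \<omega>. split_prod N \<omega> w i / s N - split_prod N \<omega> w (Suc i) / s N) (\<gamma> i - \<gamma> (Suc i))"
        unfolding s_def using \<open>i \<noteq> 0\<close> \<open>i \<in> {..<n}\<close> n by (intro conc_diff IH) auto
      then show ?thesis using True by simp
    qed (simp add: conc_deterministic)
  qed
  obtain K1 where K1: "K1 \<ge> 0" "\<And>N \<omega>. N \<ge> 1 \<Longrightarrow> \<omega> \<in> space M \<Longrightarrow>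
      \<bar>ysum Y w (\<lambda>i. T N \<omega> (take i w @ rev (drop i w)))\<bar> \<le> K1 * (s N / sqrt (real N))"
    using ysum_T_bound[of small "\<lambda>i. take i w @ rev (drop i w)" w, OF admissible_splits(1)[OF adm]] unfolding s_def by blast
  obtain K2 where K2: "K2 \<ge> 0" "\<And>N \<omega>. N \<ge> 1 \<Longrightarrow> \<omega> \<in> space M \<Longrightarrow>
      \<bar>ysum Y w (\<lambda>i. T N \<omega> (w @ rev (drop i w @ take i w)))\<bar> \<le> K2 * (s N / sqrt (real N))"
    using ysum_T_bound[of small "\<lambda>i. w @ rev (drop i w @ take i w)" w, OF admissible_splits(2)[OF adm]] unfolding s_def by blast
  obtain K3 where K3: "K3 \<ge> 0" "\<And>N \<omega>. N \<ge> 1 \<Longrightarrow> \<omega> \<in> space M \<Longrightarrow>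
      \<bar>ysum Y w (\<lambda>i. T N \<omega> (w @ drop i w @ take i w))\<bar> \<le> K3 * (s N / sqrt (real N))"
    using ysum_T_bound[of small "\<lambda>i. w @ drop i w @ take i w" w, OF admissible_splits(3)[OF adm]] unfolding s_def by blast
  have spos: "s N > 0" if "N \<ge> 1" for N using that scale_pos[OF that, of small] by (simp add: s_def)
  have "conc (\<lambda>N \<omega>. T N \<omega> w / scale small N) (rest \<gamma>)"
  proof (rule conc_step[OF _ _ _ H, where R = R and Q = Q and K = "K1 + K2 + K3"])
    show "bdd_rv (\<lambda>\<omega>. T N \<omega> w / scale small N)" for N by (intro bdd_rv_divide bdd_rv_T)
    show "bdd_rv (R N)" for N
    proof -
      have "bdd_rv (\<lambda>\<omega>. -1 * (ysum Y w (\<lambda>i. T N \<omega> (take i w @ rev (drop i w))) / s N))"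
        by (intro bdd_rv_mult bdd_rv_const bdd_rv_divide bdd_rv_ysum bdd_rv_T)
      then show ?thesis by (simp add: R_def[abs_def])
    qed
    show "bdd_rv (Q N)" for N
      unfolding Q_def by (intro bdd_rv_divide bdd_rv_ysum bdd_rv_diff bdd_rv_T)
    fix N assume N: "N \<ge> (1 :: nat)"
    note sN = spos[OF N] and sc = scale_pos[OF N, of small]
    {
      fix \<omega> assume \<omega>: "\<omega> \<in> space M"
      have "\<bar>R N \<omega>\<bar> \<le> K1 * (s N / sqrt (real N)) / s N"
        unfolding R_def abs_minus_cancel abs_divide abs_of_pos[OF sN]
        using K1(2)[OF N \<omega>] sN by (intro divide_right_mono) auto
      also have "\<dots> = K1 / sqrt (real N)" using sN by simp
      also have "\<dots> \<le> (K1 + K2 + K3) / sqrt (real N)"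
        using K2(1) K3(1) by (intro divide_right_mono) auto
      finally show "\<bar>R N \<omega>\<bar> \<le> (K1 + K2 + K3) / sqrt (real N)" .
      define D where "D = ysum Y w (\<lambda>i. T N \<omega> (w @ rev (drop i w @ take i w)) - T N \<omega> (w @ drop i w @ take i w))"
      have "\<bar>D\<bar> \<le> (K2 + K3) * (s N / sqrt (real N))"
        unfolding D_def ysum_diff distrib_right using K2(2)[OF N \<omega>] K3(2)[OF N \<omega>] by linarith
      have "\<bar>Q N \<omega>\<bar> = \<bar>D\<bar> / (s N * scale small N)"
        using sN sc by (simp add: Q_def D_def abs_divide)
      also have "\<dots> \<le> \<bar>D\<bar> / (s N * 1)"
        using sN sc by (intro divide_left_mono mult_left_mono mult_pos_pos) auto
      also have "\<dots> \<le> (K2 + K3) * (s N / sqrt (real N)) / s N"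
        unfolding mult_1_right using \<open>\<bar>D\<bar> \<le> _\<close> sN by (intro divide_right_mono) auto
      also have "\<dots> = (K2 + K3) / sqrt (real N)" using sN by simp
      also have "\<dots> \<le> (K1 + K2 + K3) / sqrt (real N)"
        using K1(1) by (intro divide_right_mono) auto
      finally show "\<bar>Q N \<omega>\<bar> \<le> (K1 + K2 + K3) / sqrt (real N)" .
    }
    fix c :: real
    let ?\<sigma> = "scale small N"
    define \<phi> where "\<phi> x = (x / ?\<sigma> - c) ^ 7" for x
    define \<phi>' where "\<phi>' x = 7 * (x / ?\<sigma> - c) ^ 6 / ?\<sigma>" for x
    have d\<phi>: "(\<phi> has_real_derivative \<phi>' x) (at x)" for x
      unfolding \<phi>_def \<phi>'_def using sc by (auto intro!: derivative_eq_intros)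
    have c\<phi>: "continuous_on UNIV \<phi>'"
      unfolding \<phi>'_def using sc by (intro continuous_intros) auto
    have SD: "expectation (\<lambda>\<omega>. ysum Y w (sd_split N (conj_letters Y (U N \<omega>) (Z N)) w) * \<phi> (T N \<omega> w)
            + \<phi>' (T N \<omega> w) * ysum Y w (sd_merge N (conj_letters Y (U N \<omega>) (Z N)) w)) = 0"
      using schwinger_dyson[OF prob_space_axioms U G Z d\<phi> c\<phi>, where w = w and Y = Y] by (simp add: T_def)
    have eq: "(T N \<omega> w / ?\<sigma> - H N \<omega> - R N \<omega>) * (T N \<omega> w / ?\<sigma> - c) ^ 7 + 7 * (T N \<omega> w / ?\<sigma> - c) ^ 6 * Q N \<omega>
      = (ysum Y w (sd_split N (conj_letters Y (U N \<omega>) (Z N)) w) * \<phi> (T N \<omega> w)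
            + \<phi>' (T N \<omega> w) * ysum Y w (sd_merge N (conj_letters Y (U N \<omega>) (Z N)) w)) / s N" for \<omega>
    proof -
      have "split_prod N \<omega> w (Suc n) / s N = T N \<omega> w / ?\<sigma>"
        using n N by (simp add: split_prod_def s_def)
      then have "H N \<omega> = ysum Y w (split_prod N \<omega> w) / s N + T N \<omega> w / ?\<sigma>"
        using ysum_rest[of "\<lambda>i. split_prod N \<omega> w i / s N"] ysum_cmult[of Y w "1 / s N" "split_prod N \<omega> w"]
        by (simp add: H_def)
      moreover have "ysum Y w (sd_split N (conj_letters Y (U N \<omega>) (Z N)) w)
          = ysum Y w (\<lambda>i. T N \<omega> (take i w @ rev (drop i w))) - ysum Y w (split_prod N \<omega> w)"
        unfolding ysum_diff[symmetric] by (simp add: sd_split_def[abs_def] T_def split_prod_def[abs_def])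
      ultimately have "T N \<omega> w / ?\<sigma> - H N \<omega> - R N \<omega>
          = ysum Y w (sd_split N (conj_letters Y (U N \<omega>) (Z N)) w) / s N"
        by (simp add: R_def diff_divide_distrib)
      moreover have "Q N \<omega> = ysum Y w (sd_merge N (conj_letters Y (U N \<omega>) (Z N)) w) / (s N * ?\<sigma>)"
        by (simp add: Q_def sd_merge_def[abs_def] T_def)
      ultimately show ?thesis
        unfolding \<phi>_def \<phi>'_def by (simp add: add_divide_distrib)
    qed
    show "expectation (\<lambda>\<omega>. (T N \<omega> w / ?\<sigma> - H N \<omega> - R N \<omega>) * (T N \<omega> w / ?\<sigma> - c) ^ 7
        + 7 * (T N \<omega> w / ?\<sigma> - c) ^ 6 * Q N \<omega>) = 0"
      unfolding eq using SD by simp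
  qed
  then show ?thesis by blast
qed

text \<open>For \<open>small\<close> only one factor N is available for two traces. A part meeting
  \<open>S\<close> keeps its unnormalised trace and the other part is normalised, hence bounded; if
  both parts meet \<open>S\<close>, the first is the one left unnormalised.\<close>

lemma conc_split_prod:
  assumes adm: "admissible small (set w)"
    and tr: "\<And>u. u = take i w \<or> u = drop i w \<Longrightarrow> conc (\<lambda>N \<omega>. T N \<omega> u / real N) (m u)"
    and Tr: "\<And>u. small \<Longrightarrow> u = take i w \<or> u = drop i w \<Longrightarrow> set u \<inter> S \<noteq> {} \<Longrightarrow> conc (\<lambda>N \<omega>. T N \<omega> u) (m' u)"
  shows "conc (\<lambda>N \<omega>. split_prod N \<omega> w i / (real N * scale small N))
     (if \<not> small then m (take i w) * m (drop i w)
      else if set (take i w) \<inter> S \<noteq> {} then m' (take i w) * m (drop i w)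
      else m' (drop i w) * m (take i w))"
proof -
  have un: "set (take i w) \<union> set (drop i w) = set w" by (metis append_take_drop_id set_append)
  have bnd: "\<exists>K. \<forall>N\<ge>1. \<forall>\<omega>\<in>space M. \<bar>T N \<omega> u / real N\<bar> \<le> K" if u: "u = take i w \<or> u = drop i w" for u
  proof -
    have "set u \<subseteq> L" using u un adm by (auto simp: admissible_def)
    then obtain K where K: "\<And>N \<omega>. N \<ge> 1 \<Longrightarrow> \<omega> \<in> space M \<Longrightarrow> \<bar>T N \<omega> u\<bar> \<le> K * real N"
      using T_bound[of u] by blast
    have "\<bar>T N \<omega> u / real N\<bar> \<le> K" if "N \<ge> 1" "\<omega> \<in> space M" for N \<omega>
      using K[OF that] that(1) by (simp add: abs_divide divide_le_eq)
    then show ?thesis by blast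
  qed
  obtain K1 where K1: "\<And>N \<omega>. N \<ge> 1 \<Longrightarrow> \<omega> \<in> space M \<Longrightarrow> \<bar>T N \<omega> (take i w) / real N\<bar> \<le> K1"
    using bnd[OF disjI1[OF refl]] by blast
  obtain K2 where K2: "\<And>N \<omega>. N \<ge> 1 \<Longrightarrow> \<omega> \<in> space M \<Longrightarrow> \<bar>T N \<omega> (drop i w) / real N\<bar> \<le> K2"
    using bnd[OF disjI2[OF refl]] by blast
  consider "\<not> small" | "small" "set (take i w) \<inter> S \<noteq> {}" | "small" "set (take i w) \<inter> S = {}" by blast
  then show ?thesis
  proof cases
    case 1
    have "conc (\<lambda>N \<omega>. T N \<omega> (take i w) / real N * (T N \<omega> (drop i w) / real N)) (m (take i w) * m (drop i w))"
      by (rule conc_mult[OF tr tr K2]) auto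
    then show ?thesis using 1 by (simp add: split_prod_def scale_def)
  next
    case 2
    have "conc (\<lambda>N \<omega>. T N \<omega> (take i w) * (T N \<omega> (drop i w) / real N)) (m' (take i w) * m (drop i w))"
      by (rule conc_mult[OF Tr tr K2]) (use 2 in auto)
    then show ?thesis using 2 by (simp add: split_prod_def scale_def)
  next
    case 3
    have "conc (\<lambda>N \<omega>. T N \<omega> (drop i w) * (T N \<omega> (take i w) / real N)) (m' (drop i w) * m (take i w))"
      by (rule conc_mult[OF Tr tr K1]) (use 3 un adm in \<open>auto simp: admissible_def\<close>)
    then show ?thesis using 3 by (simp add: split_prod_def scale_def mult.commute)
  qed
qed

text \<open>Read cyclically, a word with both kinds of letters has a \<open>Y\<close>-letter
  followed by a letter outside \<open>Y\<close>; the word is cut there.\<close>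

lemma ex_rotation:
  assumes "\<exists>v\<in>set w. Y v" "\<exists>v\<in>set w. \<not> Y v"
  shows "\<exists>u v. w = u @ v \<and> v @ u \<noteq> [] \<and> \<not> Y (hd (v @ u)) \<and> Y (last (v @ u))"
proof (cases "Y (hd w)")
  case True
  define u v where "u = takeWhile Y w" and "v = dropWhile Y w"
  have uv: "w = u @ v" by (simp add: u_def v_def)
  have "v \<noteq> []" using assms(2) by (auto simp: v_def)
  moreover have "u \<noteq> []" using True assms by (cases w) (auto simp: u_def)
  moreover have "\<not> Y (hd v)" using \<open>v \<noteq> []\<close> unfolding v_def by (rule hd_dropWhile)
  moreover have "Y (last u)" using \<open>u \<noteq> []\<close> unfolding u_def by (metis last_in_set set_takeWhileD)
  ultimately show ?thesis using uv by (intro exI[of _ u] exI[of _ v]) auto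
next
  case False
  show ?thesis
  proof (cases "Y (last w)")
    case True
    then show ?thesis using False assms by (intro exI[of _ "[]"] exI[of _ w]) auto
  next
    case nl: False
    define P where "P = (\<lambda>x. \<not> Y x)"
    define v u where "v = rev (takeWhile P (rev w))" and "u = rev (dropWhile P (rev w))"
    have uv: "w = u @ v" unfolding u_def v_def by (metis rev_append rev_rev_ident takeWhile_dropWhile_id)
    have "u \<noteq> []" using assms(1) by (auto simp: u_def P_def)
    have "v \<noteq> []" using nl assms by (cases w rule: rev_cases) (auto simp: v_def P_def)
    have "Y (last u)" using \<open>u \<noteq> []\<close> hd_dropWhile[of P "rev w"] by (auto simp: u_def P_def last_rev)
    moreover have "\<not> Y (hd v)"
    proof -
      have "hd v \<in> set (takeWhile P (rev w))" using \<open>v \<noteq> []\<close> unfolding v_def by (metis hd_in_set set_rev)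
      then show ?thesis unfolding P_def by (metis set_takeWhileD)
    qed
    ultimately show ?thesis using uv \<open>u \<noteq> []\<close> \<open>v \<noteq> []\<close> by (intro exI[of _ u] exI[of _ v]) auto
  qed
qed

text \<open>The induction ranges over both values of \<open>small\<close>, since the product of a
  cut through \<open>S\<close> also involves the normalised trace of a shorter word. Words of one
  kind have deterministic traces.\<close>

lemma ex_conc_T: "admissible small (set w) \<Longrightarrow> \<exists>x. conc (\<lambda>N \<omega>. T N \<omega> w / scale small N) x"
proof (induction "length w" arbitrary: w small rule: less_induct)
  case less
  show ?case
  proof (cases "(\<forall>v\<in>set w. Y v) \<or> (\<forall>v\<in>set w. \<not> Y v)")
    case True
    have "convergent (\<lambda>N. wtr N (Z N) w / scale small N)"
      using pure[OF _ True] pure'[OF _ True] less.prems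
      by (cases small) (auto simp: scale_def admissible_def)
    then obtain x where "(\<lambda>N. wtr N (Z N) w / scale small N) \<longlonglongrightarrow> x" by (auto simp: convergent_def)
    from conc_cong[OF conc_deterministic[OF this], of "\<lambda>N \<omega>. T N \<omega> w / scale small N"]
    show ?thesis using T_pure[OF _ True] by auto
  next
    case False
    then obtain u v where uv: "w = u @ v" and w': "v @ u \<noteq> []" "\<not> Y (hd (v @ u))" "Y (last (v @ u))"
      using ex_rotation[of w] by auto
    define w' where "w' = v @ u"
    have len: "length w' = length w" and set: "set w' = set w" by (auto simp: w'_def uv)
    \<comment> \<open>The induction hypothesis only asserts that limits exist; choosing them makes
      the limits of all cuts available as functions.\<close>
    define m where "m p = (SOME x. conc (\<lambda>N \<omega>. T N \<omega> p / real N) x)" for p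
    define m' where "m' p = (SOME x. conc (\<lambda>N \<omega>. T N \<omega> p) x)" for p
    have m: "conc (\<lambda>N \<omega>. T N \<omega> p / real N) (m p)" if "length p < length w" "set p \<subseteq> L" for p
    proof -
      have "\<exists>x. conc (\<lambda>N \<omega>. T N \<omega> p / scale False N) x"
        by (rule less.hyps[OF that(1)]) (simp add: admissible_def that)
      then show ?thesis unfolding m_def scale_def if_False by (rule someI_ex)
    qed
    have m': "conc (\<lambda>N \<omega>. T N \<omega> p) (m' p)"
      if "length p < length w" "set p \<subseteq> L" "set p \<inter> S \<noteq> {}" for p
    proof -
      have "\<exists>x. conc (\<lambda>N \<omega>. T N \<omega> p / scale True N) x"
        by (rule less.hyps[OF that(1)]) (simp add: admissible_def that)
      then show ?thesis unfolding m'_def scale_def if_True div_by_1 by (rule someI_ex)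
    qed
    have adm: "admissible small (set w')" using less.prems set by simp
    have "\<exists>x. conc (\<lambda>N \<omega>. T N \<omega> w' / scale small N) x"
    proof (rule conc_T_step[OF adm])
      show "w' \<noteq> []" "\<not> Y (hd w')" "Y (last w')" using w' by (auto simp: w'_def)
      fix i assume i: "0 < i" "i < length w'"
      have sub: "length p < length w" "set p \<subseteq> L" if "p = take i w' \<or> p = drop i w'" for p
        using that i len less.prems set set_take_subset[of i w'] set_drop_subset[of i w']
        by (auto simp: admissible_def)
      show "conc (\<lambda>N \<omega>. split_prod N \<omega> w' i / (real N * scale small N))
         (if \<not> small then m (take i w') * m (drop i w')
          else if set (take i w') \<inter> S \<noteq> {} then m' (take i w') * m (drop i w')
          else m' (drop i w') * m (take i w'))"
        by (rule conc_split_prod[OF adm m[OF sub] m'[OF sub]])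
    qed
    then obtain x where x: "conc (\<lambda>N \<omega>. T N \<omega> w' / scale small N) x" by blast
    have "conc (\<lambda>N \<omega>. T N \<omega> w / scale small N) x"
      by (rule conc_cong[OF x]) (use T_commute[of _ _ u v] in \<open>auto simp: w'_def uv\<close>)
    then show ?thesis by blast
  qed
qed

section \<open>Limiting moments and the limiting Schwinger-Dyson equations\<close>

definition mom :: "'v list \<Rightarrow> real" where
  "mom w = lim (\<lambda>N. expectation (\<lambda>\<omega>. T N \<omega> w / real N))"

text \<open>The value 0 on words avoiding \<open>S\<close> makes the product rule in
  \<open>ysum_mom'\<close> symmetric: a first-order factor without a letter of \<open>S\<close>
  drops out.\<close>

definition mom' :: "'v list \<Rightarrow> real" where
  "mom' w = (if set w \<inter> S \<noteq> {} then lim (\<lambda>N. expectation (\<lambda>\<omega>. T N \<omega> w)) else 0)"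

lemma conc_mom:
  assumes "set w \<subseteq> L" shows "conc (\<lambda>N \<omega>. T N \<omega> w / real N) (mom w)"
proof -
  obtain x where x: "conc (\<lambda>N \<omega>. T N \<omega> w / real N) x"
    using ex_conc_T[of False w] assms by (auto simp: scale_def admissible_def)
  then show ?thesis using limI[OF conc_expectation[OF x]] by (simp add: mom_def)
qed

lemma conc_mom':
  assumes "set w \<subseteq> L" "set w \<inter> S \<noteq> {}" shows "conc (\<lambda>N \<omega>. T N \<omega> w) (mom' w)"
proof -
  obtain x where x: "conc (\<lambda>N \<omega>. T N \<omega> w) x"
    using ex_conc_T[of True w] assms by (auto simp: scale_def admissible_def)
  then show ?thesis using limI[OF conc_expectation[OF x]] assms by (simp add: mom'_def)
qed

lemma mom_Nil: "mom [] = 1"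
proof -
  have "(\<lambda>N. expectation (\<lambda>\<omega>. T N \<omega> [] / real N)) \<longlonglongrightarrow> 1"
    by (rule tendsto_eventually) (auto intro!: eventually_sequentiallyI[of 1] simp: prob_space)
  then show ?thesis unfolding mom_def by (rule limI)
qed

lemma mom'_Nil: "mom' [] = 0"
  by (simp add: mom'_def)

lemma mom_commute: "mom (u @ w) = mom (w @ u)"
  unfolding mom_def by (intro arg_cong[where f = lim] ext Bochner_Integration.integral_cong refl) (simp add: T_commute)

lemma mom'_commute: "mom' (u @ w) = mom' (w @ u)"
proof -
  have "expectation (\<lambda>\<omega>. T N \<omega> (u @ w)) = expectation (\<lambda>\<omega>. T N \<omega> (w @ u))" for N
    by (intro Bochner_Integration.integral_cong refl T_commute)
  then show ?thesis by (simp add: mom'_def Un_commute)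
qed

text \<open>The unnormalised trace already converges, so a further division by N leaves 0.\<close>

lemma mom_small:
  assumes "set w \<subseteq> L" "set w \<inter> S \<noteq> {}" shows "mom w = 0"
proof -
  have 1: "(\<lambda>N. expectation (\<lambda>\<omega>. T N \<omega> w / real N)) \<longlonglongrightarrow> mom w"
    by (rule conc_expectation[OF conc_mom[OF assms(1)]])
  have "(\<lambda>N. expectation (\<lambda>\<omega>. T N \<omega> w) / real N) \<longlonglongrightarrow> 0"
    by (rule tendsto_divide_0[OF conc_expectation[OF conc_mom'[OF assms]]])
      (intro filterlim_at_top_imp_at_infinity filterlim_real_sequentially)
  then show ?thesis using 1 by (intro LIMSEQ_unique[OF 1]) simp
qed

text \<open>With the test function 1 there are no merging terms, and the expected sum over cuts
  equals that of the transposed terms, which is O(N^(-1/2)) after scaling.\<close>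

lemma ysum_limit_eq_0:
  assumes adm: "admissible small (set w)"
    and \<gamma>: "\<And>i. conc (\<lambda>N \<omega>. split_prod N \<omega> w i / (real N * scale small N)) (\<gamma> i)"
  shows "ysum Y w \<gamma> = 0"
proof -
  define s where "s N = real N * scale small N" for N
  have "conc (\<lambda>N \<omega>. ysum Y w (\<lambda>i. split_prod N \<omega> w i / s N)) (ysum Y w \<gamma>)"
    unfolding ysum_def
  proof (rule conc_sum)
    fix i
    show "conc (\<lambda>N \<omega>. if Y (w ! i) then split_prod N \<omega> w i / s N - split_prod N \<omega> w (Suc i) / s N else 0)
        (if Y (w ! i) then \<gamma> i - \<gamma> (Suc i) else 0)"
      by (cases "Y (w ! i)") (simp_all add: conc_deterministic conc_diff s_def \<gamma>)
  qed
  then have lim: "(\<lambda>N. expectation (\<lambda>\<omega>. ysum Y w (\<lambda>i. split_prod N \<omega> w i / s N))) \<longlonglongrightarrow> ysum Y w \<gamma>"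
    by (rule conc_expectation)
  obtain K where K: "K \<ge> 0" "\<And>N \<omega>. N \<ge> 1 \<Longrightarrow> \<omega> \<in> space M \<Longrightarrow>
      \<bar>ysum Y w (\<lambda>i. T N \<omega> (take i w @ rev (drop i w)))\<bar> \<le> K * (s N / sqrt (real N))"
    using ysum_T_bound[of small "\<lambda>i. take i w @ rev (drop i w)" w, OF admissible_splits(1)[OF adm]] unfolding s_def by blast
  have "\<bar>expectation (\<lambda>\<omega>. ysum Y w (\<lambda>i. split_prod N \<omega> w i / s N))\<bar> \<le> K / sqrt (real N)" if N: "N \<ge> 1" for N
  proof -
    have sN: "s N > 0" using N scale_pos[OF N, of small] by (simp add: s_def)
    define R where "R \<omega> = ysum Y w (\<lambda>i. T N \<omega> (take i w @ rev (drop i w)))" for \<omega>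
    have bR: "bdd_rv R" unfolding R_def by (intro bdd_rv_ysum bdd_rv_T)
    have bP: "bdd_rv (\<lambda>\<omega>. ysum Y w (split_prod N \<omega> w))"
      unfolding split_prod_def by (intro bdd_rv_ysum bdd_rv_mult bdd_rv_T)
    have "expectation (\<lambda>\<omega>. ysum Y w (sd_split N (conj_letters Y (U N \<omega>) (Z N)) w)) = 0"
      using schwinger_dyson[OF prob_space_axioms U G Z, where \<phi> = "\<lambda>_. 1" and \<phi>' = "\<lambda>_. 0" and w = w and Y = Y] by simp
    moreover have "ysum Y w (sd_split N (conj_letters Y (U N \<omega>) (Z N)) w) = R \<omega> - ysum Y w (split_prod N \<omega> w)" for \<omega>
      unfolding R_def ysum_diff[symmetric] by (simp add: sd_split_def[abs_def] T_def split_prod_def[abs_def])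
    ultimately have "expectation (\<lambda>\<omega>. ysum Y w (split_prod N \<omega> w)) = expectation R"
      using bR bP by (simp add: bdd_rv_integrable)
    moreover have "ysum Y w (\<lambda>i. split_prod N \<omega> w i / s N) = ysum Y w (split_prod N \<omega> w) / s N" for \<omega>
      using ysum_cmult[of Y w "1 / s N" "split_prod N \<omega> w"] by simp
    ultimately have "\<bar>expectation (\<lambda>\<omega>. ysum Y w (\<lambda>i. split_prod N \<omega> w i / s N))\<bar> = \<bar>expectation R\<bar> / s N"
      using sN by (simp add: abs_divide)
    also have "\<bar>expectation R\<bar> \<le> expectation (\<lambda>\<omega>. \<bar>R \<omega>\<bar>)" by (rule integral_abs_bound)
    also have "\<dots> \<le> expectation (\<lambda>\<omega>. K * (s N / sqrt (real N)))"
      by (intro integral_mono integrable_abs bdd_rv_integrable bdd_rv_const bR)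
        (unfold R_def, rule K(2)[OF N])
    also have "\<dots> = K * (s N / sqrt (real N))" by (simp add: prob_space)
    finally have "\<bar>expectation (\<lambda>\<omega>. ysum Y w (\<lambda>i. split_prod N \<omega> w i / s N))\<bar>
        \<le> K * (s N / sqrt (real N)) / s N" using sN by (simp only: divide_right_mono less_imp_le)
    then show ?thesis using sN by simp
  qed
  then have "\<forall>\<^sub>F N in sequentially. norm (expectation (\<lambda>\<omega>. ysum Y w (\<lambda>i. split_prod N \<omega> w i / s N))) \<le> K / sqrt (real N)"
    by (intro eventually_sequentiallyI[of 1]) auto
  moreover have "(\<lambda>N. K / sqrt (real N)) \<longlonglongrightarrow> 0"
    by (intro tendsto_divide_0[OF tendsto_const] filterlim_at_top_imp_at_infinity
        filterlim_compose[OF sqrt_at_top filterlim_real_sequentially])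
  ultimately have "(\<lambda>N. expectation (\<lambda>\<omega>. ysum Y w (\<lambda>i. split_prod N \<omega> w i / s N))) \<longlonglongrightarrow> 0"
    by (rule Lim_null_comparison)
  then show ?thesis by (rule LIMSEQ_unique[OF lim])
qed

lemma set_split: "set w \<subseteq> L \<Longrightarrow> u = take i w \<or> u = drop i w \<Longrightarrow> set u \<subseteq> L"
  using set_take_subset[of i w] set_drop_subset[of i w] by auto

lemma ysum_mom:
  assumes "set w \<subseteq> L"
  shows "ysum Y w (\<lambda>i. mom (take i w) * mom (drop i w)) = 0"
proof (rule ysum_limit_eq_0[of False])
  have adm: "admissible False (set w)" using assms by (simp add: admissible_def)
  then show "admissible False (set w)" .
  show "conc (\<lambda>N \<omega>. split_prod N \<omega> w i / (real N * scale False N)) (mom (take i w) * mom (drop i w))" for i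
    using conc_split_prod[OF adm, of i mom mom', OF conc_mom[OF set_split[OF assms, where i = i]]] by simp
qed

lemma ysum_mom':
  assumes w: "set w \<subseteq> L" "set w \<inter> S \<noteq> {}"
  shows "ysum Y w (\<lambda>i. mom' (take i w) * mom (drop i w) + mom (take i w) * mom' (drop i w)) = 0"
proof (rule ysum_limit_eq_0[of True])
  have adm: "admissible True (set w)" using assms by (simp add: admissible_def)
  then show "admissible True (set w)" .
  fix i
  \<comment> \<open>The limit chosen by cases agrees with the product rule: a part meeting
    \<open>S\<close> has \<open>mom\<close> equal to 0, and a part avoiding \<open>S\<close> has
    \<open>mom'\<close> equal to 0 by definition.\<close>
  have "(if set (take i w) \<inter> S \<noteq> {} then mom' (take i w) * mom (drop i w) else mom' (drop i w) * mom (take i w))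
     = mom' (take i w) * mom (drop i w) + mom (take i w) * mom' (drop i w)"
    using mom_small[OF set_split[OF w(1)], of "take i w" i] mom'_def[of "take i w"] by (auto simp: mult.commute)
  then show "conc (\<lambda>N \<omega>. split_prod N \<omega> w i / (real N * scale True N))
      (mom' (take i w) * mom (drop i w) + mom (take i w) * mom' (drop i w))"
    using conc_split_prod[OF adm, of i mom mom', OF conc_mom[OF set_split[OF w(1), where i = i]]
        conc_mom'[OF set_split[OF w(1), where i = i]]]
    by simp
qed

end

section \<open>Linear functionals given by moments of words\<close>

definition ext :: "((nat + nat) list \<Rightarrow> complex) \<Rightarrow> ncpoly \<Rightarrow> complex" where
  "ext f P = (\<Sum>w\<in>Poly_Mapping.keys P. Poly_Mapping.lookup P w * f (ncletters w))"

lemma ncletters_plus [simp]: "ncletters (u + v) = ncletters u @ ncletters v"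
  by (simp add: plus_ncword_def)

lemma ncletters_zero [simp]: "ncletters 0 = []"
  by (simp add: zero_ncword_def)

lemma ext_superset:
  "finite A \<Longrightarrow> Poly_Mapping.keys P \<subseteq> A \<Longrightarrow>
   ext f P = (\<Sum>w\<in>A. Poly_Mapping.lookup P w * f (ncletters w))"
  unfolding ext_def by (rule sum.mono_neutral_left) (auto simp: in_keys_iff)

lemma ext_zero [simp]: "ext f 0 = 0"
  by (simp add: ext_def)

lemma ext_add: "ext f (P + Q) = ext f P + ext f Q"
proof -
  define A where "A = Poly_Mapping.keys P \<union> Poly_Mapping.keys Q"
  have A: "finite A" "Poly_Mapping.keys P \<subseteq> A" "Poly_Mapping.keys Q \<subseteq> A" "Poly_Mapping.keys (P + Q) \<subseteq> A"
    using keys_add[of P Q] by (auto simp: A_def)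
  show ?thesis
    by (simp add: ext_superset[OF A(1,2)] ext_superset[OF A(1,3)] ext_superset[OF A(1,4)]
        lookup_add distrib_right sum.distrib)
qed

lemma ext_sum: "ext f (sum P I) = (\<Sum>i\<in>I. ext f (P i))"
  by (induction I rule: infinite_finite_induct) (auto simp: ext_add)

lemma ext_single: "ext f (Poly_Mapping.single w c) = c * f (ncletters w)"
  by (simp add: ext_def)

lemma ext_one [simp]: "ext f 1 = f []"
  by (simp add: ext_single flip: single_one)

lemma ext_cong:
  "(\<And>w. w \<in> Poly_Mapping.keys P \<Longrightarrow> f (ncletters w) = g (ncletters w)) \<Longrightarrow> ext f P = ext g P"
  unfolding ext_def by (intro sum.cong) auto

lemma ext_eq_0:
  "(\<And>w. w \<in> Poly_Mapping.keys P \<Longrightarrow> f (ncletters w) = 0) \<Longrightarrow> ext f P = 0"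
  unfolding ext_def by (intro sum.neutral) auto

lemma ext_fun_add: "ext (\<lambda>w. f w + g w) P = ext f P + ext g P"
  by (simp add: ext_def distrib_left sum.distrib)

lemma ext_fun_cmult: "ext (\<lambda>w. c * f w) P = c * ext f P"
  by (simp add: ext_def sum_distrib_left mult.left_commute)

lemma ext_swap: "ext (\<lambda>u. ext (\<lambda>v. h u v) Q) P = ext (\<lambda>v. ext (\<lambda>u. h u v) P) Q"
  unfolding ext_def sum_distrib_left
  by (subst sum.swap) (intro sum.cong refl, simp add: mult.left_commute)

lemma poly_mapping_sum_single:
  "P = (\<Sum>w\<in>Poly_Mapping.keys P. Poly_Mapping.single w (Poly_Mapping.lookup P w))"
  by (rule poly_mapping_eqI) (simp add: lookup_sum lookup_single when_def in_keys_iff)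

lemma ext_mult: "ext f (P * Q) = ext (\<lambda>u. ext (\<lambda>v. f (u @ v)) Q) P"
proof -
  let ?l = Poly_Mapping.lookup and ?k = Poly_Mapping.keys and ?s = Poly_Mapping.single
  have "P * Q = (\<Sum>u\<in>?k P. ?s u (?l P u)) * (\<Sum>v\<in>?k Q. ?s v (?l Q v))"
    using poly_mapping_sum_single[of P] poly_mapping_sum_single[of Q] by simp
  also have "\<dots> = (\<Sum>u\<in>?k P. \<Sum>v\<in>?k Q. ?s (u + v) (?l P u * ?l Q v))"
    by (simp add: sum_product mult_single)
  finally have "ext f (P * Q) = (\<Sum>u\<in>?k P. \<Sum>v\<in>?k Q. ?l P u * ?l Q v * f (ncletters u @ ncletters v))"
    by (simp add: ext_sum ext_single)
  also have "\<dots> = ext (\<lambda>u. ext (\<lambda>v. f (u @ v)) Q) P"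
    by (simp add: ext_def sum_distrib_left mult.assoc)
  finally show ?thesis .
qed

lemma ext_const_mult:
  "ext f (ncconst c * P) = c * ext f P" "ext f (P * ncconst c) = c * ext f P"
  by (simp_all add: ncconst_def ext_mult ext_single ext_fun_cmult)

lemma ext_const: "ext f (ncconst c) = c * f []"
  by (simp add: ncconst_def ext_single)

lemma ext_diff: "ext f (P - Q) = ext f P - ext f Q"
  using ext_add[of f "P - Q" Q] by simp

lemma ext_commute:
  assumes "\<And>u v. f (u @ v) = f (v @ u)"
  shows "ext f (P * Q) = ext f (Q * P)"
  unfolding ext_mult by (subst ext_swap) (simp add: assms)

text \<open>The functional \<open>f \<otimes> g\<close> applied to the free difference quotient \<open>\<partial>w\<close>, where \<open>\<partial>\<close> is the
  derivation with \<open>\<partial>x = 0\<close> and \<open>\<partial>y = 1 \<otimes> y - y \<otimes> 1\<close>.\<close>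

definition diffq :: "('v \<Rightarrow> bool) \<Rightarrow> ('v list \<Rightarrow> complex) \<Rightarrow> ('v list \<Rightarrow> complex) \<Rightarrow> 'v list \<Rightarrow> complex" where
  "diffq Y f g w = ysum Y w (\<lambda>i. f (take i w) * g (drop i w))"

lemma diffq_Cons:
  "diffq Y f g (a # w) = (if Y a then f [] * g (a # w) - f [a] * g w else 0) + diffq Y (\<lambda>x. f (a # x)) g w"
  by (simp add: diffq_def ysum_Cons)

text \<open>The Leibniz rule for the difference quotient, with the left and right multiplications
  absorbed into the two functionals.\<close>

lemma diffq_append:
  "diffq Y f g (u @ v) = diffq Y f (\<lambda>x. g (x @ v)) u + diffq Y (\<lambda>x. f (u @ x)) g v"
  by (induction u arbitrary: f) (simp_all add: diffq_Cons, simp add: diffq_def)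

lemma diffq_not_Y: "\<forall>v\<in>set w. \<not> Y v \<Longrightarrow> diffq Y f g w = 0"
  by (simp add: diffq_def ysum_def)

text \<open>The sum over cuts telescopes: the derivation maps such a word w to 1 \<otimes> w - w
  \<otimes> 1.\<close>

lemma diffq_Y: "\<forall>v\<in>set w. Y v \<Longrightarrow> diffq Y f g w = f [] * g w - f w * g []"
  by (induction w arbitrary: f) (simp_all add: diffq_Cons, simp add: diffq_def)

lemma diffq_ext_right: "ext (\<lambda>v. diffq Y f (\<lambda>x. g x v) u) Q = diffq Y f (\<lambda>x. ext (g x) Q) u"
  by (simp add: diffq_def ext_def sum_distrib_left ysum_sum ysum_cmult mult.left_commute)

lemma diffq_ext_left: "ext (\<lambda>v. diffq Y (\<lambda>x. f x v) g u) Q = diffq Y (\<lambda>x. ext (f x) Q) g u"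
  by (simp add: diffq_def ext_def sum_distrib_right ysum_sum ysum_cmult mult.assoc)

lemma ext_diffq_mult:
  "ext (diffq Y f g) (P * Q) = ext (diffq Y f (\<lambda>x. ext (\<lambda>v. g (x @ v)) Q)) P
     + ext (diffq Y (\<lambda>x. ext (\<lambda>u. f (u @ x)) P) g) Q"
proof -
  have "ext (diffq Y f g) (P * Q) = ext (\<lambda>u. ext (\<lambda>v. diffq Y f (\<lambda>x. g (x @ v)) u) Q) P
      + ext (\<lambda>u. ext (\<lambda>v. diffq Y (\<lambda>x. f (u @ x)) g v) Q) P"
    by (simp add: ext_mult diffq_append ext_fun_add)
  also have "ext (\<lambda>u. ext (\<lambda>v. diffq Y (\<lambda>x. f (u @ x)) g v) Q) P
      = ext (\<lambda>v. ext (\<lambda>u. diffq Y (\<lambda>x. f (u @ x)) g v) P) Q"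
    by (rule ext_swap)
  finally show ?thesis by (simp add: diffq_ext_right diffq_ext_left)
qed

text \<open>A superset of the ideals in terms of monomials, stable under the operations that
  generate them; vanishing on an ideal can thus be checked word by word.\<close>

definition words_through :: "(nat + nat \<Rightarrow> bool) \<Rightarrow> (nat + nat \<Rightarrow> bool) \<Rightarrow> ncpoly set" where
  "words_through ok small = {P \<in> poly_alg ok.
     \<forall>w\<in>Poly_Mapping.keys P. \<exists>v\<in>set (ncletters w). small v}"

lemma poly_alg_mult: "P \<in> poly_alg ok \<Longrightarrow> Q \<in> poly_alg ok \<Longrightarrow> P * Q \<in> poly_alg ok"
  unfolding poly_alg_def using keys_mult[of P Q] by fastforce

lemma poly_alg_add: "P \<in> poly_alg ok \<Longrightarrow> Q \<in> poly_alg ok \<Longrightarrow> P + Q \<in> poly_alg ok"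
  unfolding poly_alg_def using keys_add[of P Q] by blast

lemma poly_alg_diff: "P \<in> poly_alg ok \<Longrightarrow> Q \<in> poly_alg ok \<Longrightarrow> P - Q \<in> poly_alg ok"
  unfolding poly_alg_def using keys_diff[of P Q] by blast

lemma poly_alg_const [simp]: "ncconst c \<in> poly_alg ok"
  by (simp add: poly_alg_def ncconst_def)

lemma poly_alg_one [simp]: "1 \<in> poly_alg ok"
  by (simp add: poly_alg_def)

lemma words_through_over: "P \<in> words_through ok small \<Longrightarrow> P \<in> poly_alg ok"
  by (simp add: words_through_def)

lemma words_through_lmult:
  assumes "P \<in> poly_alg ok" "Q \<in> words_through ok small"
  shows "P * Q \<in> words_through ok small"
proof -
  have "\<exists>v\<in>set (ncletters w). small v" if "w \<in> Poly_Mapping.keys (P * Q)" for w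
    using that assms(2) keys_mult[of P Q] unfolding words_through_def by fastforce
  then show ?thesis using poly_alg_mult[OF assms(1) words_through_over[OF assms(2)]]
    by (simp add: words_through_def)
qed

lemma words_through_rmult:
  assumes "P \<in> poly_alg ok" "Q \<in> words_through ok small"
  shows "Q * P \<in> words_through ok small"
proof -
  have "\<exists>v\<in>set (ncletters w). small v" if "w \<in> Poly_Mapping.keys (Q * P)" for w
    using that assms(2) keys_mult[of Q P] unfolding words_through_def by fastforce
  then show ?thesis using poly_alg_mult[OF words_through_over[OF assms(2)] assms(1)]
    by (simp add: words_through_def)
qed

lemma words_through_add:
  assumes "P \<in> words_through ok small" "Q \<in> words_through ok small"
  shows "P + Q \<in> words_through ok small"
  using assms poly_alg_add[of P ok Q] keys_add[of P Q] unfolding words_through_def by blast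

section \<open>Freeness of type B from the limiting Schwinger--Dyson equations\<close>

text \<open>Meant for lists of algebra elements instead of letters: once freeness kills the interior
  cuts, the limit equations reduce to a comparison of the two ends.\<close>

lemma ysum_ends:
  fixes g :: "nat \<Rightarrow> 'b::ab_group_add"
  assumes "xs \<noteq> []" and g: "\<And>i. 0 < i \<Longrightarrow> i < length xs \<Longrightarrow> g i = 0"
  shows "ysum P xs g = (if P (hd xs) then g 0 else 0) - (if P (last xs) then g (length xs) else 0)"
proof -
  define n where "n = length xs - 1"
  have n: "length xs = Suc n" using assms(1) by (simp add: n_def)
  have "ysum P xs g = (\<Sum>i<Suc n. (if P (xs ! i) then g i else 0)) - (\<Sum>i<Suc n. (if P (xs ! i) then g (Suc i) else 0))"
    unfolding ysum_def n sum_subtractf[symmetric] by (intro sum.cong) auto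
  also have "(\<Sum>i<Suc n. (if P (xs ! i) then g i else 0))
      = (\<Sum>i<Suc n. if i = 0 then (if P (xs ! 0) then g 0 else 0) else 0)"
    using g n by (intro sum.cong) auto
  also have "(\<Sum>i<Suc n. (if P (xs ! i) then g (Suc i) else 0))
      = (\<Sum>i<Suc n. if i = n then (if P (xs ! n) then g (Suc n) else 0) else 0)"
    using g n by (intro sum.cong) auto
  finally have "ysum P xs g = (if P (xs ! 0) then g 0 else 0) - (if P (xs ! n) then g (Suc n) else 0)"
    by simp
  moreover have "hd xs = xs ! 0" "last xs = xs ! n"
    using assms(1) by (simp_all add: hd_conv_nth last_conv_nth n_def)
  ultimately show ?thesis unfolding n by simp
qed

definition pl :: "(nat \<times> ncpoly) list \<Rightarrow> ncpoly" where
  "pl xs = prod_list (map snd xs)"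

lemma pl_simps [simp]: "pl [] = 1" "pl (x # xs) = snd x * pl xs" "pl (xs @ ys) = pl xs * pl ys"
  by (simp_all add: pl_def)

text \<open>The limiting data with the matrices forgotten. Condition \<open>diffq_m'\<close> is the
  first-order part in e of the equation \<open>diffq_m\<close> written for m + e m' with e^2 = 0, on
  words through a small letter.\<close>

locale typeB_moments =
  fixes ok small Y :: "nat + nat \<Rightarrow> bool" and m m' :: "(nat + nat) list \<Rightarrow> complex"
  assumes m_Nil: "m [] = 1" and m'_Nil: "m' [] = 0"
    and m_commute: "\<And>u v. m (u @ v) = m (v @ u)" and m'_commute: "\<And>u v. m' (u @ v) = m' (v @ u)"
    and m_small: "\<And>w. \<forall>v\<in>set w. ok v \<Longrightarrow> \<exists>v\<in>set w. small v \<Longrightarrow> m w = 0"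
    and diffq_m: "\<And>w. \<forall>v\<in>set w. ok v \<Longrightarrow> diffq Y m m w = 0"
    and diffq_m': "\<And>w. \<forall>v\<in>set w. ok v \<Longrightarrow> \<exists>v\<in>set w. small v \<Longrightarrow> diffq Y m' m w + diffq Y m m' w = 0"
begin

definition alg :: "nat \<Rightarrow> ncpoly set" where
  "alg i = (if i = 1 then poly_alg (\<lambda>v. ok v \<and> \<not> Y v) else poly_alg (\<lambda>v. ok v \<and> Y v))"

abbreviation "J \<equiv> words_through ok small"

definition tagged :: "(nat \<times> ncpoly) list \<Rightarrow> bool" where
  "tagged xs \<longleftrightarrow> (\<forall>(i, a)\<in>set xs. i \<in> {1, 2} \<and> a \<in> alg i)"

definition centered :: "(nat \<times> ncpoly) list \<Rightarrow> bool" where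
  "centered xs \<longleftrightarrow> (\<forall>(i, a)\<in>set xs. i \<in> {1, 2} \<and> a \<in> alg i \<and> ext m a = 0)"

lemma centered_tagged: "centered xs \<Longrightarrow> tagged xs"
  by (auto simp: centered_def tagged_def)

lemma tagged_fst: "tagged xs \<Longrightarrow> x \<in> set xs \<Longrightarrow> fst x \<in> {1, 2}"
  by (cases x) (auto simp: tagged_def)

lemma centered_simps [simp]: "centered []" "centered (xs @ ys) \<longleftrightarrow> centered xs \<and> centered ys"
  "centered (rev xs) \<longleftrightarrow> centered xs"
  "centered ((i, a) # xs) \<longleftrightarrow> i \<in> {1, 2} \<and> a \<in> alg i \<and> ext m a = 0 \<and> centered xs"
  by (auto simp: centered_def)

lemma alg_over: "a \<in> alg i \<Longrightarrow> a \<in> poly_alg ok"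
  unfolding alg_def by (auto simp: poly_alg_def split: if_splits)

lemma alg_mult: "a \<in> alg i \<Longrightarrow> b \<in> alg i \<Longrightarrow> a * b \<in> alg i"
  and alg_diff: "a \<in> alg i \<Longrightarrow> b \<in> alg i \<Longrightarrow> a - b \<in> alg i"
  and alg_const: "ncconst c \<in> alg i"
  unfolding alg_def by (auto intro: poly_alg_mult poly_alg_diff split: if_splits)

lemma pl_over: "tagged xs \<Longrightarrow> pl xs \<in> poly_alg ok"
  by (induction xs) (auto simp: tagged_def intro!: poly_alg_mult dest: alg_over)

text \<open>Cuts inside an element do not count: elements of index 1 are killed by the derivation,
  and inside an element P of index 2 the cuts telescope to 1 \<otimes> P - P \<otimes> 1. A product
  of elements thus behaves like a word whose letters are the elements.\<close>

lemma ext_diffq_list: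
  "tagged xs \<Longrightarrow> ext (diffq Y f g) (pl xs)
     = ysum (\<lambda>x. fst x = 2) xs (\<lambda>i. ext f (pl (take i xs)) * ext g (pl (drop i xs)))"
proof (induction xs arbitrary: f)
  case Nil
  then show ?case by (simp add: diffq_def)
next
  case (Cons x xs)
  obtain i P where x: "x = (i, P)" by force
  have i: "i = 1 \<or> i = 2" and P: "P \<in> alg i" and xs: "tagged xs"
    using Cons.prems by (auto simp: tagged_def x)
  define Q where "Q = pl xs"
  have "ext (diffq Y f g) (P * Q) = ext (diffq Y f (\<lambda>x. ext (\<lambda>v. g (x @ v)) Q)) P
     + ext (diffq Y (\<lambda>x. ext (\<lambda>u. f (u @ x)) P) g) Q"
    by (rule ext_diffq_mult)
  also have "ext (diffq Y f (\<lambda>x. ext (\<lambda>v. g (x @ v)) Q)) P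
      = (if i = 2 then f [] * ext g (P * Q) - ext f P * ext g Q else 0)"
  proof (cases "i = 2")
    case True
    then have "\<forall>w\<in>Poly_Mapping.keys P. \<forall>v\<in>set (ncletters w). Y v"
      using P by (auto simp: alg_def poly_alg_def)
    then have "ext (diffq Y f (\<lambda>x. ext (\<lambda>v. g (x @ v)) Q)) P
        = ext (\<lambda>w. f [] * ext (\<lambda>v. g (w @ v)) Q + (- ext g Q) * f w) P"
      by (intro ext_cong) (simp add: diffq_Y)
    also have "\<dots> = f [] * ext g (P * Q) + (- ext g Q) * ext f P"
      by (simp only: ext_fun_add ext_fun_cmult ext_mult)
    finally show ?thesis using True by simp
  next
    case False
    then have "\<forall>w\<in>Poly_Mapping.keys P. \<forall>v\<in>set (ncletters w). \<not> Y v"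
      using P i by (auto simp: alg_def poly_alg_def)
    then show ?thesis using False by (simp add: ext_eq_0 diffq_not_Y)
  qed
  also have "ext (diffq Y (\<lambda>x. ext (\<lambda>u. f (u @ x)) P) g) Q =
    ysum (\<lambda>x. fst x = 2) xs (\<lambda>i. ext f (P * pl (take i xs)) * ext g (pl (drop i xs)))"
    unfolding Q_def Cons.IH[OF xs] ext_mult by (subst ext_swap) simp
  finally show ?case by (simp add: x ysum_Cons Q_def)
qed

text \<open>By induction all proper prefixes have trace 0, so the limit equation says that the trace
  counted at the first element, if that has index 2, equals the trace counted at the last one, if
  that has index 2. Different indices at the ends give 0 directly; equal ones are merged by
  cyclicity.\<close>

lemma free:
  assumes "xs \<noteq> []" "centered xs" "distinct_adj (map fst xs)"
  shows "ext m (pl xs) = 0"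
  using assms
proof (induction "length xs" arbitrary: xs rule: less_induct)
  case less
  note t = centered_tagged[OF less.prems(2)]
  have splits: "ext m (pl (take i xs)) = 0" if "0 < i" "i < length xs" for i
  proof (rule less.hyps)
    have "xs = take i xs @ drop i xs" by simp
    then show "centered (take i xs)" "distinct_adj (map fst (take i xs))"
      using less.prems by (metis centered_simps(2), metis distinct_adj_appendD1 map_append)
  qed (use that in auto)
  have "ext (diffq Y m m) (pl xs) = 0"
    using pl_over[OF t] by (intro ext_eq_0 diffq_m) (auto simp: poly_alg_def)
  then have "ysum (\<lambda>x. fst x = 2) xs (\<lambda>i. ext m (pl (take i xs)) * ext m (pl (drop i xs))) = 0"
    by (simp add: ext_diffq_list[OF t])
  then have SD: "(if fst (hd xs) = 2 then ext m (pl xs) else 0) = (if fst (last xs) = 2 then ext m (pl xs) else 0)"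
    by (subst (asm) ysum_ends) (use less.prems splits in \<open>auto simp: m_Nil\<close>)
  show ?case
  proof (cases "length xs = 1")
    case True
    then obtain x where "xs = [x]" by (auto simp: length_Suc_conv)
    then show ?thesis using less.prems by (auto simp: centered_def)
  next
    case False
    have tags: "fst (hd xs) \<in> {1, 2}" "fst (last xs) \<in> {1, 2}"
      using tagged_fst[OF t] less.prems(1) by (meson hd_in_set last_in_set)+
    show ?thesis
    proof (cases "fst (hd xs) = fst (last xs)")
      case False
      then show ?thesis using SD tags by (auto split: if_splits)
    next
      \<comment> \<open>The end factors meet cyclically in the product b a, which splits into its
        centred part y and a scalar. Both resulting lists, \<open>ys @ [(i, y)]\<close> and
        \<open>ys\<close>, are alternating and shorter; \<open>ys\<close> is nonempty because it
        separates two factors of equal index.\<close>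
      case same: True
      obtain x zs where xs1: "xs = x # zs" "zs \<noteq> []"
        using less.prems(1) False by (cases xs) auto
      then obtain ys z where xs2: "xs = x # ys @ [z]" by (metis append_butlast_last_id)
      obtain i a b where x: "x = (i, a)" and z: "z = (i, b)"
        using same xs2 by (cases x; cases z) auto
      note xs = xs2[unfolded x z]
      have ys: "ys \<noteq> []" using less.prems(3) by (auto simp: xs)
      define y where "y = b * a - ncconst (ext m (b * a))"
      have ia: "i \<in> {1, 2}" "a \<in> alg i" "b \<in> alg i" "centered ys" using less.prems(2) by (auto simp: xs)
      have y: "y \<in> alg i" "ext m y = 0"
        using ia by (auto simp: y_def alg_mult alg_diff alg_const ext_diff ext_const m_Nil)
      have d: "distinct_adj (map fst ys)" "distinct_adj (map fst (ys @ [(i, y)]))"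
        using less.prems(3) by (auto simp: xs distinct_adj_Cons distinct_adj_append_iff split: if_splits)
      have "ext m (pl xs) = ext m (pl ys * b * a)"
        using ext_commute[of m, OF m_commute, of a "pl ys * b"] by (simp add: xs mult.assoc)
      also have "pl ys * b * a = pl (ys @ [(i, y)]) + pl ys * ncconst (ext m (b * a))"
        by (simp add: y_def right_diff_distrib mult.assoc)
      also have "ext m \<dots> = ext m (pl (ys @ [(i, y)])) + ext m (b * a) * ext m (pl ys)"
        by (simp only: ext_add ext_const_mult)
      also have "ext m (pl (ys @ [(i, y)])) = 0"
        by (rule less.hyps) (use y ia d in \<open>auto simp: xs\<close>)
      also have "ext m (pl ys) = 0"
        by (rule less.hyps) (use ys ia d in \<open>auto simp: xs\<close>)
      finally show ?thesis by simp
    qed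
  qed
qed

lemma ext_m_J: "P \<in> J \<Longrightarrow> ext m P = 0"
  by (intro ext_eq_0 m_small) (auto simp: words_through_def poly_alg_def)

text \<open>At an interior cut the prefix contains \<open>v\<close>, so \<open>m\<close> vanishes on
  it, and the suffix is a centred alternating product, so \<open>m\<close> vanishes on it by
  freeness: both terms of the product rule are 0. Both end cuts equal the quantity sought, and since
  \<open>h\<close> differs from the last index exactly one of them is counted.\<close>

lemma typeB_cyclic:
  assumes v: "v \<in> J" "v \<in> alg h" "h \<in> {1, 2}" and cs: "cs \<noteq> []" "centered cs" "distinct_adj (map fst cs)"
    and h: "fst (hd cs) \<noteq> h" "fst (last cs) \<noteq> h"
  shows "ext m' (v * pl cs) = 0"
proof -
  define xs where "xs = (h, v) # cs"
  have t: "tagged xs" using centered_tagged[OF cs(2)] v by (auto simp: xs_def tagged_def)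
  have tJ: "pl (take i xs) \<in> J" if "i > 0" for i
  proof -
    have "tagged (take (i - 1) cs)"
      using t by (auto simp: xs_def tagged_def dest: in_set_takeD)
    then show ?thesis using that v pl_over by (cases i) (auto simp: xs_def intro: words_through_rmult)
  qed
  define g where "g i = ext m' (pl (take i xs)) * ext m (pl (drop i xs))
      + ext m (pl (take i xs)) * ext m' (pl (drop i xs))" for i
  have plJ: "pl xs \<in> J" using tJ[of "length xs"] by (simp add: xs_def)
  have "ext (\<lambda>w. diffq Y m' m w + diffq Y m m' w) (pl xs) = 0"
    using plJ by (intro ext_eq_0 diffq_m') (auto simp: words_through_def poly_alg_def)
  then have ys: "ysum (\<lambda>x. fst x = 2) xs g = 0"
    unfolding g_def by (simp add: ext_fun_add ysum_add ext_diffq_list[OF t])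
  have "g i = 0" if "0 < i" "i < length xs" for i
  proof -
    have "drop i xs = drop (i - 1) cs" using that by (cases i) (auto simp: xs_def)
    moreover have "ext m (pl (drop (i - 1) cs)) = 0"
    proof (rule free)
      have "cs = take (i - 1) cs @ drop (i - 1) cs" by simp
      then show "centered (drop (i - 1) cs)" "distinct_adj (map fst (drop (i - 1) cs))"
        using cs by (metis centered_simps(2), metis distinct_adj_appendD2 map_append)
    qed (use that in \<open>auto simp: xs_def\<close>)
    ultimately show ?thesis using ext_m_J[OF tJ[OF that(1)]] by (simp add: g_def)
  qed
  then have "(if h = 2 then g 0 else 0) - (if fst (last cs) = 2 then g (length xs) else 0) = 0"
    using ysum_ends[of xs g "\<lambda>x. fst x = 2"] ys cs(1) by (simp add: xs_def)
  moreover have "g 0 = ext m' (pl xs)" "g (length xs) = ext m' (pl xs)"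
    by (simp_all add: g_def m_Nil m'_Nil)
  moreover have "fst (last cs) \<in> {1, 2}"
    by (rule tagged_fst[OF centered_tagged[OF cs(2)] last_in_set[OF cs(1)]])
  ultimately have "ext m' (pl xs) = 0" using v(3) h(2) by (auto split: if_splits)
  then show ?thesis by (simp add: xs_def)
qed

text \<open>Peel off the outermost pair. By cyclicity the leftmost a and the rightmost b become
  neighbours b a. If their indices differ, \<open>typeB_cyclic\<close> gives 0; if they agree, the
  centred part of b a contributes 0 in the same way, and its scalar part leaves the factor
  \<open>ext m\<close> of a b times the shorter product. A product with factors on one side of
  \<open>v\<close> only vanishes, again by \<open>typeB_cyclic\<close>.\<close>

lemma typeB:
  assumes "v \<in> J" "v \<in> alg h" "h \<in> {1, 2}" "centered as" "centered bs"
    and "distinct_adj (rev (map fst as) @ [h] @ map fst bs)"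
  shows "ext m' (pl (rev as) * v * pl bs) =
    (if map fst as = map fst bs then (\<Prod>r<length as. ext m (snd (as ! r) * snd (bs ! r))) * ext m' v else 0)"
  using assms(4-)
proof (induction as arbitrary: bs rule: rev_induct)
  note v = assms(1-3)
  note com = ext_commute[of m', OF m'_commute]
  case Nil
  show ?case
  proof (cases bs rule: rev_cases)
    case Nil
    then show ?thesis by simp
  next
    case (snoc bs' jb)
    obtain j b where jb: "jb = (j, b)" by force
    note bs = snoc[unfolded jb]
    have d: "distinct_adj (h # map fst bs' @ [j])" using Nil.prems bs by simp
    have b: "b \<in> alg j" "centered bs'" using Nil.prems bs by auto
    have "ext m' (v * pl bs) = 0"
    proof (cases "j = h")
      case False
      show ?thesis
        by (rule typeB_cyclic[OF v]) (use Nil.prems bs False d in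
            \<open>auto simp: distinct_adj_Cons hd_append hd_map split: if_splits\<close>)
    next
      \<comment> \<open>A last factor from the algebra of \<open>v\<close> is moved to the front and
        absorbed into \<open>v\<close>: the product \<open>b * v\<close> is still in that algebra
        and still in the ideal, and the new last index differs from \<open>h\<close>.\<close>
      case True
      have ne: "bs' \<noteq> []" using d True by auto
      have "ext m' (v * pl bs) = ext m' (b * v * pl bs')"
        using com[of "v * pl bs'" b] by (simp add: bs mult.assoc)
      also have "\<dots> = 0"
        by (rule typeB_cyclic)
          (use v b True ne d in \<open>auto simp: alg_mult alg_over words_through_lmult distinct_adj_Cons
              distinct_adj_append_iff hd_append hd_map last_map split: if_splits\<close>)
      finally show ?thesis .
    qed
    then show ?thesis by (simp add: bs)
  qed
next
  note v = assms(1-3)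
  note com = ext_commute[of m', OF m'_commute]
  case (snoc ia as')
  obtain i a where ia: "ia = (i, a)" by force
  note prems = snoc.prems[unfolded ia]
  have a: "i \<in> {1, 2}" "a \<in> alg i" "centered as'" using prems by auto
  have d: "distinct_adj (i # rev (map fst as') @ h # map fst bs)" using prems by simp
  have da: "distinct_adj (i # rev (map fst as'))"
    using d distinct_adj_appendD1[of "i # rev (map fst as')"] by simp
  have lasth: "fst (last ((i, a) # rev as')) \<noteq> h"
    using d by (cases as') (auto simp: distinct_adj_append_iff distinct_adj_Cons split: if_splits)
  have db: "distinct_adj (h # map fst bs)"
    using d distinct_adj_appendD2[of "i # rev (map fst as')" "h # map fst bs"] by simp
  show ?case
  proof (cases bs rule: rev_cases)
    case Nil
    have "ext m' (pl (rev (as' @ [(i, a)])) * v) = ext m' (v * pl ((i, a) # rev as'))"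
      using com[of "a * pl (rev as')" v] by simp
    also have "\<dots> = 0"
    proof (cases "i = h")
      case False
      show ?thesis
        by (rule typeB_cyclic[OF v]) (use a da False prems lasth in \<open>auto simp: rev_map\<close>)
    next
      case True
      have ne: "as' \<noteq> []" using lasth True by auto
      have "ext m' (v * a * pl (rev as')) = 0"
        by (rule typeB_cyclic)
          (use v a True ne da lasth in \<open>auto simp: alg_mult alg_over words_through_rmult
              distinct_adj_Cons rev_map hd_map split: if_splits\<close>)
      then show ?thesis by (simp add: mult.assoc)
    qed
    finally show ?thesis using Nil by (simp add: ia)
  next
    case (snoc bs' jb)
    obtain j b where jb: "jb = (j, b)" by force
    note bs = snoc[unfolded jb]
    have b: "j \<in> {1, 2}" "b \<in> alg j" "centered bs'" using prems bs by auto
    have dbs: "distinct_adj (map fst bs)" "fst (hd bs) \<noteq> h"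
      using db bs by (auto simp: distinct_adj_Cons hd_map hd_append split: if_splits)
    have dbs': "distinct_adj (map fst bs')" using dbs(1) by (simp add: bs distinct_adj_appendD1)
    define X where "X = pl (rev as') * v * pl bs'"
    show ?thesis
    proof (cases "i = j")
      case False
      have "ext m' (pl (rev (as' @ [(i, a)])) * v * pl bs) = ext m' (v * pl (bs @ (i, a) # rev as'))"
        using com[of "a * pl (rev as')" "v * pl bs"] by (simp add: mult.assoc)
      also have "\<dots> = 0"
        by (rule typeB_cyclic[OF v])
          (use a da False prems lasth dbs bs in \<open>auto simp: distinct_adj_append_iff rev_map hd_append\<close>)
      finally show ?thesis using False by (simp add: ia bs)
    next
      case True
      define y where "y = b * a - ncconst (ext m (b * a))"
      have y: "y \<in> alg i" "ext m y = 0"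
        using a b True by (auto simp: y_def alg_mult alg_diff alg_const ext_diff ext_const m_Nil)
      have "ext m' (pl (rev (as' @ [(i, a)])) * v * pl bs) = ext m' (X * (b * a))"
        using com[of a "X * b"] by (simp add: bs X_def mult.assoc)
      also have "X * (b * a) = X * y + X * ncconst (ext m (b * a))"
        by (simp add: y_def right_diff_distrib)
      also have "ext m' \<dots> = ext m' (X * y) + ext m (b * a) * ext m' X"
        by (simp only: ext_add ext_const_mult)
      also have "ext m' (X * y) = ext m' (v * pl (bs' @ (i, y) # rev as'))"
        using com[of "pl (rev as')" "v * (pl bs' * y)"] by (simp add: X_def mult.assoc)
      also have "\<dots> = 0"
        by (rule typeB_cyclic[OF v])
          (use a b y da lasth dbs bs True in
            \<open>auto simp: distinct_adj_append_iff rev_map hd_append split: if_splits\<close>)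
      also have "ext m' X = (if map fst as' = map fst bs'
          then (\<Prod>r<length as'. ext m (snd (as' ! r) * snd (bs' ! r))) * ext m' v else 0)"
        unfolding X_def
      proof (rule snoc.IH)
        show "distinct_adj (rev (map fst as') @ [h] @ map fst bs')"
          using d by (auto simp: bs distinct_adj_Cons distinct_adj_append_iff split: if_splits)
      qed (use a b in auto)
      also have "ext m (b * a) = ext m (a * b)" by (rule ext_commute[of m, OF m_commute])
      finally show ?thesis using True
        by (auto simp: ia bs nth_append dest: arg_cong[where f = length])
    qed
  qed
qed

end

section \<open>From words to polynomials\<close>

lemma words_through_mono:
  "(\<And>v. ok v \<Longrightarrow> ok' v) \<Longrightarrow> words_through ok small \<subseteq> words_through ok' small"
  by (auto simp: words_through_def poly_alg_def)

lemma gen_ideal_subset: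
  assumes "S \<subseteq> poly_alg ok" "G \<subseteq> words_through ok small"
  shows "gen_ideal S G \<subseteq> words_through ok small"
proof
  fix P assume "P \<in> gen_ideal S G"
  then show "P \<in> words_through ok small"
  proof induction
    case zero
    show ?case by (simp add: words_through_def poly_alg_def)
  qed (use assms in \<open>auto intro: words_through_add words_through_lmult words_through_rmult\<close>)
qed

text \<open>The counterpart of \<open>gen_ideal_subset\<close> for monomials: it makes the
  hypotheses on the ideals applicable to single words.\<close>

lemma single_in_gen_ideal:
  assumes "\<forall>v\<in>set w. ok v" "x \<in> set w" "ncvar x \<in> G"
  shows "Poly_Mapping.single (NCW w) 1 \<in> gen_ideal (poly_alg ok) G"
proof -
  obtain a b where w: "w = a @ x # b" using assms(2) by (meson split_list)
  have "Poly_Mapping.single (NCW w) 1 = Poly_Mapping.single (NCW a) 1 * (ncvar x * Poly_Mapping.single (NCW b) 1)"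
    by (simp add: ncvar_def mult_single plus_ncword_def w)
  also have "\<dots> \<in> gen_ideal (poly_alg ok) G"
    using assms(1,3) by (intro gen_ideal.lmult gen_ideal.rmult gen_ideal.gen) (auto simp: poly_alg_def w)
  finally show ?thesis .
qed

lemma word_eval_wprod: "word_eval N Xs Ys w = wprod N (case_sum Xs Ys) (ncletters w)"
  by (simp add: word_eval_def wprod_def)

lemma ntr_eq_ext:
  assumes "P \<in> poly_alg ok" "\<And>v. ok v \<Longrightarrow> case_sum Xs Ys v = Z v"
  shows "ntr N Xs Ys P = ext (\<lambda>w. complex_of_real (wtr N Z w)) P / of_nat N"
proof -
  have "wtr N (case_sum Xs Ys) (ncletters w) = wtr N Z (ncletters w)" if "w \<in> Poly_Mapping.keys P" for w
    using assms that by (intro wtr_cong) (auto simp: poly_alg_def)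
  then show ?thesis
    unfolding ntr_def ext_def word_eval_wprod wtr_def[symmetric] by (intro arg_cong2[where f = "(/)"] sum.cong) auto
qed

lemma ext_tendsto:
  assumes "\<And>w. w \<in> Poly_Mapping.keys P \<Longrightarrow> (\<lambda>n. f n (ncletters w)) \<longlonglongrightarrow> g (ncletters w)"
  shows "(\<lambda>n. ext (f n) P) \<longlonglongrightarrow> ext g P"
  unfolding ext_def using assms by (intro tendsto_sum tendsto_mult tendsto_const)

lemma ext_divide: "ext f P / c = ext (\<lambda>w. f w / c) P"
  by (simp add: ext_def sum_divide_distrib)

lemma integral_ext:
  assumes "\<And>w. integrable M (\<lambda>\<omega>. F \<omega> w)"
  shows "(\<integral>\<omega>. ext (\<lambda>w. complex_of_real (F \<omega> w)) P \<partial>M) = ext (\<lambda>w. complex_of_real (\<integral>\<omega>. F \<omega> w \<partial>M)) P"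
proof -
  have "(\<integral>\<omega>. ext (\<lambda>w. complex_of_real (F \<omega> w)) P \<partial>M)
      = (\<Sum>w\<in>Poly_Mapping.keys P. \<integral>\<omega>. Poly_Mapping.lookup P w * complex_of_real (F \<omega> (ncletters w)) \<partial>M)"
    unfolding ext_def using assms
    by (intro Bochner_Integration.integral_sum integrable_mult_right integrable_of_real)
  then show ?thesis by (simp add: ext_def)
qed

lemma ysum_of_real: "complex_of_real (ysum Y w f) = ysum Y w (\<lambda>i. complex_of_real (f i))"
  unfolding ysum_def of_real_sum by (intro sum.cong) auto

lemma convergent_of_real_complexD:
  assumes "(\<lambda>n. complex_of_real (f n)) \<longlonglongrightarrow> z" shows "convergent f"
  using tendsto_Re[OF assms] by (auto simp: convergent_def)

context haar_words
begin

lemma mom_pure: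
  assumes "set w \<subseteq> L" and p: "(\<forall>v\<in>set w. Y v) \<or> (\<forall>v\<in>set w. \<not> Y v)"
  shows "(\<lambda>N. wtr N (Z N) w / real N) \<longlonglongrightarrow> mom w"
proof -
  have "expectation (\<lambda>\<omega>. T N \<omega> w / real N) = expectation (\<lambda>\<omega>. wtr N (Z N) w / real N)" for N
    by (intro Bochner_Integration.integral_cong refl) (simp add: T_pure[OF _ p])
  then have eq: "expectation (\<lambda>\<omega>. T N \<omega> w / real N) = wtr N (Z N) w / real N" for N
    by (simp only: lebesgue_integral_const prob_space scaleR_one)
  show ?thesis using conc_expectation[OF conc_mom[OF assms(1)]] by (simp only: eq)
qed

lemma mom'_pure:
  assumes "set w \<subseteq> L" "set w \<inter> S \<noteq> {}" and p: "(\<forall>v\<in>set w. Y v) \<or> (\<forall>v\<in>set w. \<not> Y v)"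
  shows "(\<lambda>N. wtr N (Z N) w) \<longlonglongrightarrow> mom' w"
proof -
  have "expectation (\<lambda>\<omega>. T N \<omega> w) = expectation (\<lambda>\<omega>. wtr N (Z N) w)" for N
    by (intro Bochner_Integration.integral_cong refl) (simp add: T_pure[OF _ p])
  then show ?thesis using conc_expectation[OF conc_mom'[OF assms(1,2)]] by (simp add: prob_space)
qed

end

theorem theorem6p2:
  fixes k k' l l' :: nat
    and A :: "nat \<Rightarrow> nat \<Rightarrow> real mat"
    and B :: "nat \<Rightarrow> nat \<Rightarrow> real mat"
    and tau tau' :: "ncpoly \<Rightarrow> complex"
    and M :: "'w measure"
    and U :: "nat \<Rightarrow> 'w \<Rightarrow> real mat"
    and special :: bool
  assumes "k' \<le> k" and "l' \<le> l"
    and A_sym: "\<And>N i. i < k \<Longrightarrow> A N i \<in> carrier_mat N N \<and> transpose_mat (A N i) = A N i"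
    and B_sym: "\<And>N j. j < l \<Longrightarrow> B N j \<in> carrier_mat N N \<and> transpose_mat (B N j) = B N j"
    and A_lim: "\<And>P. P \<in> algA1 k \<Longrightarrow>
        (\<lambda>N. ntr N (A N) (\<lambda>_. 0\<^sub>m N N) P) \<longlonglongrightarrow> tau P"
    and A_lim': "\<And>P. P \<in> idealI1 k k' \<Longrightarrow>
        (\<lambda>N. of_nat N * ntr N (A N) (\<lambda>_. 0\<^sub>m N N) P) \<longlonglongrightarrow> tau' P"
    and B_lim: "\<And>P. P \<in> algA2 l \<Longrightarrow>
        (\<lambda>N. ntr N (\<lambda>_. 0\<^sub>m N N) (B N) P) \<longlonglongrightarrow> tau P"
    and B_lim': "\<And>P. P \<in> idealI2 l l' \<Longrightarrow>
        (\<lambda>N. of_nat N * ntr N (\<lambda>_. 0\<^sub>m N N) (B N) P) \<longlonglongrightarrow> tau' P"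
    and "prob_space M"
    and U_haar: "\<And>N. haar_random M N (if special then sorth_group N else orth_group N) (U N)"
  shows "\<exists>tauE tauE'.
      (\<forall>P \<in> algA1 k \<union> algA2 l. tauE P = tau P) \<and>
      (\<forall>P \<in> idealI1 k k' \<union> idealI2 l l'. tauE' P = tau' P) \<and>
      lin_on (algA k l) tauE \<and> lin_on (idealI k k' l l') tauE' \<and>
      (\<forall>P \<in> algA k l. (\<lambda>N. integral\<^sup>L M
          (\<lambda>\<omega>. ntr N (A N) (\<lambda>j. U N \<omega> * B N j * transpose_mat (U N \<omega>)) P))
          \<longlonglongrightarrow> tauE P) \<and>
      (\<forall>P \<in> idealI k k' l l'. (\<lambda>N. of_nat N * integral\<^sup>L M
          (\<lambda>\<omega>. ntr N (A N) (\<lambda>j. U N \<omega> * B N j * transpose_mat (U N \<omega>)) P))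
          \<longlonglongrightarrow> tauE' P) \<and>
      free_type_B tauE tauE' (algA1 k) (algA2 l) (idealI1 k k') (idealI2 l l') \<and>
      (AE \<omega> in M.
         (\<forall>P \<in> algA k l. (\<lambda>N. ntr N (A N) (\<lambda>j. U N \<omega> * B N j * transpose_mat (U N \<omega>)) P)
            \<longlonglongrightarrow> tauE P) \<and>
         (\<forall>P \<in> idealI k k' l l'. (\<lambda>N. of_nat N *
            ntr N (A N) (\<lambda>j. U N \<omega> * B N j * transpose_mat (U N \<omega>)) P)
            \<longlonglongrightarrow> tauE' P))"
proof -
  define ok where "ok = (\<lambda>v :: nat + nat. case v of Inl i \<Rightarrow> i < k | Inr j \<Rightarrow> j < l)"
  define small where "small = (\<lambda>v :: nat + nat. case v of Inl i \<Rightarrow> i < k' | Inr j \<Rightarrow> j < l')"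
  define Y where "Y = (\<lambda>v :: nat + nat. case v of Inl i \<Rightarrow> False | Inr j \<Rightarrow> True)"
  \<comment> \<open>Letters out of range are set to 0 because \<open>sym_letters\<close> constrains
    every letter of the type.\<close>
  define Z where "Z N v = (if ok v then case_sum (A N) (B N) v else 0\<^sub>m N N)" for N v
  define G where "G N = (if special then sorth_group N else orth_group N)" for N
  define L where "L = {v. ok v}"
  define S where "S = {v. small v}"
  have A: "algA k l = poly_alg ok" by (simp add: algA_def ok_def)
  have A1: "algA1 k = poly_alg (\<lambda>v. ok v \<and> \<not> Y v)"
    unfolding algA1_def ok_def Y_def by (rule arg_cong[where f = poly_alg]) (auto split: sum.splits)
  have A2: "algA2 l = poly_alg (\<lambda>v. ok v \<and> Y v)"
    unfolding algA2_def ok_def Y_def by (rule arg_cong[where f = poly_alg]) (auto split: sum.splits)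
  have I1: "idealI1 k k' \<subseteq> words_through (\<lambda>v. ok v \<and> \<not> Y v) small"
    unfolding idealI1_def A1 using \<open>k' \<le> k\<close>
    by (intro gen_ideal_subset)
      (auto simp: words_through_def poly_alg_def ncvar_def ok_def Y_def small_def)
  have I2: "idealI2 l l' \<subseteq> words_through (\<lambda>v. ok v \<and> Y v) small"
    unfolding idealI2_def A2 using \<open>l' \<le> l\<close>
    by (intro gen_ideal_subset)
      (auto simp: words_through_def poly_alg_def ncvar_def ok_def Y_def small_def)
  have I1': "idealI1 k k' \<subseteq> words_through ok small" and I2': "idealI2 l l' \<subseteq> words_through ok small"
    using I1 I2 words_through_mono[of "\<lambda>v. ok v \<and> \<not> Y v" ok small]
      words_through_mono[of "\<lambda>v. ok v \<and> Y v" ok small] by blast+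
  have I: "idealI k k' l l' \<subseteq> words_through ok small"
    unfolding idealI_def A using I1' I2' by (intro gen_ideal_subset) auto
  have ntrA: "ntr N (A N) (\<lambda>_. 0\<^sub>m N N) P = ext (\<lambda>w. complex_of_real (wtr N (Z N) w)) P / of_nat N"
    if "P \<in> algA1 k" for N P
    using that unfolding A1 by (rule ntr_eq_ext) (auto simp: Z_def Y_def split: sum.splits)
  have ntrB: "ntr N (\<lambda>_. 0\<^sub>m N N) (B N) P = ext (\<lambda>w. complex_of_real (wtr N (Z N) w)) P / of_nat N"
    if "P \<in> algA2 l" for N P
    using that unfolding A2 by (rule ntr_eq_ext) (auto simp: Z_def Y_def split: sum.splits)
  have ntrU: "ntr N (A N) (\<lambda>j. V * B N j * transpose_mat V) P
      = ext (\<lambda>w. complex_of_real (wtr N (conj_letters Y V (Z N)) w)) P / of_nat N"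
    if "P \<in> algA k l" for N P V
    using that unfolding A
    by (rule ntr_eq_ext) (auto simp: Z_def Y_def conj_letters_def split: sum.splits)
  \<comment> \<open>The two sequences agree from N = 1 on; at N = 0 the division yields 0.\<close>
  have cancel: "(\<lambda>N. of_nat N * (f N / of_nat N)) \<longlonglongrightarrow> z \<longleftrightarrow> f \<longlonglongrightarrow> z" for f and z :: complex
    by (intro tendsto_cong eventually_sequentiallyI[of 1]) auto
  have pure_lim: "(\<lambda>N. ext (\<lambda>w. complex_of_real (wtr N (Z N) w)) P / of_nat N) \<longlonglongrightarrow> tau P"
    if "P \<in> algA1 k \<union> algA2 l" for P
    using that A_lim[of P] B_lim[of P] by (auto simp: ntrA ntrB)
  have pure_lim': "(\<lambda>N. ext (\<lambda>w. complex_of_real (wtr N (Z N) w)) P) \<longlonglongrightarrow> tau' P"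
    if "P \<in> idealI1 k k' \<union> idealI2 l l'" for P
  proof -
    have "P \<in> idealI1 k k' \<Longrightarrow> P \<in> algA1 k" "P \<in> idealI2 l l' \<Longrightarrow> P \<in> algA2 l"
      using I1 I2 words_through_over unfolding A1 A2 by blast+
    then have "(\<lambda>N. of_nat N * (ext (\<lambda>w. complex_of_real (wtr N (Z N) w)) P / of_nat N)) \<longlonglongrightarrow> tau' P"
      using that A_lim'[of P] B_lim'[of P] ntrA[of P] ntrB[of P] by (simp only: Un_iff) (elim disjE, simp_all only:)
    then show ?thesis by (simp only: cancel)
  qed
  have single_alg: "Poly_Mapping.single (NCW w) 1 \<in> algA1 k \<union> algA2 l"
    if "set w \<subseteq> L" "(\<forall>v\<in>set w. Y v) \<or> (\<forall>v\<in>set w. \<not> Y v)" for w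
    using that by (auto simp: A1 A2 poly_alg_def L_def)
  have single_ideal: "Poly_Mapping.single (NCW w) 1 \<in> idealI1 k k' \<union> idealI2 l l'"
    if w: "set w \<subseteq> L" "(\<forall>v\<in>set w. Y v) \<or> (\<forall>v\<in>set w. \<not> Y v)" "set w \<inter> S \<noteq> {}" for w
  proof -
    obtain x where x: "x \<in> set w" "small x" using w by (auto simp: S_def)
    from w(2) show ?thesis
    proof
      assume "\<forall>v\<in>set w. Y v"
      then have "Poly_Mapping.single (NCW w) 1 \<in> idealI2 l l'"
        unfolding idealI2_def A2 using w x
        by (intro single_in_gen_ideal[OF _ x(1)]) (auto simp: L_def Y_def small_def split: sum.splits)
      then show ?thesis by simp
    next
      assume "\<forall>v\<in>set w. \<not> Y v"
      then have "Poly_Mapping.single (NCW w) 1 \<in> idealI1 k k'"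
        unfolding idealI1_def A1 using w x
        by (intro single_in_gen_ideal[OF _ x(1)]) (auto simp: L_def Y_def small_def split: sum.splits)
      then show ?thesis by simp
    qed
  qed
  interpret prob_space M by fact
  interpret H: haar_words M Y Z U G L S
  proof
    fix N
    show "sym_letters N (Z N)"
      using A_sym B_sym by (auto simp: sym_letters_def Z_def ok_def split: sum.splits)
    show "haar_random M N (G N) (U N)" using U_haar by (simp add: G_def)
    show "G N \<subseteq> orth_group N" "sorth_group N \<subseteq> G N" using sorth_group_subset by (auto simp: G_def)
    have "v \<in> Inl ` {..<k} \<union> Inr ` {..<l}" if "v \<in> L" for v
      using that by (cases v) (auto simp: L_def ok_def)
    then show "finite L" by (intro finite_subset[of L "Inl ` {..<k} \<union> Inr ` {..<l}"]) auto
  next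
    fix w assume w: "set w \<subseteq> L" "(\<forall>v\<in>set w. Y v) \<or> (\<forall>v\<in>set w. \<not> Y v)"
    have "(\<lambda>N. complex_of_real (wtr N (Z N) w / real N)) \<longlonglongrightarrow> tau (Poly_Mapping.single (NCW w) 1)"
      using pure_lim[OF single_alg[OF w]] by (simp add: ext_single)
    then show "convergent (\<lambda>N. wtr N (Z N) w / real N)" by (rule convergent_of_real_complexD)
  next
    fix w assume w: "set w \<subseteq> L" "(\<forall>v\<in>set w. Y v) \<or> (\<forall>v\<in>set w. \<not> Y v)" "set w \<inter> S \<noteq> {}"
    have "(\<lambda>N. complex_of_real (wtr N (Z N) w)) \<longlonglongrightarrow> tau' (Poly_Mapping.single (NCW w) 1)"
      using pure_lim'[OF single_ideal[OF w]] by (simp add: ext_single)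
    then show "convergent (\<lambda>N. wtr N (Z N) w)" by (rule convergent_of_real_complexD)
  qed
  define m where "m w = complex_of_real (H.mom w)" for w
  define m' where "m' w = complex_of_real (H.mom' w)" for w
  interpret F: typeB_moments ok small Y m m'
  proof
    show "m [] = 1" "m' [] = 0" by (simp_all add: m_def m'_def H.mom_Nil H.mom'_Nil)
    show "m (u @ v) = m (v @ u)" "m' (u @ v) = m' (v @ u)" for u v
      by (simp_all add: m_def m'_def H.mom_commute[of u v] H.mom'_commute[of u v])
    fix w :: "(nat + nat) list" assume w: "\<forall>v\<in>set w. ok v"
    then have wL: "set w \<subseteq> L" by (auto simp: L_def)
    show "diffq Y m m w = 0"
      using H.ysum_mom[OF wL] ysum_of_real[of Y w "\<lambda>i. H.mom (take i w) * H.mom (drop i w)"]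
      by (simp add: diffq_def m_def)
    assume "\<exists>v\<in>set w. small v"
    then have wS: "set w \<inter> S \<noteq> {}" by (auto simp: S_def)
    show "m w = 0" using H.mom_small[OF wL wS] by (simp add: m_def)
    show "diffq Y m' m w + diffq Y m m' w = 0"
      using H.ysum_mom'[OF wL wS] ysum_of_real[of Y w
          "\<lambda>i. H.mom' (take i w) * H.mom (drop i w) + H.mom (take i w) * H.mom' (drop i w)"]
      by (simp add: diffq_def m_def m'_def ysum_add)
  qed
  have keysL: "set (ncletters w) \<subseteq> L" if "P \<in> poly_alg ok" "w \<in> Poly_Mapping.keys P" for P w
    using that by (auto simp: poly_alg_def L_def)
  have keysS: "set (ncletters w) \<subseteq> L" "set (ncletters w) \<inter> S \<noteq> {}"
    if "P \<in> words_through ok small" "w \<in> Poly_Mapping.keys P" for P w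
    using that by (auto simp: words_through_def poly_alg_def L_def S_def)
  have keysY: "(\<forall>v\<in>set (ncletters w). Y v) \<or> (\<forall>v\<in>set (ncletters w). \<not> Y v)"
    if "P \<in> algA1 k \<union> algA2 l" "w \<in> Poly_Mapping.keys P" for P w
    using that by (auto simp: A1 A2 poly_alg_def)
  \<comment> \<open>The given \<open>tau\<close> comes only as a pointwise limit. It agrees with the
    linear functional \<open>ext m\<close> on each of the two algebras because both are limits of
    the same deterministic sequence.\<close>
  have ext1: "ext m P = tau P" if P: "P \<in> algA1 k \<union> algA2 l" for P
  proof -
    have "P \<in> poly_alg ok" using P unfolding A1 A2 by (auto simp: poly_alg_def)
    then have "(\<lambda>N. complex_of_real (wtr N (Z N) (ncletters w)) / of_nat N) \<longlonglongrightarrow> m (ncletters w)"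
      if "w \<in> Poly_Mapping.keys P" for w
      using tendsto_of_real[OF H.mom_pure[OF keysL[OF _ that] keysY[OF P that]], where 'a = complex]
      by (simp add: m_def)
    then have "(\<lambda>N. ext (\<lambda>w. complex_of_real (wtr N (Z N) w) / of_nat N) P) \<longlonglongrightarrow> ext m P"
      by (rule ext_tendsto)
    then show ?thesis using pure_lim[OF P] unfolding ext_divide by (rule LIMSEQ_unique)
  qed
  have ext2: "ext m' P = tau' P" if P: "P \<in> idealI1 k k' \<union> idealI2 l l'" for P
  proof -
    have J: "P \<in> words_through ok small" using P I1' I2' by blast
    have P': "P \<in> algA1 k \<union> algA2 l" using P I1 I2 words_through_over unfolding A1 A2 by blast
    have "(\<lambda>N. ext (\<lambda>w. complex_of_real (wtr N (Z N) w)) P) \<longlonglongrightarrow> ext m' P"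
      unfolding m'_def by (intro ext_tendsto tendsto_of_real H.mom'_pure keysS[OF J] keysY[OF P'])
    then show ?thesis using pure_lim'[OF P] by (rule LIMSEQ_unique)
  qed
  have lin: "lin_on X (ext f)" for X f
    by (simp add: lin_on_def ext_add ext_const_mult)
  have int: "integrable M (\<lambda>\<omega>. H.T N \<omega> w)" for N w
    by (rule bdd_rv_integrable[OF H.bdd_rv_T])
  have exp_ntr: "(\<integral>\<omega>. ntr N (A N) (\<lambda>j. U N \<omega> * B N j * transpose_mat (U N \<omega>)) P \<partial>M)
      = ext (\<lambda>w. complex_of_real (expectation (\<lambda>\<omega>. H.T N \<omega> w))) P / of_nat N" if "P \<in> algA k l" for N P
    unfolding ntrU[OF that] H.T_def[symmetric] by (simp add: integral_ext[OF int])
  have E1: "(\<lambda>N. \<integral>\<omega>. ntr N (A N) (\<lambda>j. U N \<omega> * B N j * transpose_mat (U N \<omega>)) P \<partial>M) \<longlonglongrightarrow> ext m P"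
    if P: "P \<in> algA k l" for P
    unfolding exp_ntr[OF P] ext_divide
  proof (rule ext_tendsto)
    fix w assume "w \<in> Poly_Mapping.keys P"
    then have "(\<lambda>N. expectation (\<lambda>\<omega>. H.T N \<omega> (ncletters w) / real N)) \<longlonglongrightarrow> H.mom (ncletters w)"
      using P unfolding A by (intro conc_expectation H.conc_mom keysL)
    from tendsto_of_real[OF this, where 'a = complex]
    show "(\<lambda>N. complex_of_real (expectation (\<lambda>\<omega>. H.T N \<omega> (ncletters w))) / of_nat N) \<longlonglongrightarrow> m (ncletters w)"
      by (simp add: m_def)
  qed
  have I_alg: "P \<in> algA k l" if "P \<in> idealI k k' l l'" for P
    using that I words_through_over unfolding A by blast
  have E2: "(\<lambda>N. of_nat N * (\<integral>\<omega>. ntr N (A N) (\<lambda>j. U N \<omega> * B N j * transpose_mat (U N \<omega>)) P \<partial>M)) \<longlonglongrightarrow> ext m' P"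
    if P: "P \<in> idealI k k' l l'" for P
    unfolding exp_ntr[OF I_alg[OF P]] cancel m'_def
    using P I by (intro ext_tendsto tendsto_of_real conc_expectation H.conc_mom' keysS) auto
  \<comment> \<open>There are countably many words, so one null set serves all of them; polynomials
    follow since each is a finite combination of words.\<close>
  have AE1: "AE \<omega> in M. \<forall>w. set w \<subseteq> L \<longrightarrow> (\<lambda>N. H.T N \<omega> w / real N) \<longlonglongrightarrow> H.mom w"
    unfolding AE_all_countable
  proof
    fix w
    show "AE \<omega> in M. set w \<subseteq> L \<longrightarrow> (\<lambda>N. H.T N \<omega> w / real N) \<longlonglongrightarrow> H.mom w"
      using conc_AE[OF H.conc_mom[of w]] by (cases "set w \<subseteq> L") auto
  qed
  have AE2: "AE \<omega> in M. \<forall>w. set w \<subseteq> L \<and> set w \<inter> S \<noteq> {} \<longrightarrow> (\<lambda>N. H.T N \<omega> w) \<longlonglongrightarrow> H.mom' w"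
    unfolding AE_all_countable
  proof
    fix w
    show "AE \<omega> in M. set w \<subseteq> L \<and> set w \<inter> S \<noteq> {} \<longrightarrow> (\<lambda>N. H.T N \<omega> w) \<longlonglongrightarrow> H.mom' w"
      using conc_AE[OF H.conc_mom'[of w]] by (cases "set w \<subseteq> L \<and> set w \<inter> S \<noteq> {}") auto
  qed
  have AE: "AE \<omega> in M.
         (\<forall>P \<in> algA k l. (\<lambda>N. ntr N (A N) (\<lambda>j. U N \<omega> * B N j * transpose_mat (U N \<omega>)) P)
            \<longlonglongrightarrow> ext m P) \<and>
         (\<forall>P \<in> idealI k k' l l'. (\<lambda>N. of_nat N *
            ntr N (A N) (\<lambda>j. U N \<omega> * B N j * transpose_mat (U N \<omega>)) P)
            \<longlonglongrightarrow> ext m' P)"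
    using AE1 AE2
  proof eventually_elim
    case (elim \<omega>)
    have "(\<lambda>N. ntr N (A N) (\<lambda>j. U N \<omega> * B N j * transpose_mat (U N \<omega>)) P) \<longlonglongrightarrow> ext m P"
      if P: "P \<in> algA k l" for P
      unfolding ntrU[OF P] ext_divide
    proof (rule ext_tendsto)
      fix w assume w: "w \<in> Poly_Mapping.keys P"
      have "(\<lambda>N. H.T N \<omega> (ncletters w) / real N) \<longlonglongrightarrow> H.mom (ncletters w)"
        using elim(1) keysL[OF P[unfolded A] w] by blast
      from tendsto_of_real[OF this, where 'a = complex]
      show "(\<lambda>N. complex_of_real (wtr N (conj_letters Y (U N \<omega>) (Z N)) (ncletters w)) / of_nat N)
          \<longlonglongrightarrow> m (ncletters w)"
        by (simp add: m_def H.T_def)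
    qed
    moreover have "(\<lambda>N. of_nat N * ntr N (A N) (\<lambda>j. U N \<omega> * B N j * transpose_mat (U N \<omega>)) P) \<longlonglongrightarrow> ext m' P"
      if P: "P \<in> idealI k k' l l'" for P
      unfolding ntrU[OF I_alg[OF P]] cancel m'_def H.T_def[symmetric]
    proof (rule ext_tendsto)
      fix w assume w: "w \<in> Poly_Mapping.keys P"
      have "P \<in> words_through ok small" using P I by blast
      from keysS[OF this w] show "(\<lambda>N. complex_of_real (H.T N \<omega> (ncletters w))) \<longlonglongrightarrow> complex_of_real (H.mom' (ncletters w))"
        using elim(2) by (intro tendsto_of_real) blast
    qed
    ultimately show ?case by blast
  qed
  have alg: "F.alg i = (if i = 1 then algA1 k else algA2 l)" for i
    by (simp add: F.alg_def A1 A2)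
  have centered: "(\<forall>(i, a)\<in>set xs. i \<in> {1, 2} \<and> a \<in> (if i = 1 then algA1 k else algA2 l) \<and> ext m a = 0)
      \<longleftrightarrow> F.centered xs" for xs
    by (simp only: F.centered_def alg)
  have alternating: "alternating xs \<longleftrightarrow> distinct_adj xs" for xs
    by (simp add: alternating_def distinct_adj_conv_nth)
  have free: "free_type_B (ext m) (ext m') (algA1 k) (algA2 l) (idealI1 k k') (idealI2 l l')"
    unfolding free_type_B_def Let_def centered alternating
  proof (intro conjI allI impI)
    fix xs assume "xs \<noteq> [] \<and> F.centered xs \<and> distinct_adj (map fst xs)"
    then show "ext m (prod_list (map snd xs)) = 0" using F.free[of xs] by (simp add: pl_def)
  next
    fix as bs h v
    assume *: "F.centered as \<and> F.centered bs \<and> h \<in> {1, 2} \<and> v \<in> (if h = 1 then idealI1 k k' else idealI2 l l')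
      \<and> distinct_adj (rev (map fst as) @ [h] @ map fst bs)"
    have "v \<in> words_through ok small" using * I1' I2' by (auto split: if_splits)
    moreover have "v \<in> F.alg h"
      using * I1 I2 words_through_over by (auto simp: F.alg_def split: if_splits)
    ultimately show "ext m' (prod_list (rev (map snd as)) * v * prod_list (map snd bs)) =
       (if map fst as = map fst bs then (\<Prod>r<length as. ext m (snd (as ! r) * snd (bs ! r))) * ext m' v else 0)"
      using * F.typeB[of v h as bs] by (simp add: pl_def rev_map)
  qed
  show ?thesis
    by (rule exI[of _ "ext m"], rule exI[of _ "ext m'"]) (use ext1 ext2 lin E1 E2 free AE in blast)
qed

end
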